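(* Let $\mathcal A$ be a commutative $W^*$-algebra, let $\mathcal H$ be a finitely or countably generated Hilbert $\mathcal A$-module, and let $\mathcal G$ be a unitary group on $\mathcal H$ such that $l^2_{\mathcal G}(\mathcal A)$ is self-dual. Then the set of all complete Parseval frame vectors for $\mathcal G$ is path-connected in the norm topology of $\mathcal H$ (i.e. any two complete Parseval frame vectors for $\mathcal G$ can be joined by a norm-continuous path of complete Parseval frame vectors for $\mathcal G$).
   Context: Hilbert $\mathcal A$-modules are left modules over a $C^*$-algebra $\mathcal A$ with an $\mathcal A$-valued inner product $\langle\cdot,\cdot\rangle$ that is $\mathcal A$-linear in the first variable and satisfies $\langle x,y\rangle=\langle y,x\rangle^*$; they are complete in the norm $\|x\|=\|\langle x,x\rangle\|^{1/2}$. $\mathcal H$ is finitely (resp. countably) generated if it has a finite (algebraic) generating set (resp. a countable set of generators). A $W^*$-algebra is a $C^*$-algebra that is a dual Banach space; it is unital. A unitary group on $\mathcal H$ is a group $\mathcal G$ (under composition) of unitary (adjointable) operators on $\mathcal H$. $l^2_{\mathcal G}(\mathcal A)$ is the Hilbert $\mathcal A$-module of all families $\{a_U\}_{U\in\mathcal G}\subseteq\mathcal A$ such that $\sum_{U\in\mathcal G}a_Ua_U^*$ converges in norm, with inner product $\langle\{a_U\},\{b_U\}\rangle=\sum_U a_Ub_U^*$. A Hilbert $\mathcal A$-module $\mathcal K$ is self-dual if every bounded $\mathcal A$-linear map $\mathcal K\to\mathcal A$ has the form $x\mapsto\langle x,y\rangle$ for some $y\in\mathcal K$. A family $\{x_j\}_{j\in\mathbb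 J}$ in $\mathcal H$ ($\mathbb J$ finite or countable) is a Parseval frame for $\mathcal H$ if $\sum_{j}\langle x,x_j\rangle\langle x_j,x\rangle=\langle x,x\rangle$ for all $x\in\mathcal H$, with the sum converging in norm. A vector $\xi\in\mathcal H$ is a complete Parseval frame vector for $\mathcal G$ if the family $\{U\xi\}_{U\in\mathcal G}$ is a Parseval frame for $\mathcal H$. *)

theory Defs
  imports "HOL-Analysis.Analysis"
begin

section \<open>Complex Banach spaces and C*-algebras\<close>

class complex_banach = banach +
  fixes scaleC :: "complex \<Rightarrow> 'a \<Rightarrow> 'a"  (infixr \<open>*\<^sub>C\<close> 75)
  assumes scaleC_add_right: "c *\<^sub>C (x + y) = c *\<^sub>C x + c *\<^sub>C y"
    and scaleC_add_left: "(c + d) *\<^sub>C x = c *\<^sub>C x + d *\<^sub>C x"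
    and scaleC_scaleC: "c *\<^sub>C (d *\<^sub>C x) = (c * d) *\<^sub>C x"
    and scaleC_of_real: "complex_of_real r *\<^sub>C x = r *\<^sub>R x"
    and norm_scaleC: "norm (c *\<^sub>C x) = cmod c * norm x"

text \<open>Neither a unit nor commutativity is assumed. The zero algebra is allowed.\<close>

class cstar_algebra = complex_banach + real_normed_algebra +
  fixes star :: "'a \<Rightarrow> 'a"
  assumes mult_scaleC_left: "(c *\<^sub>C a) * b = c *\<^sub>C (a * b)"
    and mult_scaleC_right: "a * (c *\<^sub>C b) = c *\<^sub>C (a * b)"
    and star_add: "star (a + b) = star a + star b"
    and star_scaleC: "star (c *\<^sub>C a) = cnj c *\<^sub>C star a"
    and star_mult: "star (a * b) = star b * star a"
    and star_star: "star (star a) = a"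
    and norm_star_mult: "norm (star a * a) = (norm a)\<^sup>2"

definition cstar_positive :: "'a::cstar_algebra \<Rightarrow> bool" where
  "cstar_positive a \<longleftrightarrow> (\<exists>b. a = star b * b)"

definition topological_dual :: "('p::complex_banach \<Rightarrow> complex) set" where
  "topological_dual = {f. bounded_linear f \<and> (\<forall>c x. f (c *\<^sub>C x) = c * f x)}"

text \<open>
  A W*-algebra is a C*-algebra that is isometrically isomorphic, as a complex Banach space, to
  the dual of some complex Banach space. HOL cannot quantify existentially over types, so the
  predual is a type parameter. A theorem that assumes this predicate for a type variable
  \<open>'p\<close> not occurring in its conclusion is a theorem about all algebras possessing a predual.
  Such algebras are automatically unital, so a unit is not part of the definition.
\<close>

definition wstar_algebra_with_predual ::
    "'a::cstar_algebra itself \<Rightarrow> 'p::complex_banach itself \<Rightarrow> bool" where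
  "wstar_algebra_with_predual _ _ \<longleftrightarrow>
    (\<exists>T :: 'a \<Rightarrow> 'p \<Rightarrow> complex.
       (\<forall>a b p. T (a + b) p = T a p + T b p) \<and>
       (\<forall>c a p. T (c *\<^sub>C a) p = c * T a p) \<and>
       range T = topological_dual \<and>
       (\<forall>a. onorm (T a) = norm a))"

section \<open>Hilbert modules\<close>

text \<open>
  Completeness of the module is part of the class \<open>banach\<close>, whose norm is tied to the inner
  product by \<open>norm_eq_ip\<close>.
\<close>

locale hilbert_module =
  fixes act :: "'a::cstar_algebra \<Rightarrow> 'h::complex_banach \<Rightarrow> 'h"
    and ip :: "'h \<Rightarrow> 'h \<Rightarrow> 'a"
  assumes act_add_right: "act a (x + y) = act a x + act a y"
    and act_add_left: "act (a + b) x = act a x + act b x"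
    and act_act: "act a (act b x) = act (a * b) x"
    and act_scaleC_left: "act (c *\<^sub>C a) x = c *\<^sub>C act a x"
    and act_scaleC_right: "act a (c *\<^sub>C x) = c *\<^sub>C act a x"
    and ip_add_left: "ip (x + y) z = ip x z + ip y z"
    and ip_scaleC_left: "ip (c *\<^sub>C x) y = c *\<^sub>C ip x y"
    and ip_act_left: "ip (act a x) y = a * ip x y"
    and ip_star: "ip x y = star (ip y x)"
    and ip_positive: "cstar_positive (ip x x)"
    and norm_eq_ip: "norm x = sqrt (norm (ip x x))"

definition module_span :: "('a \<Rightarrow> 'h \<Rightarrow> 'h) \<Rightarrow> 'h set \<Rightarrow> 'h::comm_monoid_add set" where
  "module_span act S = {(\<Sum>x\<in>F. act (c x) x) | F c. finite F \<and> F \<subseteq> S}"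

definition finitely_generated :: "('a \<Rightarrow> 'h \<Rightarrow> 'h::complex_banach) \<Rightarrow> bool" where
  "finitely_generated act \<longleftrightarrow> (\<exists>S. finite S \<and> module_span act S = UNIV)"

text \<open>
  As usual for Hilbert modules, generation by a finite set is meant algebraically, generation
  by a countable set topologically.
\<close>

definition countably_generated :: "('a \<Rightarrow> 'h \<Rightarrow> 'h::complex_banach) \<Rightarrow> bool" where
  "countably_generated act \<longleftrightarrow> (\<exists>S. countable S \<and> closure (module_span act S) = UNIV)"

text \<open>An operator that has an adjoint is automatically bounded and module-linear.\<close>

definition unitary_operator :: "('h \<Rightarrow> 'h \<Rightarrow> 'a) \<Rightarrow> ('h \<Rightarrow> 'h) \<Rightarrow> bool" where
  "unitary_operator ip U \<longleftrightarrow>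
    (\<exists>V. (\<forall>x y. ip (U x) y = ip x (V y)) \<and> V \<circ> U = id \<and> U \<circ> V = id)"

definition unitary_group :: "('h \<Rightarrow> 'h \<Rightarrow> 'a) \<Rightarrow> ('h \<Rightarrow> 'h) set \<Rightarrow> bool" where
  "unitary_group ip G \<longleftrightarrow>
    (\<forall>U\<in>G. unitary_operator ip U) \<and> id \<in> G \<and> (\<forall>U\<in>G. \<forall>V\<in>G. U \<circ> V \<in> G) \<and> (\<forall>U\<in>G. inv U \<in> G)"

section \<open>Self-duality and the standard module of square-summable families\<close>

text \<open>
  Self-duality of the Hilbert module with carrier \<open>K\<close> and the given operations. The norm of
  \<open>x\<close> is \<open>sqrt (norm (ip x x))\<close>.
\<close>

definition self_dual ::
    "'k set \<Rightarrow> ('k \<Rightarrow> 'k \<Rightarrow> 'k) \<Rightarrow> ('a \<Rightarrow> 'k \<Rightarrow> 'k) \<Rightarrow> ('k \<Rightarrow> 'k \<Rightarrow> 'a::cstar_algebra) \<Rightarrow> bool" where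
  "self_dual K add act ip \<longleftrightarrow>
    (\<forall>\<phi>. (\<forall>x\<in>K. \<forall>y\<in>K. \<phi> (add x y) = \<phi> x + \<phi> y) \<longrightarrow>
         (\<forall>a. \<forall>x\<in>K. \<phi> (act a x) = a * \<phi> x) \<longrightarrow>
         (\<exists>C. \<forall>x\<in>K. norm (\<phi> x) \<le> C * sqrt (norm (ip x x))) \<longrightarrow>
         (\<exists>y\<in>K. \<forall>x\<in>K. \<phi> x = ip x y))"

text \<open>
  Families indexed by \<open>I\<close> are functions vanishing outside \<open>I\<close>. The sums are unconditional;
  since the terms \<open>f i * star (f i)\<close> are positive, this agrees with norm convergence of the
  series in any fixed enumeration.
\<close>

definition l2_carrier :: "'i set \<Rightarrow> ('i \<Rightarrow> 'a::cstar_algebra) set" where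
  "l2_carrier I = {f. (\<forall>i. i \<notin> I \<longrightarrow> f i = 0) \<and> (\<lambda>i. f i * star (f i)) summable_on I}"

definition l2_ip :: "'i set \<Rightarrow> ('i \<Rightarrow> 'a) \<Rightarrow> ('i \<Rightarrow> 'a) \<Rightarrow> 'a::cstar_algebra" where
  "l2_ip I f g = (\<Sum>\<^sub>\<infinity>i\<in>I. f i * star (g i))"

definition l2_self_dual :: "'a::cstar_algebra itself \<Rightarrow> 'i set \<Rightarrow> bool" where
  "l2_self_dual _ I \<longleftrightarrow>
    self_dual (l2_carrier I :: ('i \<Rightarrow> 'a) set)
      (\<lambda>f g i. f i + g i) (\<lambda>a f i. a * f i) (l2_ip I)"

section \<open>Parseval frames\<close>

definition parseval_frame :: "('h \<Rightarrow> 'h \<Rightarrow> 'a::cstar_algebra) \<Rightarrow> 'j set \<Rightarrow> ('j \<Rightarrow> 'h) \<Rightarrow> bool" where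
  "parseval_frame ip J f \<longleftrightarrow>
    countable J \<and> (\<forall>x. ((\<lambda>j. ip x (f j) * ip (f j) x) has_sum ip x x) J)"

definition complete_parseval_frame_vector ::
    "('h \<Rightarrow> 'h \<Rightarrow> 'a::cstar_algebra) \<Rightarrow> ('h \<Rightarrow> 'h) set \<Rightarrow> 'h \<Rightarrow> bool" where
  "complete_parseval_frame_vector ip G \<xi> \<longleftrightarrow> parseval_frame ip G (\<lambda>U. U \<xi>)"

end

theory Submission
  imports Defs
begin

text \<open>
  Fix a complete Parseval frame vector \<open>\<xi>\<close>. On the adjointable operators commuting with \<open>G\<close> the map
  \<open>\<tau> X = \<langle>X \<xi>, \<xi>\<rangle>\<close> is a trace with values in the algebra, and \<open>J \<xi>\<close> is again a complete Parseval frame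
  vector for every unitary \<open>J\<close> among these operators. For a second such vector \<open>\<eta>\<close> let
  \<open>K x = \<Sum>U. \<langle>x, U \<xi>\<rangle> U \<eta>\<close>.

  If the real part of \<open>K\<close> is at least \<open>-3/4\<close>, the vectors on the segment from \<open>\<xi>\<close> to \<open>\<eta>\<close> have frame
  operators bounded below by \<open>1/8\<close>, and normalizing them with the inverse square root gives a path.
  Otherwise let \<open>E\<close> be the spectral projection on which the real part of \<open>K\<close> is at most \<open>-l\<close>, where
  \<open>l \<ge> 1/2\<close>. Replacing \<open>\<xi>\<close> by \<open>(1 - 2 E) \<xi>\<close> increases the real part of \<open>\<tau> K\<close> by at least \<open>\<tau> E\<close>. Iterating
  this, the sums of the \<open>\<tau> (E n)\<close> stay bounded, and they converge in norm: for infinite \<open>G\<close> by the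
  self-duality of the standard module, for finite \<open>G\<close> because \<open>\<tau> E \<le> 2 |G| (\<tau> E)\<^sup>2\<close> makes the \<open>E n\<close> vanish
  eventually. By the trace property the products of the reflections \<open>1 - 2 E n\<close> and their adjoints
  converge strongly, the limit satisfies the bound \<open>-3/4\<close>, and moving \<open>-1\<close> to \<open>1\<close> on the unit circle in all
  factors \<open>1 + (z - 1) E n\<close> gives a path back to \<open>\<xi>\<close>.

  The spectral projections exist because bounded monotone sequences in the algebra have infima, by
  weak* compactness, and because the module inherits self-duality from the standard module.
\<close>

text \<open>A single spectral step is not enough. The projection \<open>E\<close> commutes with the
  real part of \<open>K\<close> but not with \<open>K\<close> itself, so the real part of
  \<open>K (1 - 2 E)\<close> contains cross terms and may become very negative elsewhere. No
  operator inequality survives the step; the trace does, because it sees only the corner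
  \<open>E K E\<close>. Hence the iteration, and hence a measure of progress with values in the
  algebra. Bounded increasing sequences of the algebra need not converge in norm, but norm
  convergence of the traces is what makes the moved vectors converge. For finite \<open>G\<close>
  self-duality gives no information, since finite powers of a unital algebra are always self-dual;
  there the finite frame expansion forces a gap in the spectrum of \<open>\<tau> E\<close>. The
  trace property also makes an operator and its adjoint equally large at \<open>\<xi>\<close>. Both
  are needed: the adjoints move \<open>\<xi>\<close>, and the strong limit of the operators carries
  the Parseval identity over. The constants are not rigid. Any lower bound above \<open>-1\<close>
  keeps the segment nondegenerate, and any positive lower bound for \<open>l\<close> gives a
  definite gain.\<close>

section \<open>The Banach algebra of bounded operators\<close>

text \<open>
  A copy of \<open>'a \<Rightarrow>\<^sub>L 'a\<close> on which composition can be written as multiplication. It is not made an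
  instance of \<open>ring_1\<close>, since \<open>0 = 1\<close> on the zero space.
\<close>

typedef (overloaded) 'a endo = "UNIV :: ('a::real_normed_vector \<Rightarrow>\<^sub>L 'a) set"
  morphisms blin Endo by simp

setup_lifting type_definition_endo

lift_definition ap :: "'a::real_normed_vector endo \<Rightarrow> 'a \<Rightarrow> 'a" is blinfun_apply .

instantiation endo :: (real_normed_vector) real_normed_algebra
begin

lift_definition zero_endo :: "'a endo" is 0 .
lift_definition plus_endo :: "'a endo \<Rightarrow> 'a endo \<Rightarrow> 'a endo" is "(+)" .
lift_definition minus_endo :: "'a endo \<Rightarrow> 'a endo \<Rightarrow> 'a endo" is "(-)" .
lift_definition uminus_endo :: "'a endo \<Rightarrow> 'a endo" is "uminus" .
lift_definition scaleR_endo :: "real \<Rightarrow> 'a endo \<Rightarrow> 'a endo" is "(*\<^sub>R)" .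
lift_definition times_endo :: "'a endo \<Rightarrow> 'a endo \<Rightarrow> 'a endo" is "(o\<^sub>L)" .
lift_definition norm_endo :: "'a endo \<Rightarrow> real" is norm .
lift_definition dist_endo :: "'a endo \<Rightarrow> 'a endo \<Rightarrow> real" is dist .
lift_definition sgn_endo :: "'a endo \<Rightarrow> 'a endo" is sgn .

definition uniformity_endo :: "('a endo \<times> 'a endo) filter" where
  "uniformity_endo = (INF e\<in>{0<..}. principal {(x, y). dist x y < e})"

definition open_endo :: "'a endo set \<Rightarrow> bool" where
  "open_endo U \<longleftrightarrow> (\<forall>x\<in>U. eventually (\<lambda>(x', y). x' = x \<longrightarrow> y \<in> U) uniformity)"

instance
proof
  fix a b c :: "'a endo" and r s :: real and U :: "'a endo set"
  show "a + b + c = a + (b + c)" "a + b = b + a" "0 + a = a" "- a + a = 0" "a - b = a + - b"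
    by (transfer; simp)+
  show "a * b * c = a * (b * c)"
    by transfer (rule blinfun_eqI, simp)
  show "(a + b) * c = a * c + b * c" "a * (b + c) = a * b + a * c"
    by (transfer; rule blinfun_eqI; simp add: blinfun.bilinear_simps)+
  show "r *\<^sub>R (a + b) = r *\<^sub>R a + r *\<^sub>R b" "(r + s) *\<^sub>R a = r *\<^sub>R a + s *\<^sub>R a"
    "r *\<^sub>R s *\<^sub>R a = (r * s) *\<^sub>R a" "1 *\<^sub>R a = a"
    by (transfer; simp add: algebra_simps)+
  show "r *\<^sub>R a * b = r *\<^sub>R (a * b)" "a * r *\<^sub>R b = r *\<^sub>R (a * b)"
    by (transfer; rule blinfun_eqI; simp add: blinfun.bilinear_simps)+
  show "norm (a + b) \<le> norm a + norm b" "norm (r *\<^sub>R a) = \<bar>r\<bar> * norm a" "norm a = 0 \<longleftrightarrow> a = 0"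
    by (transfer; simp add: norm_triangle_ineq)+
  show "norm (a * b) \<le> norm a * norm b"
    by transfer (rule norm_blinfun_compose)
  show "dist a b = norm (a - b)" by transfer (simp add: dist_norm)
  show "sgn a = inverse (norm a) *\<^sub>R a" by transfer (simp add: sgn_div_norm)
  show "uniformity = (INF e\<in>{0<..}. principal {(x, y :: 'a endo). dist x y < e})"
    by (rule uniformity_endo_def)
  show "open U \<longleftrightarrow> (\<forall>x\<in>U. eventually (\<lambda>(x', y). x' = x \<longrightarrow> y \<in> U) uniformity)"
    by (rule open_endo_def)
qed

end

instantiation endo :: (real_normed_vector) monoid_mult
begin

lift_definition one_endo :: "'a endo" is id_blinfun .

instance
  by standard (transfer; rule blinfun_eqI; simp)+

end

instance endo :: (banach) banach
proof
  fix X :: "nat \<Rightarrow> 'a endo"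
  assume "Cauchy X"
  then have "Cauchy (\<lambda>n. blin (X n))"
    unfolding Cauchy_def by (simp add: dist_endo.rep_eq)
  then obtain l where "(\<lambda>n. blin (X n)) \<longlonglongrightarrow> l"
    using Cauchy_convergent convergent_def by blast
  then have "X \<longlonglongrightarrow> Endo l"
    by (simp add: lim_sequentially dist_endo.rep_eq Endo_inverse)
  then show "convergent X" by (auto simp: convergent_def)
qed

lemma endo_eqI: "(\<And>x. ap X x = ap Y x) \<Longrightarrow> X = Y"
  by transfer (rule blinfun_eqI)

lemma ap_simps [simp]:
  "ap 0 x = 0" "ap 1 x = x" "ap (X + Y) x = ap X x + ap Y x" "ap (X - Y) x = ap X x - ap Y x"
  "ap (- X) x = - ap X x" "ap (r *\<^sub>R X) x = r *\<^sub>R ap X x" "ap (X * Y) x = ap X (ap Y x)"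
  by (transfer; simp add: blinfun.bilinear_simps)+

lemma bounded_bilinear_ap: "bounded_bilinear ap"
proof
  show "\<exists>K. \<forall>a b. norm (ap a b) \<le> norm a * norm b * K" for a :: "'a endo"
    by (rule exI[of _ 1], transfer) (simp add: norm_blinfun)
qed (transfer; simp add: blinfun.bilinear_simps)+

interpretation ap: bounded_bilinear ap by (rule bounded_bilinear_ap)

lemma norm_ap: "norm (ap X x) \<le> norm X * norm x"
  by transfer (rule norm_blinfun)

lemma norm_endo_le: "0 \<le> b \<Longrightarrow> (\<And>x. norm (ap X x) \<le> b * norm x) \<Longrightarrow> norm X \<le> b"
  by transfer (rule norm_blinfun_bound)

lemma norm_one_endo: "norm (1 :: 'a::real_normed_vector endo) \<le> 1"
  by (rule norm_endo_le) auto

definition endo_of :: "('a::real_normed_vector \<Rightarrow> 'a) \<Rightarrow> 'a endo" where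
  "endo_of f = Endo (Blinfun f)"

lemma ap_endo_of: "bounded_linear f \<Longrightarrow> ap (endo_of f) x = f x"
  by (simp add: endo_of_def ap.rep_eq Endo_inverse bounded_linear_Blinfun_apply)

section \<open>Square roots in Banach algebras\<close>

text \<open>
  If there is a unit, then \<open>(1 - w)\<^sup>2 = 1 - d\<close>. The last conclusion transfers algebraic properties
  of \<open>d\<close> to \<open>w\<close>.
\<close>

lemma half_square_solution:
  fixes d :: "'b::{real_normed_algebra, banach}"
  assumes d: "norm d \<le> 1"
  obtains w where "d + w * w = 2 *\<^sub>R w" "norm w \<le> 1"
    "\<And>S. closed S \<Longrightarrow> 0 \<in> S \<Longrightarrow> (\<And>x. x \<in> S \<Longrightarrow> (1/2) *\<^sub>R (d + x * x) \<in> S) \<Longrightarrow> w \<in> S"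
proof -
  define u where "u = rec_nat 0 (\<lambda>n x. (1/2) *\<^sub>R (d + x * x))"
  \<comment> \<open>The same iteration in the reals, for the largest norm allowed, majorizes
    \<open>u\<close> and its increments. As \<open>v\<close> increases and stays below 1, the
    increments are summable even if \<open>norm d = 1\<close>.\<close>
  define v :: "nat \<Rightarrow> real" where "v = rec_nat 0 (\<lambda>n x. (1/2) * (1 + x * x))"
  have u0: "u 0 = 0" and uS: "\<And>n. u (Suc n) = (1/2) *\<^sub>R (d + u n * u n)"
    by (simp_all add: u_def)
  have v0: "v 0 = 0" and vS: "\<And>n. v (Suc n) = (1/2) * (1 + v n * v n)"
    by (simp_all add: v_def)
  have v01: "0 \<le> v n \<and> v n \<le> 1" for n
  proof (induction n)
    case (Suc n)
    then have "v n * v n \<le> 1" by (simp add: mult_le_one)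
    then show ?case by (simp add: vS)
  qed (simp add: v0)
  have un: "norm (u n) \<le> v n" for n
  proof (induction n)
    case (Suc n)
    have "norm (d + u n * u n) \<le> norm d + norm (u n) * norm (u n)"
      using norm_triangle_ineq[of d "u n * u n"] norm_mult_ineq[of "u n" "u n"] by linarith
    also have "\<dots> \<le> 1 + v n * v n"
      using d Suc v01[of n] by (intro add_mono mult_mono) auto
    finally show ?case by (simp add: uS vS)
  qed (simp add: u0 v0)
  have step: "norm (u (Suc n) - u n) \<le> v (Suc n) - v n" for n
  proof (induction n)
    case 0
    show ?case using d by (simp add: uS vS u0 v0)
  next
    case (Suc n)
    let ?a = "u (Suc n)" and ?b = "u n"
    have "u (Suc (Suc n)) - u (Suc n) = (1/2) *\<^sub>R (d + ?a * ?a) - (1/2) *\<^sub>R (d + ?b * ?b)"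
      by (rule arg_cong2[where f = "(-)", OF uS[of "Suc n"] uS[of n]])
    also have "\<dots> = (1/2) *\<^sub>R (?a * (?a - ?b) + (?a - ?b) * ?b)"
      by (simp add: algebra_simps)
    also have "norm \<dots> \<le> (1/2) * (norm ?a * norm (?a - ?b) + norm (?a - ?b) * norm ?b)"
      using norm_triangle_ineq[of "?a * (?a - ?b)" "(?a - ?b) * ?b"]
        norm_mult_ineq[of ?a "?a - ?b"] norm_mult_ineq[of "?a - ?b" ?b] by simp
    also have "\<dots> \<le> (1/2) * (v (Suc n) * (v (Suc n) - v n) + (v (Suc n) - v n) * v n)"
      using Suc un[of n] un[of "Suc n"] v01[of n] v01[of "Suc n"]
        order_trans[OF norm_ge_zero Suc]
      by (intro mult_left_mono add_mono mult_mono) auto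
    also have "\<dots> = (1/2) * (1 + v (Suc n) * v (Suc n)) - (1/2) * (1 + v n * v n)"
      by (simp add: algebra_simps)
    also have "\<dots> = v (Suc (Suc n)) - v (Suc n)"
      by (rule arg_cong2[where f = "(-)", OF vS[of "Suc n", symmetric] vS[of n, symmetric]])
    finally show ?case .
  qed
  have "summable (\<lambda>n. v (Suc n) - v n)"
  proof -
    have "incseq v"
      by (rule incseq_SucI) (use order_trans[OF norm_ge_zero step] in simp)
    then have "convergent v"
      using v01 by (metis incseq_convergent convergentI)
    then show ?thesis
      by (simp add: summable_iff_convergent sum_lessThan_telescope v0)
  qed
  then have "summable (\<lambda>n. u (Suc n) - u n)"
    by (rule summable_comparison_test'[where N=0]) (use step in auto)
  then have "convergent u"
    by (simp add: summable_iff_convergent sum_lessThan_telescope u0)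
  then obtain w where w: "u \<longlonglongrightarrow> w" by (auto simp: convergent_def)
  show thesis
  proof
    have "(\<lambda>n. u (Suc n)) \<longlonglongrightarrow> (1/2) *\<^sub>R (d + w * w)"
      unfolding uS by (intro tendsto_intros w)
    with LIMSEQ_Suc[OF w] have "w = (1/2) *\<^sub>R (d + w * w)" by (rule LIMSEQ_unique)
    then have "2 *\<^sub>R w = 2 *\<^sub>R ((1/2) *\<^sub>R (d + w * w))" by simp
    then show "d + w * w = 2 *\<^sub>R w" by simp
    show "norm w \<le> 1"
      by (rule LIMSEQ_le_const2[OF tendsto_norm[OF w]]) (meson order_trans un v01)
    fix S assume S: "closed S" "0 \<in> S" "\<And>x. x \<in> S \<Longrightarrow> (1/2) *\<^sub>R (d + x * x) \<in> S"
    have "u n \<in> S" for n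
      by (induction n) (use S in \<open>auto simp: u0 uS\<close>)
    then show "w \<in> S" by (rule closed_sequentially[OF S(1) _ w])
  qed
qed

lemma norm_power_le:
  fixes d :: "'b::{real_normed_algebra, monoid_mult}"
  assumes "norm (1::'b) \<le> 1" "norm d \<le> q"
  shows "norm (d ^ n) \<le> q ^ n"
proof (induction n)
  case (Suc n)
  have "norm (d ^ Suc n) \<le> norm d * norm (d ^ n)"
    by (simp add: norm_mult_ineq)
  also have "\<dots> \<le> q * q ^ n"
    using Suc assms by (intro mult_mono) (auto intro: order_trans[OF norm_ge_zero])
  finally show ?case by simp
qed (use assms in simp)

text \<open>The coefficients of the binomial series of \<open>(1 - x) powr (-1/2)\<close>.\<close>

definition isqrt_coeff :: "nat \<Rightarrow> real" where
  "isqrt_coeff k = (- 1) ^ k * ((- 1/2) gchoose k)"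

lemma isqrt_coeff_bounds: "0 \<le> isqrt_coeff k \<and> isqrt_coeff k \<le> 1"
proof (induction k)
  case (Suc k)
  have "(real k + 1) * ((- 1/2) gchoose Suc k) = (- 1/2 - real k) * ((- 1/2) gchoose k)"
    using gbinomial_mult_1[of "- 1/2 :: real" k] by (simp add: algebra_simps)
  then have "((- 1/2) gchoose Suc k) = (- 1/2 - real k) * ((- 1/2) gchoose k) / (real k + 1)"
    by (simp add: eq_divide_eq mult.commute)
  then have "isqrt_coeff (Suc k) = isqrt_coeff k * ((1/2 + real k) / (real k + 1))"
    unfolding isqrt_coeff_def by (simp only: power_Suc) (simp add: field_simps)
  moreover have "0 \<le> (1/2 + real k) / (real k + 1)" "(1/2 + real k) / (real k + 1) \<le> 1"
    by simp_all
  ultimately show ?case using Suc by (metis mult_le_one mult_nonneg_nonneg)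
qed (simp add: isqrt_coeff_def)

text \<open>The square of the series for \<open>(1 - x) powr (-1/2)\<close> has to be the geometric
  series; by Vandermonde the convolution is \<open>(- 1) gchoose n\<close> up to the sign
  \<open>(- 1) ^ n\<close>.\<close>

lemma isqrt_coeff_conv: "(\<Sum>i\<le>n. isqrt_coeff i * isqrt_coeff (n - i)) = 1"
proof -
  have "(\<Sum>i\<le>n. isqrt_coeff i * isqrt_coeff (n - i))
      = (\<Sum>i\<le>n. (- 1) ^ n * (((- 1/2) gchoose i) * ((- 1/2) gchoose (n - i))))"
  proof (rule sum.cong)
    fix i assume "i \<in> {..n}"
    then have "(- 1) ^ n = (- 1 :: real) ^ i * (- 1) ^ (n - i)"
      by (simp flip: power_add)
    then show "isqrt_coeff i * isqrt_coeff (n - i)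
        = (- 1) ^ n * (((- 1/2) gchoose i) * ((- 1/2) gchoose (n - i)))"
      unfolding isqrt_coeff_def by (simp only: mult_ac)
  qed simp
  also have "\<dots> = (- 1) ^ n * (\<Sum>i\<le>n. ((- 1/2) gchoose i) * ((- 1/2) gchoose (n - i)))"
    by (rule sum_distrib_left[symmetric])
  also have "\<dots> = (- 1) ^ n * ((- 1/2 + - 1/2) gchoose n)"
    using gbinomial_Vandermonde[of "- 1/2 :: real" "- 1/2" n] by (simp only: atLeast0AtMost)
  also have "((- 1/2 + - 1/2 :: real) gchoose n) = (- 1) ^ n * (real n gchoose n)"
    using gbinomial_minus[of "1::real" n] by simp
  also have "real n gchoose n = 1"
    using binomial_gbinomial[of n n, where ?'a = real] by simp
  finally show ?thesis by (simp flip: power_mult_distrib)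
qed

text \<open>This is the inverse square root of \<open>1 - d\<close>, as a function of
  \<open>d\<close>; its value at 0 is 1.\<close>

definition isqrt :: "'b::{real_normed_algebra, monoid_mult, banach} \<Rightarrow> 'b" where
  "isqrt d = (\<Sum>k. isqrt_coeff k *\<^sub>R d ^ k)"

lemma
  fixes d :: "'b::{real_normed_algebra, monoid_mult, banach}"
  assumes one: "norm (1::'b) \<le> 1" and d: "norm d \<le> q" and q: "q < 1"
  shows summable_isqrt: "summable (\<lambda>k. norm (isqrt_coeff k *\<^sub>R d ^ k))"
    and isqrt_square: "isqrt d * isqrt d * (1 - d) = 1"
proof -
  have q0: "0 \<le> q" using d norm_ge_zero order_trans by blast
  have geo: "summable (\<lambda>k. q ^ k)" using q q0 by (simp add: summable_geometric)
  have "norm (isqrt_coeff k *\<^sub>R d ^ k) \<le> q ^ k" for k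
    using mult_mono[OF conjunct2[OF isqrt_coeff_bounds] norm_power_le[OF one d], of k k]
      isqrt_coeff_bounds[of k] by simp
  then show s: "summable (\<lambda>k. norm (isqrt_coeff k *\<^sub>R d ^ k))"
    by (intro summable_comparison_test'[OF geo, of 0]) auto
  have "(\<lambda>k. \<Sum>i\<le>k. (isqrt_coeff i *\<^sub>R d ^ i) * (isqrt_coeff (k - i) *\<^sub>R d ^ (k - i)))
      sums (isqrt d * isqrt d)"
    unfolding isqrt_def by (rule Cauchy_product_sums[OF s s])
  moreover have "(\<Sum>i\<le>k. (isqrt_coeff i *\<^sub>R d ^ i) * (isqrt_coeff (k - i) *\<^sub>R d ^ (k - i))) = d ^ k" for k
  proof -
    have "(\<Sum>i\<le>k. (isqrt_coeff i *\<^sub>R d ^ i) * (isqrt_coeff (k - i) *\<^sub>R d ^ (k - i)))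
        = (\<Sum>i\<le>k. (isqrt_coeff i * isqrt_coeff (k - i)) *\<^sub>R d ^ k)"
      by (rule sum.cong) (auto simp: power_add[symmetric] mult_ac)
    then show ?thesis by (simp add: scaleR_sum_left[symmetric] isqrt_coeff_conv)
  qed
  ultimately have "(\<lambda>k. d ^ k) sums (isqrt d * isqrt d)" by simp
  then have "(\<lambda>k. d ^ k * (1 - d)) sums (isqrt d * isqrt d * (1 - d))"
    by (rule sums_mult2)
  then have 1: "(\<lambda>n. \<Sum>k<n. d ^ k * (1 - d)) \<longlonglongrightarrow> isqrt d * isqrt d * (1 - d)"
    by (simp add: sums_def)
  have "(\<Sum>k<n. d ^ k * (1 - d)) = 1 - d ^ n" for n
    by (induction n) (auto simp: algebra_simps power_commutes)
  with 1 have 2: "(\<lambda>n. 1 - d ^ n) \<longlonglongrightarrow> isqrt d * isqrt d * (1 - d)" by simp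
  have "(\<lambda>n. d ^ n) \<longlonglongrightarrow> 0"
    by (rule Lim_null_comparison[OF _ LIMSEQ_realpow_zero[OF q0 q]])
      (simp add: norm_power_le[OF one d])
  then have "(\<lambda>n. 1 - d ^ n) \<longlonglongrightarrow> 1 - 0" by (intro tendsto_intros)
  with 2 show "isqrt d * isqrt d * (1 - d) = 1" by (metis LIMSEQ_unique diff_zero)
qed

text \<open>The partial sums are polynomials in \<open>d\<close>. Self-adjointness and commutation
  relations pass from \<open>d\<close> to the root in this way.\<close>

lemma isqrt_in_closed:
  fixes d :: "'b::{real_normed_algebra, monoid_mult, banach}"
  assumes one: "norm (1::'b) \<le> 1" and d: "norm d \<le> q" and q: "q < 1"
    and S: "closed S" "1 \<in> S" "0 \<in> S" "\<And>x. x \<in> S \<Longrightarrow> x * d \<in> S" "\<And>x y. x \<in> S \<Longrightarrow> y \<in> S \<Longrightarrow> x + y \<in> S"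
      "\<And>r x. x \<in> S \<Longrightarrow> r *\<^sub>R x \<in> S"
  shows "isqrt d \<in> S"
proof -
  have dk: "d ^ k \<in> S" for k
    by (induction k) (use S in \<open>auto simp flip: power_commutes\<close>)
  have "(\<Sum>k<n. isqrt_coeff k *\<^sub>R d ^ k) \<in> S" for n
    by (induction n) (use S dk in auto)
  moreover have "(\<lambda>n. \<Sum>k<n. isqrt_coeff k *\<^sub>R d ^ k) \<longlonglongrightarrow> isqrt d"
    using summable_LIMSEQ[OF summable_norm_cancel[OF summable_isqrt[OF one d q]]]
    unfolding isqrt_def .
  ultimately show ?thesis by (rule closed_sequentially[OF S(1)])
qed

lemma continuous_on_isqrt:
  fixes d :: "'t::topological_space \<Rightarrow> 'b::{real_normed_algebra, monoid_mult, banach}"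
  assumes one: "norm (1::'b) \<le> 1" and d: "\<And>t. t \<in> T \<Longrightarrow> norm (d t) \<le> q" and q: "0 \<le> q" "q < 1"
    and cont: "continuous_on T d"
  shows "continuous_on T (\<lambda>t. isqrt (d t))"
proof -
  have geo: "summable (\<lambda>k. q ^ k)" using q by (simp add: summable_geometric)
  have "norm (isqrt_coeff k *\<^sub>R d t ^ k) \<le> q ^ k" if "t \<in> T" for k t
    using mult_mono[OF conjunct2[OF isqrt_coeff_bounds] norm_power_le[OF one d[OF that]], of k k]
      isqrt_coeff_bounds[of k] by simp
  then have "uniform_limit T (\<lambda>n t. \<Sum>k<n. isqrt_coeff k *\<^sub>R d t ^ k)
      (\<lambda>t. \<Sum>k. isqrt_coeff k *\<^sub>R d t ^ k) sequentially"
    by (intro Weierstrass_m_test[OF _ geo]) auto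
  then show ?thesis
    unfolding isqrt_def
    by (rule uniform_limit_theorem[rotated]) (auto intro!: always_eventually continuous_intros cont)
qed

section \<open>Commutative C*-algebras\<close>

lemma scaleC_one [simp]: "1 *\<^sub>C x = (x::'a::complex_banach)"
  using scaleC_of_real[of 1 x] by simp

lemma scaleC_zero_left [simp]: "0 *\<^sub>C x = (0::'a::complex_banach)"
  using scaleC_of_real[of 0 x] by simp

lemma bounded_bilinear_scaleC: "bounded_bilinear ((*\<^sub>C) :: complex \<Rightarrow> 'a \<Rightarrow> 'a::complex_banach)"
proof
  fix c d :: complex and r :: real and x y :: 'a
  show "(r *\<^sub>R c) *\<^sub>C x = r *\<^sub>R c *\<^sub>C x"
    by (simp add: scaleR_conv_of_real scaleC_scaleC[symmetric] scaleC_of_real)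
  show "c *\<^sub>C r *\<^sub>R x = r *\<^sub>R c *\<^sub>C x"
    by (simp add: scaleC_of_real[symmetric] scaleC_scaleC mult.commute)
  show "\<exists>K. \<forall>c x. norm (c *\<^sub>C (x::'a)) \<le> norm c * norm x * K"
    by (rule exI[of _ 1]) (simp add: norm_scaleC)
qed (simp_all add: scaleC_add_left scaleC_add_right)

interpretation scaleC: bounded_bilinear "(*\<^sub>C)" by (rule bounded_bilinear_scaleC)

lemma scaleC_ii_ii [simp]: "\<i> *\<^sub>C \<i> *\<^sub>C x = - (x::'a::complex_banach)"
  by (simp add: scaleC_scaleC scaleC.minus_left)

lemma norm_mult_star: "norm (a * star a) = (norm (a::'a::cstar_algebra))\<^sup>2"
  and norm_star [simp]: "norm (star a) = norm a"
proof -
  have "norm b \<le> norm (star b)" for b :: 'a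
  proof (cases "b = 0")
    case False
    have "norm b * norm b \<le> norm (star b) * norm b"
      using norm_mult_ineq[of "star b" b] by (simp add: norm_star_mult power2_eq_square)
    then show ?thesis using False by simp
  qed simp
  from this[of a] this[of "star a"] show s: "norm (star a) = norm a"
    by (simp add: star_star)
  show "norm (a * star a) = (norm a)\<^sup>2"
    using norm_star_mult[of "star a"] by (simp add: star_star s)
qed

lemma bounded_linear_star: "bounded_linear (star :: 'a \<Rightarrow> 'a::cstar_algebra)"
proof
  fix r :: real and x :: 'a
  show "star (r *\<^sub>R x) = r *\<^sub>R star x"
    using star_scaleC[of "of_real r" x] by (simp add: scaleC_of_real)
  show "\<exists>K. \<forall>x::'a. norm (star x) \<le> norm x * K"
    by (rule exI[of _ 1]) simp
qed (rule star_add)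

lemmas star_diff = linear_diff [OF bounded_linear.linear [OF bounded_linear_star]]
lemmas star_minus = linear_neg [OF bounded_linear.linear [OF bounded_linear_star]]
lemmas star_scaleR = linear_scale [OF bounded_linear.linear [OF bounded_linear_star]]
lemmas star_zero [simp] = linear_0 [OF bounded_linear.linear [OF bounded_linear_star]]
lemmas star_sum = linear_sum [OF bounded_linear.linear [OF bounded_linear_star]]
lemmas tendsto_star = bounded_linear.tendsto [OF bounded_linear_star]
lemmas continuous_on_star = bounded_linear.continuous_on [OF bounded_linear_star]

declare star_star [simp]

definition re_part :: "'a::cstar_algebra \<Rightarrow> 'a" where
  "re_part c = (1/2) *\<^sub>R (c + star c)"

definition im_part :: "'a::cstar_algebra \<Rightarrow> 'a" where
  "im_part c = (1/2) *\<^sub>R \<i> *\<^sub>C (star c - c)"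

lemma star_re_part [simp]: "star (re_part c) = re_part c"
  by (simp add: re_part_def star_scaleR star_add add.commute)

lemma star_im_part [simp]: "star (im_part c) = im_part c"
  by (simp add: im_part_def star_scaleR star_scaleC star_diff scaleC.minus_left scaleC.diff_right)

lemma re_im_parts: "re_part c + \<i> *\<^sub>C im_part c = c" "re_part c - \<i> *\<^sub>C im_part c = star c"
proof -
  have "\<i> *\<^sub>C im_part c = (1/2) *\<^sub>R (c - star c)"
    by (simp add: im_part_def scaleC.scaleR_right)
  then show "re_part c + \<i> *\<^sub>C im_part c = c" "re_part c - \<i> *\<^sub>C im_part c = star c"
    by (simp_all add: re_part_def scaleR_add_right scaleR_diff_right) (simp_all flip: scaleR_add_left)
qed

text \<open>Self-adjoint multipliers take the place of the real elements of a unitization.\<close>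

definition multipliers :: "'a::{cstar_algebra, comm_ring} endo set" where
  "multipliers = {m. (\<forall>a b. ap m (a * b) = ap m a * b) \<and> (\<forall>a. star (ap m a) = ap m (star a))}"

definition lmul :: "'a::{cstar_algebra, comm_ring} \<Rightarrow> 'a endo" where
  "lmul x = endo_of ((*) x)"

lemma ap_lmul [simp]: "ap (lmul x) a = x * a"
  by (simp add: lmul_def ap_endo_of bounded_linear_mult_right)

lemma lmul_simps: "lmul (x + y) = lmul x + lmul y" "lmul (x - y) = lmul x - lmul y"
  "lmul (x * y) = lmul x * lmul y" "lmul (r *\<^sub>R x) = r *\<^sub>R lmul x" "lmul 0 = 0"
  by (rule endo_eqI; simp add: algebra_simps)+

text \<open>Testing at \<open>star x\<close> with the C*-identity replaces testing at a
  unit.\<close>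

lemma norm_lmul [simp]: "norm (lmul x) = norm x"
proof (rule antisym)
  show "norm (lmul x) \<le> norm x"
    by (rule norm_endo_le) (auto simp: norm_mult_ineq)
  show "norm x \<le> norm (lmul x)"
  proof (cases "x = 0")
    case False
    have "norm x * norm x \<le> norm (lmul x) * norm x"
      using norm_ap[of "lmul x" "star x"] by (simp add: norm_mult_star power2_eq_square)
    then show ?thesis using False by simp
  qed simp
qed

lemma lmul_multiplier: "star x = x \<Longrightarrow> lmul x \<in> multipliers"
  by (simp add: multipliers_def star_mult mult_ac)

lemma multipliersD:
  assumes "m \<in> multipliers"
  shows "ap m (a * b) = ap m a * b" "ap m (a * b) = a * ap m b" "star (ap m a) = ap m (star a)"
  using assms by (auto simp: multipliers_def) (metis mult.commute)

lemma multipliers_closed_under: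
  "0 \<in> multipliers" "1 \<in> multipliers"
  "m \<in> multipliers \<Longrightarrow> n \<in> multipliers \<Longrightarrow> m + n \<in> multipliers"
  "m \<in> multipliers \<Longrightarrow> n \<in> multipliers \<Longrightarrow> m - n \<in> multipliers"
  "m \<in> multipliers \<Longrightarrow> n \<in> multipliers \<Longrightarrow> m * n \<in> multipliers"
  "m \<in> multipliers \<Longrightarrow> r *\<^sub>R m \<in> multipliers"
  by (auto simp: multipliers_def star_add star_diff star_scaleR algebra_simps) (metis mult.commute)

text \<open>Both sides equal \<open>ap m a * ap n b\<close>. Only products are covered, since
  without a unit not every element is visibly a product.\<close>

lemma multipliers_commute:
  assumes "m \<in> multipliers" "n \<in> multipliers"
  shows "ap m (ap n (a * b)) = ap n (ap m (a * b))"
  by (metis assms multipliersD(1,2))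

lemma closed_multipliers: "closed multipliers"
proof -
  have *: "multipliers = (\<Inter>a. \<Inter>b. {m. ap m (a * b) = ap m a * b}) \<inter> (\<Inter>a. {m. star (ap m a) = ap m (star a)})"
    by (auto simp: multipliers_def)
  show ?thesis
    unfolding * by (intro closed_Int closed_INT ballI closed_Collect_eq continuous_intros
        ap.continuous_on continuous_on_star)
qed

text \<open>For \<open>z = m a + i n a\<close> or \<open>z = m a - i n a\<close> the cross terms of
  \<open>star z * z\<close> cancel by commutativity and leave
  \<open>(m m + n n) (star a * a)\<close>; the two versions of \<open>z\<close> add up to
  \<open>2 m a\<close>. Monotonicity of the norm on positive elements comes from here, without
  Gelfand theory.\<close>

lemma norm_multiplier_sum_squares:
  assumes m: "m \<in> multipliers" and n: "n \<in> multipliers"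
  shows "(norm m)\<^sup>2 \<le> norm (m * m + n * n)"
proof -
  define t where "t = norm (m * m + n * n)"
  have t0: "0 \<le> t" by (simp add: t_def)
  have bnd: "norm (ap m a + c *\<^sub>C ap n a) \<le> sqrt t * norm a" if c: "c = \<i> \<or> c = - \<i>" for a c
  proof -
    let ?z = "ap m a + c *\<^sub>C ap n a"
    have cc: "cnj c = - c" "c * c = -1" using c by auto
    have "star ?z * ?z = (ap m (star a) - c *\<^sub>C ap n (star a)) * (ap m a + c *\<^sub>C ap n a)"
      by (simp add: star_add star_scaleC cc multipliersD(3)[OF m] multipliersD(3)[OF n] scaleC.minus_left)
    also have "\<dots> = ap m (star a) * ap m a + ap n (star a) * ap n a
        + (c *\<^sub>C (ap m (star a) * ap n a) - c *\<^sub>C (ap n (star a) * ap m a))"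
      by (simp add: algebra_simps mult_scaleC_left mult_scaleC_right scaleC_scaleC cc scaleC.minus_left)
    also have "ap m (star a) * ap n a = ap n (star a) * ap m a"
      using multipliers_commute[OF m n, of "star a" a]
      by (metis m n multipliersD(1,2))
    also have "ap m (star a) * ap m a = ap m (ap m (star a * a))"
      by (metis m multipliersD(1,2))
    also have "ap n (star a) * ap n a = ap n (ap n (star a * a))"
      by (metis n multipliersD(1,2))
    finally have "star ?z * ?z = ap (m * m + n * n) (star a * a)" by simp
    then have "(norm ?z)\<^sup>2 = norm (ap (m * m + n * n) (star a * a))"
      by (metis norm_star_mult)
    also have "\<dots> \<le> t * (norm a)\<^sup>2"
      unfolding t_def by (rule order_trans[OF norm_ap]) (simp add: norm_star_mult)
    finally show ?thesis
      using real_le_rsqrt by (fastforce simp: real_sqrt_mult)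
  qed
  have "norm (ap m a) \<le> sqrt t * norm a" for a
  proof -
    have "2 *\<^sub>R ap m a = (ap m a + \<i> *\<^sub>C ap n a) + (ap m a + (- \<i>) *\<^sub>C ap n a)"
      by (simp add: scaleC.minus_left scaleR_2)
    then have "2 * norm (ap m a) = norm ((ap m a + \<i> *\<^sub>C ap n a) + (ap m a + (- \<i>) *\<^sub>C ap n a))"
      by (metis norm_scaleR abs_numeral)
    also have "\<dots> \<le> sqrt t * norm a + sqrt t * norm a"
      by (rule norm_triangle_mono) (auto intro: bnd)
    finally show ?thesis by simp
  qed
  then have "norm m \<le> sqrt t"
    by (intro norm_endo_le) (auto simp: t0)
  then show ?thesis
    using power_mono[of "norm m" "sqrt t" 2] t0 by (simp add: t_def)
qed

lemma multiplier_sqrt: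
  assumes m: "m \<in> multipliers" and "norm (1 - m) \<le> 1"
  obtains r where "r \<in> multipliers" "r * r = m"
proof -
  obtain w where w: "(1 - m) + w * w = 2 *\<^sub>R w"
    "\<And>S. closed S \<Longrightarrow> 0 \<in> S \<Longrightarrow> (\<And>x. x \<in> S \<Longrightarrow> (1/2) *\<^sub>R ((1 - m) + x * x) \<in> S) \<Longrightarrow> w \<in> S"
    using half_square_solution[OF assms(2)] by metis
  have "w \<in> multipliers"
    by (rule w(2)[OF closed_multipliers]) (intro multipliers_closed_under m; assumption)+
  moreover have "(1 - w) * (1 - w) = m"
    using w(1) by (simp add: algebra_simps scaleR_2)
  ultimately show thesis by (intro that[of "1 - w"] multipliers_closed_under)
qed

text \<open>If \<open>r * r = 1 - m * m\<close>, then \<open>r * r + m * m = 1\<close>, and the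
  bound for sums of squares gives \<open>norm r \<le> 1\<close>.\<close>

lemma multiplier_one_minus_square:
  assumes m: "m \<in> multipliers" and nm: "norm m \<le> 1"
  shows "norm (1 - m * m) \<le> 1"
proof -
  have "norm (1 - (1 - m * m)) \<le> 1"
    using norm_mult_ineq[of m m] nm by (simp add: mult_le_one order_trans)
  then obtain r where r: "r \<in> multipliers" "r * r = 1 - m * m"
    using multiplier_sqrt m by (metis multipliers_closed_under(2,4,5))
  have "(norm r)\<^sup>2 \<le> 1"
    using order_trans[OF norm_multiplier_sum_squares[OF r(1) m]] norm_one_endo by (simp add: r(2))
  then show ?thesis
    using norm_mult_ineq[of r r] by (simp add: r(2) power2_eq_square)
qed

text \<open>Positivity as membership in a ball around a multiple of 1. In this form it is visibly
  stable under sums, and the power series for the square root applies after scaling.\<close>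

definition pos_multiplier :: "'a::{cstar_algebra, comm_ring} endo \<Rightarrow> bool" where
  "pos_multiplier m \<longleftrightarrow> m \<in> multipliers \<and> (\<exists>t\<ge>0. norm (t *\<^sub>R 1 - m) \<le> t)"

lemma pos_multiplier_square:
  assumes m: "m \<in> multipliers" and t: "(norm m)\<^sup>2 \<le> t"
  shows "norm (t *\<^sub>R 1 - m * m) \<le> t"
proof (cases "t = 0")
  case False
  with t have t0: "t > 0" by (metis less_eq_real_def order_trans zero_le_power2)
  let ?n = "(1 / sqrt t) *\<^sub>R m"
  have "norm m \<le> sqrt t" by (rule real_le_rsqrt[OF t])
  then have "norm (1 - ?n * ?n) \<le> 1"
    using t0 by (intro multiplier_one_minus_square multipliers_closed_under m) (simp add: divide_simps)
  moreover have "t *\<^sub>R 1 - m * m = t *\<^sub>R (1 - ?n * ?n)"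
    using t0 by (simp add: scaleR_diff_right)
  ultimately show ?thesis using t0 by (simp add: mult_left_le)
qed (use t in simp)

lemma pos_multiplier_squareI: "m \<in> multipliers \<Longrightarrow> pos_multiplier (m * m)"
  unfolding pos_multiplier_def using pos_multiplier_square[OF _ order_refl]
  by (meson multipliers_closed_under(5) zero_le_power2)

lemma pos_multiplier_sqrt:
  assumes "pos_multiplier m"
  obtains r where "r \<in> multipliers" "r * r = m"
proof -
  obtain t where t: "m \<in> multipliers" "t \<ge> 0" "norm (t *\<^sub>R 1 - m) \<le> t"
    using assms by (auto simp: pos_multiplier_def)
  show thesis
  proof (cases "t = 0")
    case True
    then show thesis using t that[of 0] by (simp add: multipliers_closed_under)
  next
    case False
    with t have t0: "t > 0" by simp
    have "1 - (1/t) *\<^sub>R m = (1/t) *\<^sub>R (t *\<^sub>R 1 - m)" using t0 by (simp add: scaleR_diff_right)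
    then have "norm (1 - (1/t) *\<^sub>R m) \<le> 1" using t0 t by (simp add: divide_simps)
    then obtain r where "r \<in> multipliers" "r * r = (1/t) *\<^sub>R m"
      using multiplier_sqrt t(1) by (metis multipliers_closed_under(6))
    then show thesis
      using t0 by (intro that[of "sqrt t *\<^sub>R r"]) (simp_all add: multipliers_closed_under)
  qed
qed

lemma pos_multiplier_add: "pos_multiplier m \<Longrightarrow> pos_multiplier n \<Longrightarrow> pos_multiplier (m + n)"
  unfolding pos_multiplier_def
proof (elim conjE exE, intro conjI)
  fix s t assume "s \<ge> 0" "t \<ge> 0" "norm (s *\<^sub>R 1 - m) \<le> s" "norm (t *\<^sub>R 1 - n) \<le> t"
  moreover have "(s + t) *\<^sub>R 1 - (m + n) = (s *\<^sub>R 1 - m) + (t *\<^sub>R 1 - n)"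
    by (simp add: algebra_simps)
  ultimately show "\<exists>t\<ge>0. norm (t *\<^sub>R 1 - (m + n)) \<le> t"
    by (intro exI[of _ "s + t"]) (simp only: add_nonneg_nonneg norm_triangle_mono simp_thms)
qed (rule multipliers_closed_under)

lemma norm_pos_multiplier_le:
  assumes "pos_multiplier m" "pos_multiplier n"
  shows "norm m \<le> norm (m + n)"
proof -
  obtain r s where "r \<in> multipliers" "r * r = m" "s \<in> multipliers" "s * s = n"
    using assms pos_multiplier_sqrt by metis
  then show ?thesis
    using norm_multiplier_sum_squares[of r s] norm_mult_ineq[of r r]
    by (simp add: power2_eq_square)
qed

text \<open>By commutativity \<open>star b * b\<close> is the sum of the squares of the real and the
  imaginary part of \<open>b\<close>.\<close>

lemma pos_multiplier_lmul:
  assumes "cstar_positive (a::'a::{cstar_algebra, comm_ring})"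
  shows "pos_multiplier (lmul a)"
proof -
  obtain b where b: "a = star b * b" using assms by (auto simp: cstar_positive_def)
  let ?x = "re_part b" and ?y = "im_part b"
  have "a = (?x - \<i> *\<^sub>C ?y) * (?x + \<i> *\<^sub>C ?y)" by (simp only: b re_im_parts)
  also have "\<dots> = ?x * ?x + ?y * ?y"
    by (simp add: algebra_simps mult_scaleC_left mult_scaleC_right)
  finally have "lmul a = lmul ?x * lmul ?x + lmul ?y * lmul ?y" by (simp add: lmul_simps)
  then show ?thesis
    by (simp add: pos_multiplier_add pos_multiplier_squareI lmul_multiplier)
qed

lemma cstar_positive_mult_star: "cstar_positive (a * star (a::'a::{cstar_algebra, comm_ring}))"
  unfolding cstar_positive_def by (metis mult.commute)

lemma norm_le_sum_mult_star:
  fixes f :: "'i \<Rightarrow> 'a::{cstar_algebra, comm_ring}"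
  assumes F: "finite F" and j: "j \<in> F"
  shows "(norm (f j))\<^sup>2 \<le> norm (\<Sum>i\<in>F. f i * star (f i))"
proof -
  have sum: "pos_multiplier (lmul (\<Sum>i\<in>F'. f i * star (f i)))" if "finite F'" for F'
    using that
  proof (induction F')
    case empty
    have "pos_multiplier (lmul (0 * star 0 :: 'a))"
      by (intro pos_multiplier_lmul cstar_positive_mult_star)
    then show ?case by simp
  next
    case (insert i F')
    then show ?case
      by (simp add: lmul_simps(1) pos_multiplier_add pos_multiplier_lmul cstar_positive_mult_star)
  qed
  have "norm (f j * star (f j)) \<le> norm (f j * star (f j) + (\<Sum>i\<in>F - {j}. f i * star (f i)))"
    using norm_pos_multiplier_le[OF pos_multiplier_lmul[OF cstar_positive_mult_star[of "f j"]] sum[of "F - {j}"]] F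
    by (simp flip: lmul_simps(1))
  then show ?thesis
    by (simp add: norm_mult_star sum.remove[OF F j])
qed

text \<open>Self-duality represents the evaluation at a point of \<open>I\<close>, and this produces a unit.\<close>

lemma self_dual_imp_unit:
  assumes sd: "l2_self_dual TYPE('a::{cstar_algebra, comm_ring}) I" and j: "j \<in> I"
  obtains e :: "'a::{cstar_algebra, comm_ring}" where "\<And>a. e * a = a"
proof -
  let ?K = "l2_carrier I :: ('b \<Rightarrow> 'a) set"
  have bound: "norm (f j) \<le> 1 * sqrt (norm (l2_ip I f f))" if "f \<in> ?K" for f
  proof -
    have "((\<lambda>i. f i * star (f i)) has_sum l2_ip I f f) I"
      using that by (auto simp: l2_carrier_def l2_ip_def)
    then have "((\<lambda>F. norm (\<Sum>i\<in>F. f i * star (f i))) \<longlongrightarrow> norm (l2_ip I f f)) (finite_subsets_at_top I)"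
      unfolding has_sum_def by (rule tendsto_norm)
    moreover have "\<forall>\<^sub>F F in finite_subsets_at_top I. (norm (f j))\<^sup>2 \<le> norm (\<Sum>i\<in>F. f i * star (f i))"
      unfolding eventually_finite_subsets_at_top
      by (rule exI[of _ "{j}"]) (use j in \<open>auto intro: norm_le_sum_mult_star\<close>)
    ultimately have "(norm (f j))\<^sup>2 \<le> norm (l2_ip I f f)"
      by (rule tendsto_lowerbound) simp
    then show ?thesis by (simp add: real_le_rsqrt)
  qed
  from sd[unfolded l2_self_dual_def self_dual_def, rule_format, of "\<lambda>f. f j"] bound
  obtain y where y: "y \<in> ?K" "\<And>f. f \<in> ?K \<Longrightarrow> f j = l2_ip I f y" by blast
  have "star (y j) * a = a" for a
  proof -
    let ?f = "\<lambda>i. if i = j then a else 0"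
    have hs: "((\<lambda>i. ?f i * star (g i)) has_sum a * star (g j)) I" for g :: "'b \<Rightarrow> 'a"
      using j by (intro has_sum_finite_neutralI[of "{j}"]) auto
    have "?f \<in> ?K"
      using hs[of ?f] j by (auto simp: l2_carrier_def summable_on_def)
    with y(2)[of ?f] have "a = l2_ip I ?f y" by simp
    also have "\<dots> = a * star (y j)"
      unfolding l2_ip_def using hs by (rule infsumI)
    finally show ?thesis by (simp add: mult.commute)
  qed
  then show thesis by (rule that)
qed

section \<open>The order of a commutative C*-algebra with unit\<close>

definition cle :: "'a::cstar_algebra \<Rightarrow> 'a \<Rightarrow> bool" (infix \<open>\<preceq>\<close> 50) where
  "a \<preceq> b \<longleftrightarrow> cstar_positive (b - a)"

locale unital_cstar =
  fixes e :: "'a::{cstar_algebra, comm_ring}"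
  assumes e_mult [simp]: "e * a = a"
begin

lemma mult_e [simp]: "a * e = a" for a :: 'a
  by (metis e_mult mult.commute)

lemma star_e [simp]: "star e = e"
  by (metis mult_e star_mult star_star)

lemma norm_e: "norm e \<le> 1"
  using norm_star_mult[of e] by (cases "e = 0") (auto simp: power2_eq_square)

lemma lmul_e: "lmul e = 1"
  by (rule endo_eqI) simp

text \<open>With a unit every multiplier \<open>r\<close> is multiplication by
  \<open>ap r e\<close>, so the square root of the multiplier comes from an element of the
  algebra.\<close>

lemma cstar_positive_iff_lmul: "cstar_positive a \<longleftrightarrow> pos_multiplier (lmul a)" for a :: 'a
proof
  assume "pos_multiplier (lmul a)"
  then obtain r where r: "r \<in> multipliers" "r * r = lmul a" by (rule pos_multiplier_sqrt)
  have "star (ap r e) * ap r e = ap (r * r) e"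
    using multipliersD(1,3)[OF r(1)] by (metis ap_simps(7) e_mult star_e)
  then show "cstar_positive a"
    unfolding cstar_positive_def r(2) by (metis ap_lmul mult_e)
qed (rule pos_multiplier_lmul)

lemma lmul_multiplier_iff: "lmul a \<in> multipliers \<longleftrightarrow> star a = a" for a :: 'a
  using multipliersD(3)[of "lmul a" e] lmul_multiplier by fastforce

text \<open>Positivity is read off from distances, the kind of information that survives a weak*
  limit.\<close>

lemma cstar_positive_iff: "cstar_positive a \<longleftrightarrow> star a = a \<and> (\<exists>t\<ge>0. norm (t *\<^sub>R e - a) \<le> t)" for a :: 'a
proof -
  have "lmul (t *\<^sub>R e - a) = t *\<^sub>R 1 - lmul a" for t
    by (simp add: lmul_simps lmul_e)
  then show ?thesis
    unfolding cstar_positive_iff_lmul pos_multiplier_def lmul_multiplier_iff by (metis norm_lmul)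
qed

lemma cstar_positive_norm:
  assumes a: "cstar_positive (a::'a)" and t: "norm a \<le> t"
  shows "norm (t *\<^sub>R e - a) \<le> t"
proof -
  obtain r where r: "r \<in> multipliers" "r * r = lmul a"
    using a pos_multiplier_lmul pos_multiplier_sqrt by metis
  have "(norm r)\<^sup>2 \<le> norm (r * r + 0 * 0)"
    by (rule norm_multiplier_sum_squares[OF r(1)]) (rule multipliers_closed_under)
  then have "(norm r)\<^sup>2 \<le> t" using t by (simp add: r)
  from pos_multiplier_square[OF r(1) this] have "norm (lmul (t *\<^sub>R e - a)) \<le> t"
    by (simp add: r lmul_simps lmul_e)
  then show ?thesis by simp
qed

lemma cstar_positive_star: "cstar_positive a \<Longrightarrow> star a = a" for a :: 'a
  by (simp add: cstar_positive_iff)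

lemma cstar_positive_add: "cstar_positive a \<Longrightarrow> cstar_positive b \<Longrightarrow> cstar_positive (a + b)" for a b :: 'a
  by (simp add: cstar_positive_iff_lmul lmul_simps pos_multiplier_add)

lemma cstar_positive_mult: "cstar_positive a \<Longrightarrow> cstar_positive b \<Longrightarrow> cstar_positive (a * b)" for a b :: 'a
  unfolding cstar_positive_def by (metis (no_types, lifting) mult.assoc mult.commute star_mult)

lemma cstar_positive_e: "cstar_positive e"
  unfolding cstar_positive_def by (rule exI[of _ e]) simp

lemma cstar_positive_scaleR: "r \<ge> 0 \<Longrightarrow> cstar_positive a \<Longrightarrow> cstar_positive (r *\<^sub>R a)" for a :: 'a
proof -
  assume r: "r \<ge> 0" and "cstar_positive a"
  then obtain b where "a = star b * b" by (auto simp: cstar_positive_def)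
  then have "r *\<^sub>R a = star (sqrt r *\<^sub>R b) * (sqrt r *\<^sub>R b)"
    using r by (simp add: star_scaleR)
  then show ?thesis unfolding cstar_positive_def by (rule exI)
qed

lemma cstar_positive_0 [simp]: "cstar_positive (0::'a)"
  unfolding cstar_positive_def by (rule exI[of _ 0]) simp

lemma cstar_positive_sum: "(\<And>i. i \<in> F \<Longrightarrow> cstar_positive (f i)) \<Longrightarrow> cstar_positive (\<Sum>i\<in>F. f i)" for f :: "'i \<Rightarrow> 'a"
  by (induction F rule: infinite_finite_induct) (auto simp: cstar_positive_add)

lemma norm_mono: "cstar_positive a \<Longrightarrow> a \<preceq> b \<Longrightarrow> norm a \<le> norm b" for a b :: 'a
  using norm_pos_multiplier_le[of "lmul a" "lmul (b - a)"]
  by (simp add: cle_def cstar_positive_iff_lmul lmul_simps)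

lemma cle_refl [simp]: "a \<preceq> a" for a :: 'a
  by (simp add: cle_def)

lemma cle_trans [trans]: "a \<preceq> b \<Longrightarrow> b \<preceq> c \<Longrightarrow> a \<preceq> c" for a b c :: 'a
  using cstar_positive_add[of "b - a" "c - b"] by (simp add: cle_def)

lemma cle_antisym: "a \<preceq> b \<Longrightarrow> b \<preceq> a \<Longrightarrow> a = b" for a b :: 'a
  using norm_mono[of "b - a" 0] by (simp add: cle_def)

lemma cle_add: "a \<preceq> b \<Longrightarrow> c \<preceq> d \<Longrightarrow> a + c \<preceq> b + d" for a b c d :: 'a
  using cstar_positive_add[of "b - a" "d - c"] by (simp add: cle_def algebra_simps)

lemma cle_scaleR: "0 \<le> r \<Longrightarrow> a \<preceq> b \<Longrightarrow> r *\<^sub>R a \<preceq> r *\<^sub>R b" for a b :: 'a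
  using cstar_positive_scaleR[of r "b - a"] by (simp add: cle_def scaleR_diff_right)

lemma cle_mult_left: "cstar_positive c \<Longrightarrow> a \<preceq> b \<Longrightarrow> c * a \<preceq> c * b" for a b c :: 'a
  using cstar_positive_mult[of c "b - a"] by (simp add: cle_def right_diff_distrib)

lemma sa_cle_norm: "star a = a \<Longrightarrow> norm a \<le> t \<Longrightarrow> a \<preceq> t *\<^sub>R e" for a :: 'a
  unfolding cle_def cstar_positive_iff
  by (auto simp: star_diff star_scaleR intro!: exI[of _ t] order_trans[OF norm_ge_zero])

lemma cle_norm_bound: "cstar_positive a \<Longrightarrow> a \<preceq> t *\<^sub>R e \<Longrightarrow> 0 \<le> t \<Longrightarrow> norm a \<le> t" for a :: 'a
  using norm_mono[of a "t *\<^sub>R e"] norm_e by (auto simp: mult_left_le intro: order_trans)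

lemma closed_cstar_positive: "closed {a::'a. cstar_positive a}"
proof -
  have *: "{a::'a. cstar_positive a} = {a. star a = a} \<inter> {a. norm (norm a *\<^sub>R e - a) \<le> norm a}"
    using cstar_positive_norm cstar_positive_iff norm_ge_zero by blast
  show ?thesis
    unfolding * by (intro closed_Int closed_Collect_eq closed_Collect_le continuous_intros continuous_on_star)
qed

lemma cstar_positive_tendsto:
  fixes f :: "'i \<Rightarrow> 'a"
  shows "(f \<longlongrightarrow> a) F \<Longrightarrow> F \<noteq> bot \<Longrightarrow> (\<And>x. cstar_positive (f x)) \<Longrightarrow> cstar_positive a"
  using Lim_in_closed_set[OF closed_cstar_positive, of f F a] by simp

lemma cle_tendsto:
  fixes f :: "'i \<Rightarrow> 'a"
  shows "(f \<longlongrightarrow> a) F \<Longrightarrow> (g \<longlongrightarrow> b) F \<Longrightarrow> F \<noteq> bot \<Longrightarrow> (\<And>x. f x \<preceq> g x) \<Longrightarrow> a \<preceq> b"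
  unfolding cle_def by (rule cstar_positive_tendsto[OF tendsto_diff])

end

lemma Bseq_plus:
  fixes s t :: "nat \<Rightarrow> 'a::real_normed_vector"
  assumes "Bseq s" "Bseq t"
  shows "Bseq (\<lambda>n. s n + t n)"
proof -
  obtain K K' where "\<And>n. norm (s n) \<le> K" "\<And>n. norm (t n) \<le> K'"
    using assms by (auto simp: Bseq_def)
  then show ?thesis by (intro BseqI'[where K = "K + K'"]) (rule norm_triangle_mono)
qed

section \<open>Generalized limits from a predual\<close>

text \<open>
  By Tychonoff's theorem one filter on \<open>nat\<close> makes all bounded sequences weak* convergent at the
  same time. The multiplication need not be weak* continuous a priori, so only properties
  that can be read off from norm balls are used.
\<close>

lemma predual_generalized_limit:
  assumes "wstar_algebra_with_predual TYPE('a::cstar_algebra) TYPE('p::complex_banach)"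
  obtains L :: "(nat \<Rightarrow> 'a::cstar_algebra) \<Rightarrow> 'a" where
    "\<And>s t. Bseq s \<Longrightarrow> Bseq t \<Longrightarrow> L (\<lambda>n. s n + t n) = L s + L t"
    "\<And>c s. Bseq s \<Longrightarrow> L (\<lambda>n. c *\<^sub>C s n) = c *\<^sub>C L s"
    "\<And>s b r. Bseq s \<Longrightarrow> (\<forall>\<^sub>F n in sequentially. norm (s n - b) \<le> r) \<Longrightarrow> norm (L s - b) \<le> r"
proof -
  obtain T :: "'a \<Rightarrow> 'p \<Rightarrow> complex" where
    T_add: "\<And>a b p. T (a + b) p = T a p + T b p" and
    T_scaleC: "\<And>c a p. T (c *\<^sub>C a) p = c * T a p" and
    T_range: "range T = topological_dual" and
    T_norm: "\<And>a. onorm (T a) = norm a"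
    using assms unfolding wstar_algebra_with_predual_def by blast
  have T_dual: "bounded_linear (T a)" "T a (c *\<^sub>C p) = c * T a p" for a c p
    using T_range unfolding topological_dual_def by auto
  have T_bound: "norm (T a p) \<le> norm a * norm p" for a p
    using onorm[OF T_dual(1)] by (simp add: T_norm)
  have T_diff: "T (a - b) p = T a p - T b p" for a b p
    using T_add[of "a - b" b p] by simp
  have T_inj: "a = b" if "\<And>p. T a p = T b p" for a b
  proof -
    have "T (a - b) = (\<lambda>p. 0)" using that by (auto simp: T_diff)
    then have "norm (a - b) = onorm (\<lambda>p::'p. 0 :: complex)" using T_norm[of "a - b"] by simp
    then show ?thesis by (simp only: onorm_zero) simp
  qed
  define M where "M s = (SOME K. \<forall>n. norm (s n) \<le> K)" for s :: "nat \<Rightarrow> 'a"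
  have M: "norm (s n) \<le> M s" if "Bseq s" for s n
  proof -
    have "\<exists>K. \<forall>n. norm (s n) \<le> K" using that by (auto simp: Bseq_def)
    then show ?thesis unfolding M_def by (rule someI2_ex) blast
  qed
  have T_seq: "norm (T (s n) p) \<le> M s * norm p" if "Bseq s" for s n p
    by (rule order_trans[OF T_bound mult_right_mono[OF M[OF that] norm_ge_zero]])
  \<comment> \<open>Each pair of a bounded sequence and a predual vector is one coordinate. A
    cluster point of \<open>X\<close> therefore serves all bounded sequences at once. Unbounded
    sequences get the value 0 so that \<open>X n\<close> stays in the compact set
    \<open>C\<close>.\<close>
  define X :: "nat \<Rightarrow> (nat \<Rightarrow> 'a) \<times> 'p \<Rightarrow> complex" where
    "X n = (\<lambda>(s, p). if Bseq s then T (s n) p else 0)" for n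
  define C :: "((nat \<Rightarrow> 'a) \<times> 'p \<Rightarrow> complex) set" where
    "C = PiE UNIV (\<lambda>(s, p). if Bseq s then cball 0 (M s * norm p) else {0})"
  have "compact C"
  proof -
    have "compactin (product_topology (\<lambda>_. euclidean) UNIV) C"
      unfolding C_def compactin_PiE by (auto simp: split_beta)
    then show ?thesis by (simp add: euclidean_product_topology)
  qed
  moreover have "X n \<in> C" for n
    by (auto simp: X_def C_def PiE_UNIV_domain T_seq)
  then have "eventually (\<lambda>x. x \<in> C) (filtermap X sequentially)"
    by (simp add: eventually_filtermap)
  moreover have "filtermap X sequentially \<noteq> bot"
    by (simp add: filtermap_bot_iff)
  ultimately obtain f where f: "inf (nhds f) (filtermap X sequentially) \<noteq> bot"
    unfolding compact_filter by blast
  \<comment> \<open>The neighbourhoods of the cluster point, pulled back to \<open>nat\<close>, give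
    a proper filter finer than \<open>sequentially\<close> along which \<open>X\<close> converges.
    It does the work of an ultrafilter.\<close>
  define F where "F = inf (filtercomap X (nhds f)) sequentially"
  have F: "F \<noteq> bot"
  proof
    assume "F = bot"
    then have "eventually (\<lambda>n. False) F" by simp
    then obtain P Q where PQ: "eventually P (filtercomap X (nhds f))" "eventually Q sequentially"
      "\<And>n. P n \<Longrightarrow> Q n \<Longrightarrow> False"
      unfolding F_def eventually_inf by blast
    then obtain R where R: "eventually R (nhds f)" "\<And>n. R (X n) \<Longrightarrow> P n"
      by (auto simp: eventually_filtercomap)
    have "eventually (\<lambda>x. \<not> R x) (filtermap X sequentially)"
      unfolding eventually_filtermap using PQ(2) by (rule eventually_mono) (use PQ(3) R(2) in blast)
    with R(1) have "eventually (\<lambda>x. False) (inf (nhds f) (filtermap X sequentially))"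
      unfolding eventually_inf by (intro exI[of _ R] exI[of _ "\<lambda>x. \<not> R x"]) simp
    then show False using f by (simp add: eventually_False)
  qed
  have Fseq: "F \<le> sequentially" by (simp add: F_def)
  have "(X \<longlongrightarrow> f) F"
    unfolding F_def filterlim_iff_le_filtercomap by simp
  then have Xlim: "((\<lambda>n. X n i) \<longlongrightarrow> f i) F" for i
    using continuous_on_tendsto_compose[OF continuous_on_product_coordinates] by fastforce
  have lim: "((\<lambda>n. T (s n) p) \<longlongrightarrow> f (s, p)) F" if "Bseq s" for s p
    using Xlim[of "(s, p)"] that by (simp add: X_def)
  define L where "L s = (SOME a. \<forall>p. T a p = f (s, p))" for s
  have L: "T (L s) p = f (s, p)" if s: "Bseq s" for s p
  proof -
    have sc: "f (s, c *\<^sub>C p) = c * f (s, p)" for c p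
      using tendsto_mult_left[OF lim[OF s, of p], of c]
      by (intro tendsto_unique[OF F lim[OF s]]) (simp add: T_dual)
    have "bounded_linear (\<lambda>p. f (s, p))"
    proof (rule bounded_linear_intro[where K = "M s"])
      fix p q r
      show "f (s, p + q) = f (s, p) + f (s, q)"
        using tendsto_add[OF lim[OF s, of p] lim[OF s, of q]]
        by (intro tendsto_unique[OF F lim[OF s]])
          (simp add: linear_add[OF bounded_linear.linear[OF T_dual(1)]])
      show "f (s, r *\<^sub>R p) = r *\<^sub>R f (s, p)"
        using sc[of "of_real r" p] by (simp add: scaleC_of_real scaleR_conv_of_real)
      show "norm (f (s, p)) \<le> norm p * M s"
        by (rule tendsto_upperbound[OF tendsto_norm[OF lim[OF s]] _ F], rule always_eventually)
          (simp add: T_seq[OF s] mult.commute)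
    qed
    then have "(\<lambda>p. f (s, p)) \<in> range T"
      unfolding T_range topological_dual_def by (simp add: sc)
    then have "\<exists>a. \<forall>p. T a p = f (s, p)" by (metis (mono_tags) imageE)
    then show ?thesis unfolding L_def by (rule someI2_ex) blast
  qed
  show thesis
  proof
    fix s t :: "nat \<Rightarrow> 'a" and c b r
    assume s: "Bseq s"
    {
      assume t: "Bseq t"
      have st: "Bseq (\<lambda>n. s n + t n)"
        using s t by (simp add: Bseq_plus)
      show "L (\<lambda>n. s n + t n) = L s + L t"
      proof (rule T_inj)
        fix p
        show "T (L (\<lambda>n. s n + t n)) p = T (L s + L t) p"
          unfolding T_add L[OF s] L[OF t] L[OF st]
          using tendsto_add[OF lim[OF s, of p] lim[OF t, of p]]
          by (intro tendsto_unique[OF F lim[OF st]]) (simp add: T_add)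
      qed
    }
    have cs: "Bseq (\<lambda>n. c *\<^sub>C s n)"
      by (rule BseqI'[where K = "cmod c * M s"]) (simp add: norm_scaleC mult_left_mono M[OF s])
    show "L (\<lambda>n. c *\<^sub>C s n) = c *\<^sub>C L s"
    proof (rule T_inj)
      fix p
      show "T (L (\<lambda>n. c *\<^sub>C s n)) p = T (c *\<^sub>C L s) p"
        unfolding T_scaleC L[OF s] L[OF cs]
        using tendsto_mult_left[OF lim[OF s, of p], of c]
        by (intro tendsto_unique[OF F lim[OF cs]]) (simp add: T_scaleC)
    qed
    assume ev: "\<forall>\<^sub>F n in sequentially. norm (s n - b) \<le> r"
    then obtain n where "norm (s n - b) \<le> r" by (auto simp: eventually_sequentially)
    then have r0: "0 \<le> r" by (rule order_trans[OF norm_ge_zero])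
    have "norm (T (L s - b) p) \<le> r * norm p" for p
    proof -
      have "((\<lambda>n. T (s n - b) p) \<longlongrightarrow> T (L s - b) p) F"
        unfolding T_diff L[OF s] by (intro tendsto_intros lim s)
      moreover have "\<forall>\<^sub>F n in F. norm (T (s n - b) p) \<le> r * norm p"
        using filter_leD[OF Fseq ev]
        by (rule eventually_mono) (rule order_trans[OF T_bound mult_right_mono[OF _ norm_ge_zero]])
      ultimately show ?thesis by (rule tendsto_upperbound[OF tendsto_norm _ F])
    qed
    then show "norm (L s - b) \<le> r"
      unfolding T_norm[symmetric] by (rule onorm_bound[OF r0])
  qed
qed

locale generalized_limit = unital_cstar e for e :: "'a::{cstar_algebra, comm_ring}" +
  fixes L :: "(nat \<Rightarrow> 'a) \<Rightarrow> 'a"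
  assumes L_add: "\<And>s t. Bseq s \<Longrightarrow> Bseq t \<Longrightarrow> L (\<lambda>n. s n + t n) = L s + L t"
    and L_scaleC: "\<And>c s. Bseq s \<Longrightarrow> L (\<lambda>n. c *\<^sub>C s n) = c *\<^sub>C L s"
    and L_ball: "\<And>s b r. Bseq s \<Longrightarrow> (\<forall>\<^sub>F n in sequentially. norm (s n - b) \<le> r) \<Longrightarrow> norm (L s - b) \<le> r"
begin

lemma BseqI: "(\<And>n. norm (s n) \<le> K) \<Longrightarrow> Bseq s"
  by (meson BseqI')

lemma Bseq_mult_left: "Bseq s \<Longrightarrow> Bseq (\<lambda>n. c * s n)" for s :: "nat \<Rightarrow> 'a"
proof -
  assume "Bseq s"
  then obtain K where K: "\<And>n. norm (s n) \<le> K" by (auto simp: Bseq_def)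
  show ?thesis
    by (rule BseqI[where K = "norm c * K"])
      (rule order_trans[OF norm_mult_ineq mult_left_mono[OF K norm_ge_zero]])
qed

lemma Bseq_scaleC: "Bseq s \<Longrightarrow> Bseq (\<lambda>n. c *\<^sub>C s n)" for s :: "nat \<Rightarrow> 'a"
proof -
  assume "Bseq s"
  then obtain K where "\<And>n. norm (s n) \<le> K" by (auto simp: Bseq_def)
  then show ?thesis
    by (intro BseqI[where K = "cmod c * K"]) (simp add: norm_scaleC mult_left_mono)
qed

lemma L_const: "L (\<lambda>n. b) = b"
  using L_ball[of "\<lambda>n. b" b 0] by (simp add: Bfun_const)

lemma L_scaleR: "Bseq s \<Longrightarrow> L (\<lambda>n. r *\<^sub>R s n) = r *\<^sub>R L s"
  using L_scaleC[of s "of_real r"] by (simp add: scaleC_of_real)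

lemma L_diff: "Bseq s \<Longrightarrow> Bseq t \<Longrightarrow> L (\<lambda>n. s n - t n) = L s - L t"
  using L_add[of s "\<lambda>n. (-1) *\<^sub>R t n"] L_scaleR[of t "-1"] Bseq_scaleC[of t "of_real (-1)"]
  by (simp add: scaleC_of_real scaleC.minus_left)

lemma L_norm: "(\<And>n. norm (s n) \<le> K) \<Longrightarrow> norm (L s) \<le> K"
  using L_ball[of s 0 K] BseqI[of s K] by simp

text \<open>Sakai's trick: the distance of a self-adjoint element to \<open>i t\<close> grows too slowly in \<open>t\<close> for a
  limit with a nonzero imaginary part.\<close>

lemma L_self_adjoint:
  assumes s: "Bseq s" and sa: "\<forall>\<^sub>F n in sequentially. star (s n) = s n"
  shows "star (L s) = L s"
proof -
  obtain K where K: "\<And>n. norm (s n) \<le> K" "K > 0" using s by (auto simp: Bseq_def)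
  define y where "y = im_part (L s)"
  have sy: "star y = y" by (simp add: y_def)
  have bound: "norm (y - t *\<^sub>R e) \<le> sqrt (K\<^sup>2 + t\<^sup>2)" for t :: real
  proof -
    let ?z = "L s - t *\<^sub>R \<i> *\<^sub>C e"
    have "\<forall>\<^sub>F n in sequentially. norm (s n - t *\<^sub>R \<i> *\<^sub>C e) \<le> sqrt (K\<^sup>2 + t\<^sup>2)"
      using sa
    proof (rule eventually_mono)
      fix n assume n: "star (s n) = s n"
      have "star (s n - t *\<^sub>R \<i> *\<^sub>C e) * (s n - t *\<^sub>R \<i> *\<^sub>C e) = s n * s n + (t * t) *\<^sub>R e"
        by (simp add: n star_diff star_scaleR star_scaleC scaleC.minus_left algebra_simps
            mult_scaleC_left mult_scaleC_right scaleC.scaleR_right)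
      then have "(norm (s n - t *\<^sub>R \<i> *\<^sub>C e))\<^sup>2 = norm (s n * s n + (t * t) *\<^sub>R e)"
        by (metis norm_star_mult)
      also have "\<dots> \<le> K * K + t * t * 1"
        using order_trans[OF norm_mult_ineq[of "s n" "s n"] mult_mono[OF K(1) K(1)]] K(2) norm_e
        by (intro norm_triangle_mono) (auto intro: mult_left_le)
      finally show "norm (s n - t *\<^sub>R \<i> *\<^sub>C e) \<le> sqrt (K\<^sup>2 + t\<^sup>2)"
        by (simp add: real_le_rsqrt power2_eq_square)
    qed
    then have z: "norm ?z \<le> sqrt (K\<^sup>2 + t\<^sup>2)" by (rule L_ball[OF s])
    have "y - t *\<^sub>R e = (1/2) *\<^sub>R \<i> *\<^sub>C (star ?z - ?z)"
      by (simp add: y_def im_part_def star_diff star_scaleR star_scaleC scaleC.minus_left scaleC.diff_right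
          scaleC.add_right scaleC.scaleR_right scaleC.minus_right scaleR_diff_right scaleR_add_right
          flip: scaleR_add_left)
        (metis add_uminus_conv_diff field_sum_of_halves minus_add_distrib scaleR_left_distrib)
    also have "norm \<dots> \<le> (1/2) * (norm (star ?z) + norm ?z)"
      using norm_triangle_ineq4[of "star ?z" ?z] by (simp add: norm_scaleC)
    also have "\<dots> = norm ?z" by simp
    finally show ?thesis using z by linarith
  qed
  \<comment> \<open>With \<open>t = Suc n\<close>, the ball gives
    \<open>y' + t \<le> sqrt (K^2 + t^2) \<le> t + K^2 / t\<close>. The \<open>t\<close> cancels,
    and what remains tends to 0.\<close>
  have small: "y' \<preceq> (K\<^sup>2 / real (Suc n)) *\<^sub>R e"
    if y': "star y' = y'" and b: "norm (y' + real (Suc n) *\<^sub>R e) \<le> sqrt (K\<^sup>2 + (real (Suc n))\<^sup>2)" for y' n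
  proof -
    let ?t = "real (Suc n)"
    have "y' + ?t *\<^sub>R e \<preceq> sqrt (K\<^sup>2 + ?t\<^sup>2) *\<^sub>R e"
      by (rule sa_cle_norm[OF _ b]) (simp add: y' star_add star_scaleR)
    also have "\<dots> \<preceq> (K\<^sup>2 / ?t + ?t) *\<^sub>R e"
    proof -
      have "sqrt (K\<^sup>2 + ?t\<^sup>2) \<le> K\<^sup>2 / ?t + ?t"
        by (rule real_le_lsqrt) (auto simp: power2_sum power_divide)
      then show ?thesis
        unfolding cle_def by (simp add: cstar_positive_scaleR cstar_positive_e flip: scaleR_diff_left)
    qed
    finally show ?thesis by (simp add: cle_def algebra_simps)
  qed
  have le0: "y' \<preceq> 0" if "\<And>n. y' \<preceq> (K\<^sup>2 / real (Suc n)) *\<^sub>R e" for y'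
  proof -
    have "(\<lambda>n. (K\<^sup>2 / real (Suc n)) *\<^sub>R e) \<longlonglongrightarrow> 0 *\<^sub>R e"
      by (intro tendsto_scaleR tendsto_const LIMSEQ_Suc[OF lim_const_over_n])
    then have "(\<lambda>n. (K\<^sup>2 / real (Suc n)) *\<^sub>R e) \<longlonglongrightarrow> 0" by simp
    from cle_tendsto[OF tendsto_const this _ that] show ?thesis by simp
  qed
  have "y \<preceq> 0"
  proof (rule le0, rule small[OF sy])
    fix n
    show "norm (y + real (Suc n) *\<^sub>R e) \<le> sqrt (K\<^sup>2 + (real (Suc n))\<^sup>2)"
      using bound[of "- real (Suc n)"] by (simp only: scaleR_minus_left diff_minus_eq_add power2_minus)
  qed
  moreover have "- y \<preceq> 0"
  proof (rule le0, rule small)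
    fix n
    show "norm (- y + real (Suc n) *\<^sub>R e) \<le> sqrt (K\<^sup>2 + (real (Suc n))\<^sup>2)"
      using bound[of "real (Suc n)"] by (simp add: norm_minus_commute)
  qed (simp add: star_minus sy)
  ultimately have "y = 0"
    by (metis cle_antisym cle_def diff_0 diff_zero minus_minus)
  then show ?thesis using re_im_parts[of "L s"] by (simp add: y_def scaleC.zero_right)
qed

text \<open>Positive elements of norm at most \<open>K\<close> lie in the ball of radius
  \<open>K\<close> around \<open>K e\<close>, and \<open>L\<close> does not leave balls. Together
  with self-adjointness this characterizes positivity.\<close>

lemma L_positive:
  assumes s: "Bseq s" and pos: "\<forall>\<^sub>F n in sequentially. cstar_positive (s n)"
  shows "cstar_positive (L s)"
proof -
  obtain K where K: "\<And>n. norm (s n) \<le> K" "K > 0" using s by (auto simp: Bseq_def)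
  have "star (L s) = L s"
    by (rule L_self_adjoint[OF s eventually_mono[OF pos]]) (rule cstar_positive_star)
  moreover have "norm (L s - K *\<^sub>R e) \<le> K"
    by (rule L_ball[OF s eventually_mono[OF pos]])
      (metis K(1) cstar_positive_norm norm_minus_commute)
  ultimately show ?thesis
    unfolding cstar_positive_iff using K(2) by (auto simp: norm_minus_commute intro!: exI[of _ K])
qed

lemma L_mono:
  assumes "Bseq s" "Bseq t" "\<forall>\<^sub>F n in sequentially. s n \<preceq> t n"
  shows "L s \<preceq> L t"
proof -
  have "Bseq (\<lambda>n. t n - s n)"
    using Bseq_plus[OF assms(2), of "\<lambda>n. - s n"] assms(1) by (simp add: Bseq_minus_iff)
  then show ?thesis
    using L_positive[of "\<lambda>n. t n - s n"] assms by (simp add: cle_def L_diff)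
qed

section \<open>Infima of decreasing sequences\<close>

definition decreasing :: "(nat \<Rightarrow> 'a) \<Rightarrow> bool" where
  "decreasing s \<longleftrightarrow> (\<forall>n. s (Suc n) \<preceq> s n) \<and> (\<forall>n. cstar_positive (s n))"

lemma decreasing_le:
  assumes "decreasing s" "m \<le> n"
  shows "s n \<preceq> s m"
  using assms(2)
proof (induction n rule: dec_induct)
  case (step n)
  have "s (Suc n) \<preceq> s n" using assms(1) by (simp add: decreasing_def)
  then show ?case using step.IH by (rule cle_trans)
qed simp

lemma decreasing_Bseq: "decreasing s \<Longrightarrow> Bseq s"
  by (rule BseqI[where K = "norm (s 0)"], rule norm_mono) (simp_all add: decreasing_le, simp add: decreasing_def)

text \<open>Together with \<open>L_decreasing_ge\<close> this identifies \<open>L s\<close> as the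
  infimum, so on decreasing sequences \<open>L\<close> does not depend on the filter behind
  it.\<close>

lemma L_decreasing_le: "decreasing s \<Longrightarrow> L s \<preceq> s m"
proof -
  assume s: "decreasing s"
  have "L s \<preceq> L (\<lambda>n. s m)"
    by (rule L_mono[OF decreasing_Bseq[OF s] Bfun_const])
      (use decreasing_le[OF s] eventually_sequentially in blast)
  then show ?thesis by (simp add: L_const)
qed

lemma L_decreasing_ge: "decreasing s \<Longrightarrow> (\<And>n. a \<preceq> s n) \<Longrightarrow> a \<preceq> L s"
  using L_mono[OF Bfun_const decreasing_Bseq, of s a] by (simp add: L_const)

lemma L_decreasing_Suc:
  assumes s: "decreasing s"
  shows "L (\<lambda>n. s (Suc n)) = L s"
proof (rule cle_antisym)
  have s': "decreasing (\<lambda>n. s (Suc n))" using s by (simp add: decreasing_def)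
  show "L (\<lambda>n. s (Suc n)) \<preceq> L s"
    using s by (intro L_mono decreasing_Bseq s' always_eventually) (auto simp: decreasing_def)
  show "L s \<preceq> L (\<lambda>n. s (Suc n))"
    by (rule L_decreasing_ge[OF s']) (rule L_decreasing_le[OF s])
qed

text \<open>Since \<open>L\<close> is an infimum here, \<open>b L s \<le> L (b s)\<close> for every
  positive \<open>b\<close>. Taking \<open>b = c\<close>, and then \<open>b = norm c e - c\<close>,
  gives both inequalities.\<close>

lemma L_decreasing_mult:
  assumes s: "decreasing s" and c: "cstar_positive c"
  shows "L (\<lambda>n. c * s n) = c * L s"
proof -
  let ?t = "norm c"
  note B = decreasing_Bseq[OF s]
  have ineq: "b * L s \<preceq> L (\<lambda>n. b * s n)" if b: "cstar_positive b" for b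
  proof -
    have "decreasing (\<lambda>n. b * s n)"
      using s b unfolding decreasing_def by (auto intro: cle_mult_left cstar_positive_mult)
    then show ?thesis
      by (rule L_decreasing_ge) (intro cle_mult_left b L_decreasing_le s)
  qed
  have 1: "c * L s \<preceq> L (\<lambda>n. c * s n)" by (rule ineq[OF c])
  have "cstar_positive (?t *\<^sub>R e - c)"
    using sa_cle_norm[of c ?t] c by (simp add: cle_def cstar_positive_star)
  then have "(?t *\<^sub>R e - c) * L s \<preceq> L (\<lambda>n. (?t *\<^sub>R e - c) * s n)" by (rule ineq)
  also have "(\<lambda>n. (?t *\<^sub>R e - c) * s n) = (\<lambda>n. ?t *\<^sub>R s n - c * s n)"
    by (simp add: left_diff_distrib)
  also have "L \<dots> = ?t *\<^sub>R L s - L (\<lambda>n. c * s n)"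
    using Bseq_scaleC[OF B, of "of_real ?t"]
    by (simp add: L_diff L_scaleR[OF B] Bseq_mult_left[OF B] scaleC_of_real)
  finally have "L (\<lambda>n. c * s n) \<preceq> c * L s"
    by (simp add: cle_def algebra_simps)
  with 1 show ?thesis by (simp add: cle_antisym)
qed

end

section \<open>Hilbert modules and adjointable operators\<close>

context unital_cstar
begin

text \<open>The hypothesis is the expansion of a positive form at \<open>t x - \<beta> y\<close>,
  where \<alpha>, \<beta>, \<gamma> are its values at \<open>(x, x)\<close>, \<open>(x, y)\<close>,
  \<open>(y, y)\<close>. Replacing \<gamma> by a scalar \<open>t\<close> above its norm leaves
  \<open>\<beta> * star \<beta> \<le> t \<alpha>\<close>.\<close>

lemma cauchy_schwarz_aux:
  fixes \<alpha> \<beta> \<gamma> :: 'a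
  assumes pos: "\<And>t. cstar_positive ((t * t) *\<^sub>R \<alpha> - (2 * t) *\<^sub>R (\<beta> * star \<beta>) + \<beta> * star \<beta> * \<gamma>)"
    and \<gamma>: "star \<gamma> = \<gamma>" and \<alpha>: "star \<alpha> = \<alpha>"
  shows "(norm \<beta>)\<^sup>2 \<le> norm \<alpha> * norm \<gamma>"
proof -
  have le: "\<beta> * star \<beta> \<preceq> t *\<^sub>R \<alpha>" if t: "t > 0" "norm \<gamma> \<le> t" for t
  proof -
    have 1: "\<beta> * star \<beta> * \<gamma> \<preceq> \<beta> * star \<beta> * (t *\<^sub>R e)"
      by (intro cle_mult_left cstar_positive_mult_star sa_cle_norm \<gamma> t)
    have "(2 * t) *\<^sub>R (\<beta> * star \<beta>) - (t * t) *\<^sub>R \<alpha> \<preceq> \<beta> * star \<beta> * \<gamma>"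
      using pos[of t] by (simp add: cle_def algebra_simps)
    also note 1
    finally have "cstar_positive ((1 / t) *\<^sub>R (t *\<^sub>R (\<beta> * star \<beta>) - ((2 * t) *\<^sub>R (\<beta> * star \<beta>) - (t * t) *\<^sub>R \<alpha>)))"
      unfolding cle_def using t by (intro cstar_positive_scaleR) auto
    moreover have "(1 / t) *\<^sub>R (t *\<^sub>R (\<beta> * star \<beta>) - ((2 * t) *\<^sub>R (\<beta> * star \<beta>) - (t * t) *\<^sub>R \<alpha>))
        = t *\<^sub>R \<alpha> - \<beta> * star \<beta>"
      using t by (simp add: scaleR_diff_right scaleR_2)
    ultimately show ?thesis by (simp add: cle_def)
  qed
  show ?thesis
  proof (rule field_le_epsilon)
    fix \<delta> :: real assume \<delta>: "0 < \<delta>"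
    \<comment> \<open>\<open>norm \<gamma>\<close> may be 0, so it is enlarged; the divisor keeps
      the error below \<delta> after multiplication by \<open>norm \<alpha>\<close>.\<close>
    define t where "t = norm \<gamma> + \<delta> / (norm \<alpha> + 1)"
    have na: "norm \<alpha> + 1 > 0" by (simp add: add_nonneg_pos)
    then have t: "t > 0" "norm \<gamma> \<le> t"
      using \<delta> by (auto simp: t_def add_nonneg_pos)
    have "(norm \<beta>)\<^sup>2 \<le> norm (t *\<^sub>R \<alpha>)"
      using norm_mono[OF cstar_positive_mult_star le[OF t]] by (simp add: norm_mult_star)
    also have "\<dots> = norm \<alpha> * norm \<gamma> + \<delta> * (norm \<alpha> / (norm \<alpha> + 1))"
      using t by (simp only: norm_scaleR abs_of_pos) (simp add: t_def algebra_simps)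
    also have "\<dots> \<le> norm \<alpha> * norm \<gamma> + \<delta> * 1"
      using \<delta> na by (intro add_left_mono mult_left_mono) auto
    finally show "(norm \<beta>)\<^sup>2 \<le> norm \<alpha> * norm \<gamma> + \<delta>" by simp
  qed
qed

lemma sum_cauchy_schwarz:
  fixes f g :: "'i \<Rightarrow> 'a"
  shows "(norm (\<Sum>i\<in>F. f i * star (g i)))\<^sup>2
    \<le> norm (\<Sum>i\<in>F. f i * star (f i)) * norm (\<Sum>i\<in>F. g i * star (g i))"
proof (rule cauchy_schwarz_aux)
  fix t :: real
  let ?\<beta> = "\<Sum>i\<in>F. f i * star (g i)" and ?\<alpha> = "\<Sum>i\<in>F. f i * star (f i)" and ?\<gamma> = "\<Sum>i\<in>F. g i * star (g i)"
  let ?z = "\<lambda>i. t *\<^sub>R f i - ?\<beta> * g i"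
  have s: "star ?\<beta> = (\<Sum>i\<in>F. g i * star (f i))" by (simp add: star_sum star_mult mult.commute)
  have "(\<Sum>i\<in>F. ?z i * star (?z i)) = (\<Sum>i\<in>F. (t * t) *\<^sub>R (f i * star (f i))
      - t *\<^sub>R (star ?\<beta> * (f i * star (g i))) - t *\<^sub>R (?\<beta> * (g i * star (f i))) + ?\<beta> * star ?\<beta> * (g i * star (g i)))"
    by (rule sum.cong) (simp_all add: star_diff star_scaleR star_mult algebra_simps)
  also have "\<dots> = (t * t) *\<^sub>R ?\<alpha> - t *\<^sub>R (star ?\<beta> * ?\<beta>) - t *\<^sub>R (?\<beta> * star ?\<beta>) + ?\<beta> * star ?\<beta> * ?\<gamma>"
    unfolding s[symmetric] by (simp only: sum.distrib sum_subtractf scaleR_sum_right[symmetric] sum_distrib_left[symmetric] s)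
  also have "\<dots> = (t * t) *\<^sub>R ?\<alpha> - (2 * t) *\<^sub>R (?\<beta> * star ?\<beta>) + ?\<beta> * star ?\<beta> * ?\<gamma>"
    unfolding mult.commute[of "star ?\<beta>" ?\<beta>] mult_2 scaleR_left_distrib diff_diff_add ..
  finally show "cstar_positive ((t * t) *\<^sub>R ?\<alpha> - (2 * t) *\<^sub>R (?\<beta> * star ?\<beta>) + ?\<beta> * star ?\<beta> * ?\<gamma>)"
    using cstar_positive_sum[of F "\<lambda>i. ?z i * star (?z i)"] by (simp add: cstar_positive_mult_star)
qed (simp_all add: star_sum star_mult)

end

locale comm_hilbert_module =
  hilbert_module act ip + unital_cstar e
  for act :: "'a::{cstar_algebra, comm_ring} \<Rightarrow> 'h::complex_banach \<Rightarrow> 'h"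
    and ip :: "'h \<Rightarrow> 'h \<Rightarrow> 'a" and e :: 'a
begin

lemma ip_add_right: "ip x (y + z) = ip x y + ip x z"
  by (subst (1 2 3) ip_star) (simp add: ip_add_left star_add)

lemma ip_scaleC_right: "ip x (c *\<^sub>C y) = cnj c *\<^sub>C ip x y"
  by (subst (1 2) ip_star) (simp add: ip_scaleC_left star_scaleC)

lemma ip_act_right: "ip x (act a y) = star a * ip x y"
  by (subst (1 2) ip_star) (simp add: ip_act_left star_mult mult.commute)

lemma ip_scaleR_left: "ip (r *\<^sub>R x) y = r *\<^sub>R ip x y"
  using ip_scaleC_left[of "of_real r"] by (simp add: scaleC_of_real)

lemma ip_scaleR_right: "ip x (r *\<^sub>R y) = r *\<^sub>R ip x y"
  using ip_scaleC_right[of _ "of_real r"] by (simp add: scaleC_of_real)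

lemma ip_diff_left: "ip (x - y) z = ip x z - ip y z"
  using ip_add_left[of "x - y" y z] by simp

lemma ip_diff_right: "ip x (y - z) = ip x y - ip x z"
  using ip_add_right[of x "y - z" z] by simp

lemma ip_zero [simp]: "ip 0 x = 0" "ip x 0 = 0"
  using ip_diff_left[of 0 0 x] ip_diff_right[of x 0 0] by simp_all

lemma ip_minus_left: "ip (- x) y = - ip x y"
  using ip_diff_left[of 0 x y] by simp

lemma ip_minus_right: "ip x (- y) = - ip x y"
  using ip_diff_right[of x 0 y] by simp

lemma star_ip: "star (ip x y) = ip y x"
  by (rule ip_star[symmetric])

lemmas ip_simps = ip_add_left ip_add_right ip_diff_left ip_diff_right ip_minus_left ip_minus_right
  ip_scaleR_left ip_scaleR_right ip_scaleC_left ip_scaleC_right ip_act_left ip_act_right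

lemma norm_ip_self: "norm (ip x x) = (norm x)\<^sup>2"
  by (simp add: norm_eq_ip)

lemma ip_self_eq_0: "ip x x = 0 \<longleftrightarrow> x = 0"
  using norm_ip_self[of x] by auto

lemma ip_eqI: "(\<And>z. ip x z = ip y z) \<Longrightarrow> x = y"
  using ip_self_eq_0[of "x - y"] by (simp add: ip_diff_left)

lemma ip_eqI_right: "(\<And>z. ip z x = ip z y) \<Longrightarrow> x = y"
  using ip_self_eq_0[of "x - y"] by (simp add: ip_diff_right)

lemma ip_sum_left: "ip (\<Sum>i\<in>F. f i) y = (\<Sum>i\<in>F. ip (f i) y)"
  by (induction F rule: infinite_finite_induct) (simp_all add: ip_add_left)

text \<open>A relation and not an operation, because bounded module maps need not have
  adjoints.\<close>

definition adj :: "'h endo \<Rightarrow> 'h endo \<Rightarrow> bool" where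
  "adj X Y \<longleftrightarrow> (\<forall>x y. ip (ap X x) y = ip x (ap Y y))"

lemma adjD: "adj X Y \<Longrightarrow> ip (ap X x) y = ip x (ap Y y)"
  by (simp add: adj_def)

lemma adj_sym: "adj X Y \<Longrightarrow> adj Y X"
  unfolding adj_def by (metis star_ip)

lemma adj_intros:
  "adj 0 0" "adj 1 1"
  "adj X X' \<Longrightarrow> adj Y Y' \<Longrightarrow> adj (X + Y) (X' + Y')"
  "adj X X' \<Longrightarrow> adj Y Y' \<Longrightarrow> adj (X - Y) (X' - Y')"
  "adj X X' \<Longrightarrow> adj (- X) (- X')"
  "adj X X' \<Longrightarrow> adj Y Y' \<Longrightarrow> adj (X * Y) (Y' * X')"
  "adj X X' \<Longrightarrow> adj (r *\<^sub>R X) (r *\<^sub>R X')"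
  by (auto simp: adj_def ip_simps)

lemma adj_power: "adj X X \<Longrightarrow> adj (X ^ n) (X ^ n)"
  by (induction n) (auto simp: adj_intros(2) simp flip: power_commutes intro: adj_intros(6)
      dest: adj_intros(6)[of X X "X ^ _" "X ^ _"])

lemma adj_unique: "adj X Y \<Longrightarrow> adj X Z \<Longrightarrow> Y = Z"
  by (intro endo_eqI ip_eqI_right) (metis adjD)

lemma adj_act: "adj X Y \<Longrightarrow> ap X (act a x) = act a (ap X x)"
  by (rule ip_eqI) (simp add: adjD ip_act_left)

lemma adj_scaleC: "adj X Y \<Longrightarrow> ap X (c *\<^sub>C x) = c *\<^sub>C ap X x"
  by (rule ip_eqI) (simp add: adjD ip_scaleC_left)

lemma form_cauchy_schwarz:
  assumes Y: "adj Y Y" and pos: "\<And>x. cstar_positive (ip (ap Y x) x)"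
  shows "(norm (ip (ap Y x) y))\<^sup>2 \<le> norm (ip (ap Y x) x) * norm (ip (ap Y y) y)"
proof (rule cauchy_schwarz_aux)
  fix t :: real
  let ?\<beta> = "ip (ap Y x) y"
  let ?z = "t *\<^sub>R x - act ?\<beta> y"
  have "ip (ap Y y) x = star ?\<beta>" by (simp add: adjD[OF Y] star_ip)
  then have "ip (ap Y ?z) ?z = (t * t) *\<^sub>R ip (ap Y x) x - (2 * t) *\<^sub>R (?\<beta> * star ?\<beta>) + ?\<beta> * star ?\<beta> * ip (ap Y y) y"
    by (simp add: ap.diff_right ap.scaleR_right adj_act[OF Y] ip_simps algebra_simps scaleR_diff_right)
      (simp add: mult_ac flip: scaleR_left_distrib)
  then show "cstar_positive ((t * t) *\<^sub>R ip (ap Y x) x - (2 * t) *\<^sub>R (?\<beta> * star ?\<beta>) + ?\<beta> * star ?\<beta> * ip (ap Y y) y)"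
    using pos[of ?z] by simp
qed (use pos cstar_positive_star in auto)

lemma norm_ip: "norm (ip x y) \<le> norm x * norm y"
proof -
  have "(norm (ip x y))\<^sup>2 \<le> (norm x * norm y)\<^sup>2"
    using form_cauchy_schwarz[OF adj_intros(2), of x y] by (simp add: ip_positive norm_ip_self power_mult_distrib)
  then show ?thesis by (rule power2_le_imp_le) simp
qed

lemma bounded_bilinear_ip: "bounded_bilinear ip"
proof
  show "\<exists>K. \<forall>x y. norm (ip x y) \<le> norm x * norm y * K"
    by (rule exI[of _ 1]) (simp add: norm_ip)
qed (simp_all add: ip_simps)

lemmas tendsto_ip = bounded_bilinear.tendsto[OF bounded_bilinear_ip]
lemmas continuous_on_ip = bounded_bilinear.continuous_on[OF bounded_bilinear_ip]

lemma norm_act: "norm (act a x) \<le> norm a * norm x"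
proof -
  have "(norm (act a x))\<^sup>2 = norm (star a * a * ip x x)"
    by (simp add: norm_ip_self[symmetric] ip_simps mult_ac)
  also have "\<dots> \<le> (norm a * norm x)\<^sup>2"
    using norm_mult_ineq[of "star a * a" "ip x x"] by (simp add: norm_ip_self norm_star_mult power_mult_distrib)
  finally show ?thesis by (rule power2_le_imp_le) simp
qed

lemma act_scaleR_left: "act (r *\<^sub>R a) x = r *\<^sub>R act a x"
  using act_scaleC_left[of "of_real r"] by (simp add: scaleC_of_real)

lemma act_scaleR_right: "act a (r *\<^sub>R x) = r *\<^sub>R act a x"
  using act_scaleC_right[of a "of_real r"] by (simp add: scaleC_of_real)

lemma bounded_bilinear_act: "bounded_bilinear act"
proof
  show "\<exists>K. \<forall>a x. norm (act a x) \<le> norm a * norm x * K"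
    by (rule exI[of _ 1]) (simp add: norm_act)
qed (simp_all add: act_add_left act_add_right act_scaleR_left act_scaleR_right)

lemma closed_adj_self: "closed {X. adj X X}"
proof -
  have *: "{X. adj X X} = (\<Inter>x. \<Inter>y. {X. ip (ap X x) y = ip x (ap X y)})"
    by (auto simp: adj_def)
  show ?thesis
    unfolding * by (intro closed_INT ballI closed_Collect_eq continuous_on_ip ap.continuous_on continuous_intros)
qed

lemma closed_commute_map:
  assumes "continuous_on UNIV f"
  shows "closed {X. \<forall>x. ap X (f x) = f (ap X x)}"
proof -
  have *: "{X. \<forall>x. ap X (f x) = f (ap X x)} = (\<Inter>x. {X. ap X (f x) = f (ap X x)})"
    by auto
  show ?thesis
    unfolding * by (intro closed_INT ballI closed_Collect_eq ap.continuous_on continuous_intros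
        continuous_on_compose2[OF assms]) auto
qed

text \<open>Commutation is stated for plain functions \<open>f\<close>, since the elements of
  \<open>G\<close> are functions and not of type \<open>endo\<close>.\<close>

lemma self_adjoint_sqrt:
  assumes Z: "adj Z Z" and "norm (1 - Z) \<le> 1"
  obtains R where "adj R R" "R * R = Z" "norm (1 - R) \<le> 1"
    "\<And>f x. linear f \<Longrightarrow> continuous_on UNIV f \<Longrightarrow> (\<And>y. ap Z (f y) = f (ap Z y)) \<Longrightarrow> ap R (f x) = f (ap R x)"
proof -
  obtain w where w: "(1 - Z) + w * w = 2 *\<^sub>R w" "norm w \<le> 1"
    "\<And>S. closed S \<Longrightarrow> 0 \<in> S \<Longrightarrow> (\<And>x. x \<in> S \<Longrightarrow> (1/2) *\<^sub>R ((1 - Z) + x * x) \<in> S) \<Longrightarrow> w \<in> S"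
    using half_square_solution[OF assms(2)] by metis
  show thesis
  proof (rule that[of "1 - w"])
    have "w \<in> {X. adj X X}"
      by (rule w(3)[OF closed_adj_self]) (auto intro!: adj_intros Z)
    then show "adj (1 - w) (1 - w)" by (auto intro: adj_intros)
    show "(1 - w) * (1 - w) = Z"
      using w(1) by (simp add: algebra_simps scaleR_2)
    show "norm (1 - (1 - w)) \<le> 1" using w(2) by simp
    fix f x
    assume f: "linear f" and cont: "continuous_on UNIV f" and comm: "\<And>x. ap Z (f x) = f (ap Z x)"
    have "w \<in> {X. \<forall>x. ap X (f x) = f (ap X x)}"
      by (rule w(3)[OF closed_commute_map[OF cont]])
        (simp_all add: comm linear_0[OF f] linear_add[OF f] linear_diff[OF f] linear_scale[OF f])
    then show "ap (1 - w) (f x) = f (ap (1 - w) x)"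
      by (simp add: linear_diff[OF f])
  qed
qed

text \<open>If \<open>R\<close> is a self-adjoint root of \<open>1 - Z\<close>, the form of
  \<open>1 - Z\<close> at \<open>x\<close> is the inner square of \<open>ap R x\<close>.\<close>

lemma contraction_positive:
  assumes Z: "adj Z Z" and "norm Z \<le> 1"
  shows "ip (ap Z x) x \<preceq> ip x x"
proof -
  have "adj (1 - Z) (1 - Z)" "norm (1 - (1 - Z)) \<le> 1"
    using assms by (auto intro: adj_intros)
  then obtain R where R: "adj R R" "R * R = 1 - Z"
    by (rule self_adjoint_sqrt)
  have "ip (ap (1 - Z) x) x = ip (ap R x) (ap R x)"
    unfolding R(2)[symmetric] by (simp add: adjD[OF R(1)])
  then have "cstar_positive (ip (ap (1 - Z) x) x)" by (simp add: ip_positive)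
  then show ?thesis by (simp add: cle_def ip_diff_left)
qed

lemma norm_adj_le:
  assumes "adj Z Y"
  shows "norm Y \<le> norm Z"
proof (rule norm_endo_le)
  fix y
  have "norm (ap Y y) * norm (ap Y y) = norm (ip (ap Z (ap Y y)) y)"
    by (simp add: adjD[OF assms] norm_ip_self power2_eq_square)
  also have "\<dots> \<le> norm (ap Z (ap Y y)) * norm y" by (rule norm_ip)
  also have "\<dots> \<le> norm Z * norm (ap Y y) * norm y" by (intro mult_right_mono norm_ap) simp
  finally show "norm (ap Y y) \<le> norm Z * norm y"
    by (cases "ap Y y = 0") (simp_all add: mult_ac)
qed simp

lemma contraction_ip_le:
  assumes Z: "adj Z Z'" and n: "norm Z \<le> 1"
  shows "ip (ap Z x) (ap Z x) \<preceq> ip x x"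
proof -
  have "norm (Z' * Z) \<le> 1"
    using norm_mult_ineq[of Z' Z] norm_adj_le[OF Z] n by (meson mult_le_one norm_ge_zero order_trans)
  with contraction_positive[of "Z' * Z" x] show ?thesis
    using Z by (simp add: adj_intros adj_sym adjD[OF adj_sym[OF Z]])
qed

text \<open>Cauchy-Schwarz for the form of \<open>Y\<close>, applied to \<open>x\<close> and
  \<open>ap Y x\<close>, bounds \<open>norm (ap Y x) ^ 4\<close> by \<open>t^2\<close> times the
  squares of both norms; one square cancels.\<close>

lemma norm_le_of_form_le:
  assumes Y: "adj Y Y" and pos: "\<And>x. cstar_positive (ip (ap Y x) x)"
    and le: "\<And>x. ip (ap Y x) x \<preceq> t *\<^sub>R ip x x" and t: "0 \<le> t"
  shows "norm Y \<le> t"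
proof (rule norm_endo_le[OF t])
  fix x
  have b: "norm (ip (ap Y z) z) \<le> t * (norm z)\<^sup>2" for z
    using norm_mono[OF pos le, of z] t by (simp add: norm_ip_self)
  let ?n = "(norm (ap Y x))\<^sup>2"
  have "?n * ?n \<le> (t * (norm x)\<^sup>2) * (t * ?n)"
    using order_trans[OF form_cauchy_schwarz[OF Y pos, of x "ap Y x"] mult_mono[OF b b]] t
    by (simp add: norm_ip_self power2_eq_square[of "?n"])
  then have "?n \<le> (t * norm x)\<^sup>2"
    by (cases "ap Y x = 0") (simp_all add: power_mult_distrib power2_eq_square mult_ac t)
  then show "norm (ap Y x) \<le> t * norm x"
    by (rule power2_le_imp_le) (simp add: t)
qed

definition scal :: "complex \<Rightarrow> 'h endo" where
  "scal c = endo_of ((*\<^sub>C) c)"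

lemma ap_scal [simp]: "ap (scal c) x = c *\<^sub>C x"
  by (simp add: scal_def ap_endo_of scaleC.bounded_linear_right)

lemma adj_scal: "adj (scal c) (scal (cnj c))"
  by (simp add: adj_def ip_simps)

lemma twice_re_ip_le:
  assumes "cmod z \<le> 1"
  shows "z *\<^sub>C ip x y + star (z *\<^sub>C ip x y) \<preceq> ip x x + ip y y"
proof -
  have 1: "z *\<^sub>C ip x y + star (z *\<^sub>C ip x y) \<preceq> (cmod z)\<^sup>2 *\<^sub>R ip x x + ip y y"
  proof -
    have "cnj z *\<^sub>C z *\<^sub>C ip x x = of_real ((cmod z)\<^sup>2) *\<^sub>C ip x x"
      unfolding scaleC_scaleC by (simp only: complex_norm_square mult.commute)
    then have "cnj z *\<^sub>C z *\<^sub>C ip x x = (cmod z)\<^sup>2 *\<^sub>R ip x x"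
      by (simp only: scaleC_of_real)
    then have "ip (z *\<^sub>C x - y) (z *\<^sub>C x - y)
        = (cmod z)\<^sup>2 *\<^sub>R ip x x + ip y y - (z *\<^sub>C ip x y + star (z *\<^sub>C ip x y))"
      by (simp add: ip_simps star_scaleC star_ip scaleC_of_real scaleC.diff_right)
    then show ?thesis using ip_positive[of "z *\<^sub>C x - y"] by (simp add: cle_def)
  qed
  have "(cmod z)\<^sup>2 *\<^sub>R ip x x + ip y y \<preceq> 1 *\<^sub>R ip x x + ip y y"
    using assms cstar_positive_scaleR[of "1 - (cmod z)\<^sup>2" "ip x x"]
    by (simp add: cle_def ip_positive scaleR_diff_left power_le_one)
  with 1 show ?thesis using cle_trans by fastforce
qed

end

section \<open>Parseval frame vectors of a unitary group\<close>

lemma summable_on_CauchyI: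
  fixes f :: "'i \<Rightarrow> 'b::banach"
  assumes "\<And>\<epsilon>. \<epsilon> > 0 \<Longrightarrow> \<exists>F0. finite F0 \<and> F0 \<subseteq> I \<and>
    (\<forall>F. finite F \<longrightarrow> F \<subseteq> I \<longrightarrow> F \<inter> F0 = {} \<longrightarrow> norm (sum f F) \<le> \<epsilon>)"
  shows "f summable_on I"
proof -
  have "cauchy_filter (filtermap (sum f) (finite_subsets_at_top I))"
  proof (subst cauchy_filter_metric_filtermap, intro allI impI)
    fix \<epsilon> :: real assume \<epsilon>: "\<epsilon> > 0"
    then obtain F0 where F0: "finite F0" "F0 \<subseteq> I"
      "\<And>F. finite F \<Longrightarrow> F \<subseteq> I \<Longrightarrow> F \<inter> F0 = {} \<Longrightarrow> norm (sum f F) \<le> \<epsilon> / 3"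
      using assms[of "\<epsilon> / 3"] by auto
    have d: "norm (sum f F - sum f F0) \<le> \<epsilon> / 3" if "finite F" "F \<subseteq> I" "F0 \<subseteq> F" for F
      using F0(3)[of "F - F0"] that by (auto simp: sum_diff)
    show "\<exists>P. eventually P (finite_subsets_at_top I) \<and> (\<forall>F F'. P F \<and> P F' \<longrightarrow> dist (sum f F) (sum f F') < \<epsilon>)"
    proof (intro exI[of _ "\<lambda>F. finite F \<and> F \<subseteq> I \<and> F0 \<subseteq> F"] conjI allI impI)
      show "\<forall>\<^sub>F F in finite_subsets_at_top I. finite F \<and> F \<subseteq> I \<and> F0 \<subseteq> F"
        unfolding eventually_finite_subsets_at_top using F0 by blast
      fix F F' assume "(finite F \<and> F \<subseteq> I \<and> F0 \<subseteq> F) \<and> (finite F' \<and> F' \<subseteq> I \<and> F0 \<subseteq> F')"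
      then have "norm (sum f F - sum f F0) \<le> \<epsilon> / 3" "norm (sum f F' - sum f F0) \<le> \<epsilon> / 3"
        using d by auto
      then have "norm ((sum f F - sum f F0) - (sum f F' - sum f F0)) \<le> \<epsilon> / 3 + \<epsilon> / 3"
        by (rule norm_triangle_le_diff[OF add_mono])
      then show "dist (sum f F) (sum f F') < \<epsilon>" using \<epsilon> by (simp add: dist_norm)
    qed
  qed
  then obtain s where "filtermap (sum f) (finite_subsets_at_top I) \<le> nhds s"
    using cauchy_filter_complete_converges[of "filtermap (sum f) (finite_subsets_at_top I)" UNIV] complete_UNIV
    by (auto simp: filtermap_bot_iff)
  then show ?thesis
    by (auto simp: summable_on_def has_sum_def filterlim_def)
qed

lemma has_sum_minus:
  fixes f g :: "'i \<Rightarrow> 'b::real_normed_vector"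
  assumes "(f has_sum a) I" "(g has_sum b) I"
  shows "((\<lambda>i. f i - g i) has_sum (a - b)) I"
  using has_sum_add[OF assms(1) has_sum_bounded_linear[OF bounded_linear_minus[OF bounded_linear_ident] assms(2)]]
  by simp

lemma summable_on_CauchyD:
  fixes f :: "'i \<Rightarrow> 'b::real_normed_vector"
  assumes "f summable_on I" "\<epsilon> > 0"
  shows "\<exists>F0. finite F0 \<and> F0 \<subseteq> I \<and>
    (\<forall>F. finite F \<longrightarrow> F \<subseteq> I \<longrightarrow> F \<inter> F0 = {} \<longrightarrow> norm (sum f F) \<le> \<epsilon>)"
proof -
  obtain s where s: "(f has_sum s) I" using assms by (auto simp: summable_on_def)
  have "\<forall>\<^sub>F F in finite_subsets_at_top I. dist (sum f F) s < \<epsilon> / 2"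
    using tendstoD[OF s[unfolded has_sum_def], of "\<epsilon> / 2"] assms(2) by simp
  then obtain F0 where F0: "finite F0" "F0 \<subseteq> I"
    and F0': "\<forall>F. finite F \<and> F0 \<subseteq> F \<and> F \<subseteq> I \<longrightarrow> dist (sum f F) s < \<epsilon> / 2"
    unfolding eventually_finite_subsets_at_top by (elim exE conjE)
  show ?thesis
  proof (intro exI[of _ F0] conjI F0 allI impI)
    fix F assume F: "finite F" "F \<subseteq> I" "F \<inter> F0 = {}"
    have "sum f (F \<union> F0) = sum f F + sum f F0"
      using F F0 by (intro sum.union_disjoint) auto
    then have "norm (sum f F) = norm ((sum f (F \<union> F0) - s) - (sum f F0 - s))" by simp
    also have "\<dots> \<le> \<epsilon> / 2 + \<epsilon> / 2"
      using F0'[THEN spec, of "F \<union> F0"] F0'[THEN spec, of F0] F F0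
        norm_triangle_ineq4[of "sum f (F \<union> F0) - s" "sum f F0 - s"]
      by (simp add: dist_norm)
    finally show "norm (sum f F) \<le> \<epsilon>" by simp
  qed
qed

text \<open>For series that Cauchy-Schwarz controls on finite sets: \<open>g\<close> consists of the
  squares of the coefficients, and its small tails make the partial sums of \<open>f\<close>
  Cauchy.\<close>

lemma
  fixes f :: "'i \<Rightarrow> 'b::banach" and g :: "'i \<Rightarrow> 'c::real_normed_vector"
  assumes g: "g summable_on I" and c: "0 \<le> c"
    and le: "\<And>F. finite F \<Longrightarrow> F \<subseteq> I \<Longrightarrow> (norm (sum f F))\<^sup>2 \<le> norm (sum g F) * c"
  shows summable_on_dominated: "f summable_on I"
    and norm_infsum_dominated: "(norm (infsum f I))\<^sup>2 \<le> norm (infsum g I) * c"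
proof -
  show f: "f summable_on I"
  proof (rule summable_on_CauchyI)
    fix \<epsilon> :: real assume \<epsilon>: "\<epsilon> > 0"
    have pos: "\<epsilon>\<^sup>2 / (c + 1) > 0" using \<epsilon> c by simp
    obtain F0 where F0: "finite F0" "F0 \<subseteq> I" and
      small: "\<forall>F. finite F \<longrightarrow> F \<subseteq> I \<longrightarrow> F \<inter> F0 = {} \<longrightarrow> norm (sum g F) \<le> \<epsilon>\<^sup>2 / (c + 1)"
      using summable_on_CauchyD[OF g pos] by (elim exE conjE)
    have "norm (sum f F) \<le> \<epsilon>" if F: "finite F" "F \<subseteq> I" "F \<inter> F0 = {}" for F
    proof (rule power2_le_imp_le)
      have "(norm (sum f F))\<^sup>2 \<le> (\<epsilon>\<^sup>2 / (c + 1)) * c"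
        by (rule order_trans[OF le[OF F(1,2)] mult_right_mono[OF small[rule_format, OF F] c]])
      also have "\<dots> \<le> \<epsilon>\<^sup>2" using c by (simp add: divide_simps mult_left_mono)
      finally show "(norm (sum f F))\<^sup>2 \<le> \<epsilon>\<^sup>2" .
    qed (use \<epsilon> in simp)
    then show "\<exists>F0. finite F0 \<and> F0 \<subseteq> I \<and>
        (\<forall>F. finite F \<longrightarrow> F \<subseteq> I \<longrightarrow> F \<inter> F0 = {} \<longrightarrow> norm (sum f F) \<le> \<epsilon>)"
      using F0 by (intro exI[of _ F0]) simp
  qed
  have lim1: "((\<lambda>F. (norm (sum f F))\<^sup>2) \<longlongrightarrow> (norm (infsum f I))\<^sup>2) (finite_subsets_at_top I)"
    by (intro tendsto_power tendsto_norm has_sum_infsum[OF f, unfolded has_sum_def])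
  have lim2: "((\<lambda>F. norm (sum g F) * c) \<longlongrightarrow> norm (infsum g I) * c) (finite_subsets_at_top I)"
    by (intro tendsto_mult tendsto_const tendsto_norm has_sum_infsum[OF g, unfolded has_sum_def])
  show "(norm (infsum f I))\<^sup>2 \<le> norm (infsum g I) * c"
    by (rule tendsto_le[OF finite_subsets_at_top_neq_bot lim2 lim1 eventually_finite_subsets_at_top_weakI])
      (rule le)
qed

context unital_cstar
begin

lemma has_sum_finite_le:
  fixes f :: "'i \<Rightarrow> 'a"
  assumes s: "(f has_sum s) I" and pos: "\<And>i. i \<in> I \<Longrightarrow> cstar_positive (f i)" and F: "finite F" "F \<subseteq> I"
  shows "sum f F \<preceq> s"
proof -
  have "((\<lambda>F'. sum f F' - sum f F) \<longlongrightarrow> s - sum f F) (finite_subsets_at_top I)"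
    using s unfolding has_sum_def by (intro tendsto_diff tendsto_const)
  moreover have "\<forall>\<^sub>F F' in finite_subsets_at_top I. sum f F' - sum f F \<in> {a. cstar_positive a}"
    unfolding eventually_finite_subsets_at_top
    by (rule exI[of _ F]) (use F pos in \<open>auto simp: sum_diff[symmetric] intro!: cstar_positive_sum\<close>)
  ultimately have "s - sum f F \<in> {a. cstar_positive a}"
    by (intro Lim_in_closed_set[OF closed_cstar_positive]) auto
  then show ?thesis by (simp add: cle_def)
qed

end

locale group_frames = comm_hilbert_module act ip e
  for act :: "'a::{cstar_algebra, comm_ring} \<Rightarrow> 'h::complex_banach \<Rightarrow> 'h"
    and ip :: "'h \<Rightarrow> 'h \<Rightarrow> 'a" and e :: 'a +
  fixes G :: "('h \<Rightarrow> 'h) set"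
  assumes unitary_group: "unitary_group ip G"
begin

section \<open>The unitary action of the group\<close>

lemma id_in_G: "id \<in> G"
  and comp_in_G: "U \<in> G \<Longrightarrow> V \<in> G \<Longrightarrow> U \<circ> V \<in> G"
  and inv_in_G: "U \<in> G \<Longrightarrow> inv U \<in> G"
  using unitary_group by (auto simp: unitary_group_def)

lemma
  assumes U: "U \<in> G"
  shows G_inv: "inv U (U x) = x" "U (inv U x) = x"
    and ip_G: "ip (U x) y = ip x (inv U y)"
proof -
  obtain V where V: "\<And>x y. ip (U x) y = ip x (V y)" "V \<circ> U = id" "U \<circ> V = id"
    using unitary_group U unfolding unitary_group_def unitary_operator_def by blast
  then have "inv U = V" by (intro inv_unique_comp)
  then show "inv U (U x) = x" "U (inv U x) = x" "ip (U x) y = ip x (inv U y)"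
    using V by (auto simp: fun_eq_iff)
qed

lemma ip_G_G: "U \<in> G \<Longrightarrow> ip (U x) (U y) = ip x y"
  by (simp add: ip_G G_inv)

lemma ip_G': "U \<in> G \<Longrightarrow> ip x (U y) = ip (inv U x) y"
  by (metis ip_G star_ip)

lemma norm_G: "U \<in> G \<Longrightarrow> norm (U x) = norm x"
  by (simp add: norm_eq_ip ip_G_G)

lemma G_add: "U \<in> G \<Longrightarrow> U (x + y) = U x + U y"
  and G_act: "U \<in> G \<Longrightarrow> U (act a x) = act a (U x)"
  and G_scaleC: "U \<in> G \<Longrightarrow> U (c *\<^sub>C x) = c *\<^sub>C U x"
  by (rule ip_eqI; simp add: ip_G ip_simps)+

lemma G_bounded_linear: "U \<in> G \<Longrightarrow> bounded_linear U"
proof (rule bounded_linear_intro[where K = 1])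
  fix x y and r :: real
  assume U: "U \<in> G"
  show "U (x + y) = U x + U y" by (rule G_add[OF U])
  show "U (r *\<^sub>R x) = r *\<^sub>R U x"
    using G_scaleC[OF U, of "of_real r"] by (simp add: scaleC_of_real)
  show "norm (U x) \<le> norm x * 1" by (simp add: norm_G[OF U])
qed

lemmas G_linear = bounded_linear.linear[OF G_bounded_linear]

lemma G_continuous: "U \<in> G \<Longrightarrow> continuous_on UNIV U"
  by (simp add: linear_continuous_on G_bounded_linear)

lemma bij_inv_G: "bij_betw inv G G"
proof -
  have "inv (inv U) = U" if "U \<in> G" for U
    using that by (intro inv_inv_eq o_bij[of "inv U"]) (auto simp: fun_eq_iff G_inv)
  then show ?thesis
    by (intro bij_betwI[where g = inv]) (auto intro: inv_in_G)
qed

lemma bij_comp_G: "V \<in> G \<Longrightarrow> bij_betw ((\<circ>) V) G G"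
  by (rule bij_betwI[where g = "(\<circ>) (inv V)"]) (auto simp: comp_in_G inv_in_G fun_eq_iff G_inv)

section \<open>Frame expansions, synthesis and cross operators\<close>

abbreviation PF :: "'h \<Rightarrow> bool" where
  "PF \<equiv> complete_parseval_frame_vector ip G"

lemma PF_has_sum: "PF \<zeta> \<Longrightarrow> ((\<lambda>U. ip x (U \<zeta>) * ip (U \<zeta>) x) has_sum ip x x) G"
  by (simp add: complete_parseval_frame_vector_def parseval_frame_def)

lemma PF_countable: "PF \<zeta> \<Longrightarrow> countable G"
  by (simp add: complete_parseval_frame_vector_def parseval_frame_def)

text \<open>It serves twice: to extend the frame identity off the diagonal, and to split the matrix
  coefficients of operator powers into four decreasing sequences.\<close>

lemma polarization:
  assumes "\<And>x y z. B (x + y) z = B x z + B y (z::'h)" "\<And>x y z. B x (y + z) = B x y + B x z"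
    "\<And>c x y. B (c *\<^sub>C x) y = c *\<^sub>C B x y" "\<And>c x y. B x (c *\<^sub>C y) = cnj c *\<^sub>C B x y"
  shows "B x y = (1/4) *\<^sub>R ((B (x + y) (x + y) - B (x + (-1) *\<^sub>C y) (x + (-1) *\<^sub>C y))
    + \<i> *\<^sub>C (B (x + \<i> *\<^sub>C y) (x + \<i> *\<^sub>C y) - B (x + (- \<i>) *\<^sub>C y) (x + (- \<i>) *\<^sub>C y)))"
    (is "_ = _ *\<^sub>R (?P + _)")
proof -
  have 1: "?P = 2 *\<^sub>R (B x y + B y x)"
    by (simp only: assms) (simp add: scaleC.minus_left scaleR_2)
  have 2: "B (x + \<i> *\<^sub>C y) (x + \<i> *\<^sub>C y) - B (x + (- \<i>) *\<^sub>C y) (x + (- \<i>) *\<^sub>C y)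
      = 2 *\<^sub>R (\<i> *\<^sub>C B y x - \<i> *\<^sub>C B x y)"
    by (simp only: assms) (simp add: scaleC.minus_left scaleC.add_right scaleC.diff_right scaleR_2 scaleC_scaleC)
  show ?thesis
    unfolding 1 2
    by (simp add: scaleC.scaleR_right scaleC.diff_right scaleC_scaleC scaleC.minus_left flip: scaleR_add_right)
qed

lemma PF_polar:
  assumes "PF \<zeta>"
  shows "((\<lambda>U. ip x (U \<zeta>) * ip (U \<zeta>) y) has_sum ip x y) G"
proof -
  let ?B = "\<lambda>U x y. ip x (U \<zeta>) * ip (U \<zeta>) y"
  have B: "?B U x y = (1/4) *\<^sub>R ((?B U (x + y) (x + y) - ?B U (x + (-1) *\<^sub>C y) (x + (-1) *\<^sub>C y))
    + \<i> *\<^sub>C (?B U (x + \<i> *\<^sub>C y) (x + \<i> *\<^sub>C y) - ?B U (x + (- \<i>) *\<^sub>C y) (x + (- \<i>) *\<^sub>C y)))" for U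
    by (rule polarization) (simp_all add: ip_simps algebra_simps mult_scaleC_left mult_scaleC_right)
  have I: "ip x y = (1/4) *\<^sub>R ((ip (x + y) (x + y) - ip (x + (-1) *\<^sub>C y) (x + (-1) *\<^sub>C y))
    + \<i> *\<^sub>C (ip (x + \<i> *\<^sub>C y) (x + \<i> *\<^sub>C y) - ip (x + (- \<i>) *\<^sub>C y) (x + (- \<i>) *\<^sub>C y)))"
    by (rule polarization) (simp_all only: ip_simps)
  show ?thesis
    unfolding B by (subst I) (intro has_sum_bounded_linear[OF bounded_linear_scaleR_right]
      has_sum_bounded_linear[OF scaleC.bounded_linear_right] has_sum_add has_sum_minus PF_has_sum assms)
qed

lemma PF_coefficients:
  assumes "PF \<zeta>"
  shows "((\<lambda>U. ip x (U \<zeta>) * star (ip x (U \<zeta>))) has_sum ip x x) G"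
  using PF_has_sum[OF assms] by (simp add: star_ip)

text \<open>For the synthesized vector \<open>v\<close>, Cauchy-Schwarz applied to
  \<open>ip v v\<close> produces a second factor that the Parseval identity of \<open>v\<close>
  bounds by \<open>norm v ^ 2\<close>; that factor cancels.\<close>

lemma synthesis_finite_norm:
  assumes \<zeta>: "PF \<zeta>" and F: "finite F" "F \<subseteq> G"
  shows "(norm (\<Sum>U\<in>F. act (c U) (U \<zeta>)))\<^sup>2 \<le> norm (\<Sum>U\<in>F. c U * star (c U))"
proof -
  let ?v = "\<Sum>U\<in>F. act (c U) (U \<zeta>)"
  have "ip ?v ?v = (\<Sum>U\<in>F. c U * star (ip ?v (U \<zeta>)))"
    by (subst ip_sum_left) (simp add: ip_act_left star_ip)
  then have "((norm ?v)\<^sup>2)\<^sup>2 \<le> norm (\<Sum>U\<in>F. c U * star (c U)) * norm (\<Sum>U\<in>F. ip ?v (U \<zeta>) * star (ip ?v (U \<zeta>)))"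
    using sum_cauchy_schwarz[of c "\<lambda>U. ip ?v (U \<zeta>)" F] by (simp add: norm_ip_self[symmetric])
  also have "norm (\<Sum>U\<in>F. ip ?v (U \<zeta>) * star (ip ?v (U \<zeta>))) \<le> norm (ip ?v ?v)"
  proof (rule norm_mono)
    show "cstar_positive (\<Sum>U\<in>F. ip ?v (U \<zeta>) * star (ip ?v (U \<zeta>)))"
      by (intro cstar_positive_sum cstar_positive_mult_star)
    show "(\<Sum>U\<in>F. ip ?v (U \<zeta>) * star (ip ?v (U \<zeta>))) \<preceq> ip ?v ?v"
      by (rule has_sum_finite_le[OF PF_coefficients[OF \<zeta>] cstar_positive_mult_star F])
  qed
  finally show ?thesis
    by (cases "?v = 0") (simp_all add: norm_ip_self power2_eq_square mult_left_mono)
qed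

definition synthesis :: "'h \<Rightarrow> (('h \<Rightarrow> 'h) \<Rightarrow> 'a) \<Rightarrow> 'h" where
  "synthesis \<zeta> c = (\<Sum>\<^sub>\<infinity>U\<in>G. act (c U) (U \<zeta>))"

lemma
  assumes \<zeta>: "PF \<zeta>" and c: "(\<lambda>U. c U * star (c U)) summable_on G"
  shows has_sum_synthesis: "((\<lambda>U. act (c U) (U \<zeta>)) has_sum synthesis \<zeta> c) G"
    and ip_synthesis: "((\<lambda>U. c U * ip (U \<zeta>) y) has_sum ip (synthesis \<zeta> c) y) G"
    and norm_synthesis: "(norm (synthesis \<zeta> c))\<^sup>2 \<le> norm (\<Sum>\<^sub>\<infinity>U\<in>G. c U * star (c U))"
proof -
  have le: "(norm (\<Sum>U\<in>F. act (c U) (U \<zeta>)))\<^sup>2 \<le> norm (\<Sum>U\<in>F. c U * star (c U)) * 1"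
    if "finite F" "F \<subseteq> G" for F
    using synthesis_finite_norm[OF \<zeta> that] by simp
  from summable_on_dominated[OF c zero_le_one le]
  show hs: "((\<lambda>U. act (c U) (U \<zeta>)) has_sum synthesis \<zeta> c) G"
    by (simp add: synthesis_def)
  show "((\<lambda>U. c U * ip (U \<zeta>) y) has_sum ip (synthesis \<zeta> c) y) G"
    using has_sum_bounded_linear[OF bounded_bilinear.bounded_linear_left[OF bounded_bilinear_ip] hs, of y]
    by (simp add: ip_act_left)
  show "(norm (synthesis \<zeta> c))\<^sup>2 \<le> norm (\<Sum>\<^sub>\<infinity>U\<in>G. c U * star (c U))"
    using norm_infsum_dominated[OF c zero_le_one le] by (simp add: synthesis_def)
qed

text \<open>Analysis with \<zeta> followed by synthesis with \<eta>; the \<open>K\<close> of the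
  overview is \<open>cross \<xi> \<eta>\<close>. For a single vector \<open>cross_self\<close> is
  the reconstruction formula.\<close>

definition cross :: "'h \<Rightarrow> 'h \<Rightarrow> 'h endo" where
  "cross \<zeta> \<eta> = endo_of (\<lambda>x. synthesis \<eta> (\<lambda>U. ip x (U \<zeta>)))"

lemma
  assumes \<zeta>: "PF \<zeta>" and \<eta>: "PF \<eta>"
  shows ap_cross: "ap (cross \<zeta> \<eta>) x = synthesis \<eta> (\<lambda>U. ip x (U \<zeta>))"
    and ip_cross: "((\<lambda>U. ip x (U \<zeta>) * ip (U \<eta>) y) has_sum ip (ap (cross \<zeta> \<eta>) x) y) G"
    and norm_cross: "norm (cross \<zeta> \<eta>) \<le> 1"
proof -
  let ?s = "\<lambda>x. synthesis \<eta> (\<lambda>U. ip x (U \<zeta>))"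
  have sm: "(\<lambda>U. ip x (U \<zeta>) * star (ip x (U \<zeta>))) summable_on G" for x
    by (rule has_sum_imp_summable[OF PF_coefficients[OF \<zeta>]])
  have ip_s: "((\<lambda>U. ip x (U \<zeta>) * ip (U \<eta>) y) has_sum ip (?s x) y) G" for x y
    by (rule ip_synthesis[OF \<eta> sm])
  have n: "norm (?s x) \<le> norm x" for x
    using norm_synthesis[OF \<eta> sm, of x] infsumI[OF PF_coefficients[OF \<zeta>, of x]]
    by (intro power2_le_imp_le[of "norm (?s x)"]) (simp_all add: norm_ip_self)
  have "bounded_linear ?s"
  proof (rule bounded_linear_intro[where K = 1])
    fix x y and r :: real
    show "?s (x + y) = ?s x + ?s y"
    proof (rule ip_eqI)
      fix z
      have "((\<lambda>U. ip (x + y) (U \<zeta>) * ip (U \<eta>) z) has_sum ip (?s x) z + ip (?s y) z) G"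
        using has_sum_add[OF ip_s ip_s] by (simp add: ip_add_left distrib_right)
      then show "ip (?s (x + y)) z = ip (?s x + ?s y) z"
        unfolding ip_add_left[of "?s x"] by (rule has_sum_unique[OF ip_s])
    qed
    show "?s (r *\<^sub>R x) = r *\<^sub>R ?s x"
    proof (rule ip_eqI)
      fix z
      have "((\<lambda>U. ip (r *\<^sub>R x) (U \<zeta>) * ip (U \<eta>) z) has_sum r *\<^sub>R ip (?s x) z) G"
        using has_sum_bounded_linear[OF bounded_linear_scaleR_right ip_s] by (simp add: ip_scaleR_left)
      then show "ip (?s (r *\<^sub>R x)) z = ip (r *\<^sub>R ?s x) z"
        unfolding ip_scaleR_left[of r "?s x"] by (rule has_sum_unique[OF ip_s])
    qed
    show "norm (?s x) \<le> norm x * 1" using n by simp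
  qed
  then show ap: "ap (cross \<zeta> \<eta>) x = ?s x" for x
    by (simp add: cross_def ap_endo_of)
  show "((\<lambda>U. ip x (U \<zeta>) * ip (U \<eta>) y) has_sum ip (ap (cross \<zeta> \<eta>) x) y) G"
    unfolding ap by (rule ip_s)
  show "norm (cross \<zeta> \<eta>) \<le> 1"
    by (rule norm_endo_le) (simp_all add: ap n)
qed

lemma cross_self:
  assumes "PF \<zeta>"
  shows "cross \<zeta> \<zeta> = 1"
  by (intro endo_eqI ip_eqI) (simp add: has_sum_unique[OF ip_cross[OF assms assms] PF_polar[OF assms]])

section \<open>The commutant of the group and its trace\<close>

definition cadj :: "'h endo \<Rightarrow> 'h endo \<Rightarrow> bool" where
  "cadj X X' \<longleftrightarrow> adj X X' \<and> (\<forall>U\<in>G. \<forall>x. ap X (U x) = U (ap X x))"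

lemma cadj_adj: "cadj X X' \<Longrightarrow> adj X X'"
  and cadj_commute: "cadj X X' \<Longrightarrow> U \<in> G \<Longrightarrow> ap X (U x) = U (ap X x)"
  by (auto simp: cadj_def)

lemma cadj_ip: "cadj X X' \<Longrightarrow> ip (ap X x) y = ip x (ap X' y)"
  by (simp add: cadj_def adjD)

text \<open>The adjoint commutes with \<open>U\<close> because \<open>X\<close> commutes with
  \<open>inv U\<close>, which lies in \<open>G\<close> too. So the commutant is closed under
  adjoints although \<open>cadj\<close> asks for commutation of \<open>X\<close> only.\<close>

lemma cadj_sym: "cadj X X' \<Longrightarrow> cadj X' X"
  unfolding cadj_def
proof (intro conjI ballI allI)
  fix U x assume X: "adj X X' \<and> (\<forall>U\<in>G. \<forall>x. ap X (U x) = U (ap X x))" and U: "U \<in> G"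
  have "ip (ap X' (U x)) y = ip (U (ap X' x)) y" for y
  proof -
    have "ip (ap X' (U x)) y = ip x (inv U (ap X y))"
      using adjD[OF adj_sym] X ip_G[OF U] by metis
    also have "\<dots> = ip x (ap X (inv U y))" using X inv_in_G[OF U] by simp
    also have "\<dots> = ip (U (ap X' x)) y"
      using adjD[OF adj_sym] X ip_G[OF U] by metis
    finally show ?thesis .
  qed
  then show "ap X' (U x) = U (ap X' x)" by (rule ip_eqI)
qed (simp add: adj_sym)

lemma cadj_intros:
  "cadj 0 0" "cadj 1 1"
  "cadj X X' \<Longrightarrow> cadj Y Y' \<Longrightarrow> cadj (X + Y) (X' + Y')"
  "cadj X X' \<Longrightarrow> cadj Y Y' \<Longrightarrow> cadj (X - Y) (X' - Y')"
  "cadj X X' \<Longrightarrow> cadj (- X) (- X')"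
  "cadj X X' \<Longrightarrow> cadj Y Y' \<Longrightarrow> cadj (X * Y) (Y' * X')"
  "cadj X X' \<Longrightarrow> cadj (r *\<^sub>R X) (r *\<^sub>R X')"
  "cadj (scal c) (scal (cnj c))"
  unfolding cadj_def
  by (auto simp: adj_intros adj_scal linear_0[OF G_linear] linear_add[OF G_linear]
      linear_diff[OF G_linear] linear_neg[OF G_linear] linear_scale[OF G_linear] G_scaleC)

lemma cadj_power: "cadj X X \<Longrightarrow> cadj (X ^ n) (X ^ n)"
proof -
  assume X: "cadj X X"
  have "ap (X ^ n) (U x) = U (ap (X ^ n) x)" if "U \<in> G" for U x
    by (induction n) (simp_all add: cadj_commute[OF X that])
  then show ?thesis unfolding cadj_def using adj_power[OF cadj_adj[OF X]] by blast
qed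

lemma cadj_cross:
  assumes \<zeta>: "PF \<zeta>" and \<eta>: "PF \<eta>"
  shows "cadj (cross \<zeta> \<eta>) (cross \<eta> \<zeta>)"
  unfolding cadj_def adj_def
proof (intro conjI allI ballI)
  fix x y
  have "((\<lambda>U. star (ip y (U \<eta>) * ip (U \<zeta>) x)) has_sum star (ip (ap (cross \<eta> \<zeta>) y) x)) G"
    by (rule has_sum_bounded_linear[OF bounded_linear_star ip_cross[OF \<eta> \<zeta>]])
  then have "((\<lambda>U. ip x (U \<zeta>) * ip (U \<eta>) y) has_sum ip x (ap (cross \<eta> \<zeta>) y)) G"
    by (simp add: star_mult star_ip)
  then show "ip (ap (cross \<zeta> \<eta>) x) y = ip x (ap (cross \<eta> \<zeta>) y)"
    using ip_cross[OF \<zeta> \<eta>] has_sum_unique by blast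
next
  fix V x assume V: "V \<in> G"
  show "ap (cross \<zeta> \<eta>) (V x) = V (ap (cross \<zeta> \<eta>) x)"
  proof (rule ip_eqI)
    fix y
    have "((\<lambda>U. ip x (U \<zeta>) * ip (U \<eta>) (inv V y)) has_sum ip (ap (cross \<zeta> \<eta>) x) (inv V y)) G"
      by (rule ip_cross[OF \<zeta> \<eta>])
    also have "ip (ap (cross \<zeta> \<eta>) x) (inv V y) = ip (V (ap (cross \<zeta> \<eta>) x)) y"
      by (simp add: ip_G V)
    \<comment> \<open>Left translation by \<open>V\<close> permutes \<open>G\<close>; this is where
      commutation with the group comes from.\<close>
    also have "(\<lambda>U. ip x (U \<zeta>) * ip (U \<eta>) (inv V y)) = (\<lambda>U. ip (V x) ((V \<circ> U) \<zeta>) * ip ((V \<circ> U) \<eta>) y)"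
      by (simp only: o_apply ip_G_G[OF V] ip_G[OF V, symmetric])
    finally have "((\<lambda>U. ip (V x) (U \<zeta>) * ip (U \<eta>) y) has_sum ip (V (ap (cross \<zeta> \<eta>) x)) y) G"
      using has_sum_reindex_bij_betw[OF bij_comp_G[OF V], of "\<lambda>U. ip (V x) (U \<zeta>) * ip (U \<eta>) y"] by simp
    then show "ip (ap (cross \<zeta> \<eta>) (V x)) y = ip (V (ap (cross \<zeta> \<eta>) x)) y"
      using ip_cross[OF \<zeta> \<eta>] has_sum_unique by blast
  qed
qed

text \<open>Both sides are expanded in the frame. The term at \<open>U\<close> on one side is the
  term at \<open>inv U\<close> on the other with its two factors interchanged, and the algebra is
  commutative.\<close>

lemma trace_commute:
  assumes \<zeta>: "PF \<zeta>" and X: "cadj X X'" and Y: "cadj Y Y'"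
  shows "ip (ap X (ap Y \<zeta>)) \<zeta> = ip (ap Y (ap X \<zeta>)) \<zeta>"
proof -
  let ?g = "\<lambda>V. ip (ap X \<zeta>) (V \<zeta>) * ip (V \<zeta>) (ap Y' \<zeta>)"
  have "ip (ap Y \<zeta>) (U \<zeta>) * ip (U \<zeta>) (ap X' \<zeta>) = ?g (inv U)" if U: "U \<in> G" for U
  proof -
    have "ip (ap Y \<zeta>) (U \<zeta>) = ip (ap Y (inv U \<zeta>)) \<zeta>"
      by (simp only: ip_G'[OF U] cadj_commute[OF Y inv_in_G[OF U]])
    then have "ip (ap Y \<zeta>) (U \<zeta>) = ip (inv U \<zeta>) (ap Y' \<zeta>)"
      by (simp only: cadj_ip[OF Y])
    moreover have "ip (U \<zeta>) (ap X' \<zeta>) = ip (ap X \<zeta>) (inv U \<zeta>)"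
      by (simp only: cadj_ip[OF X, symmetric] cadj_commute[OF X U] ip_G[OF U])
    ultimately show ?thesis by (simp add: mult.commute)
  qed
  then have "((\<lambda>U. ?g (inv U)) has_sum ip (ap Y \<zeta>) (ap X' \<zeta>)) G"
    by (rule has_sum_cong[THEN iffD1, OF _ PF_polar[OF \<zeta>]])
  then have "(?g has_sum ip (ap Y \<zeta>) (ap X' \<zeta>)) G"
    using has_sum_reindex_bij_betw[OF bij_inv_G, of ?g] by simp
  moreover have "(?g has_sum ip (ap X \<zeta>) (ap Y' \<zeta>)) G"
    by (rule PF_polar[OF \<zeta>])
  ultimately have "ip (ap Y \<zeta>) (ap X' \<zeta>) = ip (ap X \<zeta>) (ap Y' \<zeta>)"
    by (rule has_sum_unique)
  then show ?thesis by (simp add: cadj_ip[OF X] cadj_ip[OF Y])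
qed

text \<open>Formally \<zeta>' is the adjoint of the isometry \<open>j\<close> applied to \<zeta>.
  Only this weak form is assumed, as \<open>j\<close> will be a strong limit for which no adjoint
  has been constructed.\<close>

lemma PF_transport:
  assumes \<zeta>: "PF \<zeta>" and "\<And>x U. U \<in> G \<Longrightarrow> ip x (U \<zeta>') = ip (j x) (U \<zeta>)"
    and "\<And>x. ip (j x) (j x) = ip x x"
  shows "PF \<zeta>'"
  unfolding complete_parseval_frame_vector_def parseval_frame_def
proof (intro conjI allI)
  fix x
  have "((\<lambda>U. ip (j x) (U \<zeta>) * ip (U \<zeta>) (j x)) has_sum ip x x) G"
    using PF_has_sum[OF \<zeta>, of "j x"] assms(3) by simp
  moreover have "ip (j x) (U \<zeta>) * ip (U \<zeta>) (j x) = ip x (U \<zeta>') * ip (U \<zeta>') x" if "U \<in> G" for U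
    using assms(2)[OF that] by (metis star_ip)
  ultimately show "((\<lambda>U. ip x (U \<zeta>') * ip (U \<zeta>') x) has_sum ip x x) G"
    by (rule has_sum_cong[THEN iffD1, rotated])
qed (rule PF_countable[OF \<zeta>])

text \<open>\<open>x\<close> is close to a finite combination of the \<open>U \<zeta>\<close>, and
  there the action of \<open>X\<close> is determined by \<open>ap X \<zeta>\<close>. As \<delta>
  depends only on \<open>M\<close>, \<open>x\<close> and \<epsilon>, convergence at \<zeta> becomes
  strong convergence on bounded parts of the commutant.\<close>

lemma commutant_small:
  assumes \<zeta>: "PF \<zeta>" and \<epsilon>: "\<epsilon> > 0"
  obtains \<delta> where "\<delta> > 0"
    "\<And>X X'. cadj X X' \<Longrightarrow> norm X \<le> M \<Longrightarrow> norm (ap X \<zeta>) < \<delta> \<Longrightarrow> norm (ap X x) < \<epsilon>"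
proof -
  let ?M = "\<bar>M\<bar> + 1" and ?c = "\<lambda>U. ip x (U \<zeta>)"
  have "((\<lambda>U. act (?c U) (U \<zeta>)) has_sum x) G"
    using has_sum_synthesis[OF \<zeta>, of ?c] has_sum_imp_summable[OF PF_coefficients[OF \<zeta>, of x]]
      ap_cross[OF \<zeta> \<zeta>, of x] by (simp add: cross_self[OF \<zeta>])
  then have "\<forall>\<^sub>F F in finite_subsets_at_top G. dist (\<Sum>U\<in>F. act (?c U) (U \<zeta>)) x < \<epsilon> / (2 * ?M)"
    using \<epsilon> unfolding has_sum_def by (intro tendstoD) auto
  then obtain F where F: "finite F" "F \<subseteq> G" "dist (\<Sum>U\<in>F. act (?c U) (U \<zeta>)) x < \<epsilon> / (2 * ?M)"
    unfolding eventually_finite_subsets_at_top by blast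
  let ?v = "\<Sum>U\<in>F. act (?c U) (U \<zeta>)" and ?S = "(\<Sum>U\<in>F. norm (?c U)) + 1"
  have half: "c * (\<epsilon> / (2 * c)) = \<epsilon> / 2" if "c > 0" for c :: real
    using that by simp
  have S: "?S > 0" by (simp add: add_nonneg_pos sum_nonneg)
  show thesis
  proof (rule that[of "\<epsilon> / (2 * ?S)"])
    show "\<epsilon> / (2 * ?S) > 0" using \<epsilon> S by simp
    fix X X' assume X: "cadj X X'" "norm X \<le> M" "norm (ap X \<zeta>) < \<epsilon> / (2 * ?S)"
    have "ap X ?v = (\<Sum>U\<in>F. act (?c U) (U (ap X \<zeta>)))"
      using F(2) by (auto simp: ap.sum_right adj_act[OF cadj_adj[OF X(1)]] cadj_commute[OF X(1)] intro!: sum.cong)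
    then have "norm (ap X ?v) \<le> (\<Sum>U\<in>F. norm (act (?c U) (U (ap X \<zeta>))))"
      by (simp add: norm_sum)
    also have "\<dots> \<le> (\<Sum>U\<in>F. norm (?c U) * norm (ap X \<zeta>))"
      using F(2) by (intro sum_mono order_trans[OF norm_act]) (auto simp: norm_G)
    also have "\<dots> \<le> ?S * norm (ap X \<zeta>)"
      by (simp add: sum_distrib_right[symmetric] mult_right_mono)
    also have "\<dots> \<le> ?S * (\<epsilon> / (2 * ?S))" using X(3) S by (intro mult_left_mono) auto
    also have "\<dots> = \<epsilon> / 2" by (rule half[OF S])
    finally have 1: "norm (ap X ?v) \<le> \<epsilon> / 2" .
    have "norm (ap X (x - ?v)) \<le> ?M * norm (x - ?v)"
      using X(2) by (intro order_trans[OF norm_ap] mult_right_mono) auto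
    also have "\<dots> < ?M * (\<epsilon> / (2 * ?M))"
      using F(3) by (intro mult_strict_left_mono) (auto simp: dist_norm norm_minus_commute)
    also have "\<dots> = \<epsilon> / 2" by (rule half) simp
    finally have 2: "norm (ap X (x - ?v)) < \<epsilon> / 2" .
    have "norm (ap X x) \<le> norm (ap X ?v) + norm (ap X (x - ?v))"
      using norm_triangle_ineq[of "ap X ?v" "ap X (x - ?v)"] by (simp add: ap.diff_right)
    then show "norm (ap X x) < \<epsilon>" using 1 2 by linarith
  qed
qed

text \<open>Analysis embeds the module isometrically into the standard module, with synthesis as a
  left inverse. The composition of \<phi> with synthesis is represented by a family
  \<open>g\<close>, and the synthesis of \<open>g\<close> represents \<phi>.\<close>

lemma module_self_dual:
  assumes \<zeta>: "PF \<zeta>" and sd: "l2_self_dual TYPE('a) G"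
    and add: "\<And>x y. \<phi> (x + y) = \<phi> x + \<phi> y" and lin: "\<And>a x. \<phi> (act a x) = a * \<phi> x"
    and bnd: "\<And>x. norm (\<phi> x) \<le> C * norm x" and C: "0 \<le> C"
  obtains y where "\<And>x. \<phi> x = ip x y"
proof -
  let ?K = "l2_carrier G :: (('h \<Rightarrow> 'h) \<Rightarrow> 'a) set"
  let ?\<psi> = "\<lambda>f. \<phi> (synthesis \<zeta> f)"
  have K: "(\<lambda>U. f U * star (f U)) summable_on G" if "f \<in> ?K" for f
    using that by (simp add: l2_carrier_def)
  have syn: "((\<lambda>U. act (f U) (U \<zeta>)) has_sum synthesis \<zeta> f) G" if "f \<in> ?K" for f
    by (rule has_sum_synthesis[OF \<zeta> K[OF that]])
  have 1: "?\<psi> (\<lambda>i. f i + g i) = ?\<psi> f + ?\<psi> g" if "f \<in> ?K" "g \<in> ?K" for f g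
  proof -
    have "((\<lambda>U. act (f U + g U) (U \<zeta>)) has_sum synthesis \<zeta> f + synthesis \<zeta> g) G"
      using has_sum_add[OF syn syn, OF that] by (simp add: act_add_left)
    then have "synthesis \<zeta> (\<lambda>i. f i + g i) = synthesis \<zeta> f + synthesis \<zeta> g"
      unfolding synthesis_def by (rule infsumI)
    then show ?thesis by (simp add: add)
  qed
  have 2: "?\<psi> (\<lambda>i. a * f i) = a * ?\<psi> f" if "f \<in> ?K" for f a
  proof -
    have "((\<lambda>U. act a (act (f U) (U \<zeta>))) has_sum act a (synthesis \<zeta> f)) G"
      by (rule has_sum_bounded_linear[OF bounded_bilinear.bounded_linear_right[OF bounded_bilinear_act] syn[OF that]])
    then have "synthesis \<zeta> (\<lambda>i. a * f i) = act a (synthesis \<zeta> f)"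
      unfolding synthesis_def[of \<zeta> "\<lambda>i. a * f i"] act_act by (rule infsumI)
    then show ?thesis by (simp add: lin)
  qed
  have 3: "norm (?\<psi> f) \<le> C * sqrt (norm (l2_ip G f f))" if "f \<in> ?K" for f
  proof -
    have "norm (synthesis \<zeta> f) \<le> sqrt (norm (l2_ip G f f))"
      using norm_synthesis[OF \<zeta> K[OF that]] unfolding l2_ip_def by (rule real_le_rsqrt)
    then show ?thesis using bnd[of "synthesis \<zeta> f"] C by (meson mult_left_mono order_trans)
  qed
  from sd[unfolded l2_self_dual_def self_dual_def, rule_format, of ?\<psi>] 1 2 3
  obtain g where g: "g \<in> ?K" "\<And>f. f \<in> ?K \<Longrightarrow> ?\<psi> f = l2_ip G f g" by blast
  have "\<phi> x = ip x (synthesis \<zeta> g)" for x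
  proof -
    \<comment> \<open>The coefficients are cut off outside \<open>G\<close>, as membership in the
      carrier requires.\<close>
    let ?f = "\<lambda>U. if U \<in> G then ip x (U \<zeta>) else 0"
    have f: "((\<lambda>U. ?f U * star (?f U)) has_sum ip x x) G"
      using PF_coefficients[OF \<zeta>, of x] by (rule has_sum_cong[THEN iffD1, rotated]) simp
    then have fK: "?f \<in> ?K" by (auto simp: l2_carrier_def summable_on_def)
    have "synthesis \<zeta> ?f = synthesis \<zeta> (\<lambda>U. ip x (U \<zeta>))"
      unfolding synthesis_def by (rule infsum_cong) simp
    also have "\<dots> = x"
      using ap_cross[OF \<zeta> \<zeta>, of x] by (simp add: cross_self[OF \<zeta>])
    finally have "\<phi> x = l2_ip G ?f g" using g(2)[OF fK] by simp
    also have "\<dots> = ip x (synthesis \<zeta> g)"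
      unfolding l2_ip_def
    proof (rule infsumI)
      have "((\<lambda>U. star (g U * ip (U \<zeta>) x)) has_sum star (ip (synthesis \<zeta> g) x)) G"
        by (rule has_sum_bounded_linear[OF bounded_linear_star ip_synthesis[OF \<zeta> K[OF g(1)]]])
      then have "((\<lambda>U. ip x (U \<zeta>) * star (g U)) has_sum ip x (synthesis \<zeta> g)) G"
        by (simp add: star_mult star_ip)
      then show "((\<lambda>U. ?f U * star (g U)) has_sum ip x (synthesis \<zeta> g)) G"
        by (rule has_sum_cong[THEN iffD1, rotated]) simp
    qed
    finally show ?thesis .
  qed
  then show thesis by (rule that)
qed

end

section \<open>Spectral projections\<close>

context generalized_limit
begin

lemma L_decreasing_mult_all:
  assumes s: "decreasing s"
  shows "L (\<lambda>n. c * s n) = c * L s"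
proof -
  note B = decreasing_Bseq[OF s]
  have sa: "L (\<lambda>n. x * s n) = x * L s" if x: "star x = x" for x
  proof -
    let ?t = "norm x"
    have "cstar_positive (?t *\<^sub>R e - x)"
      using sa_cle_norm[OF x order_refl] by (simp add: cle_def)
    then have "L (\<lambda>n. (?t *\<^sub>R e - x) * s n) = (?t *\<^sub>R e - x) * L s"
      by (rule L_decreasing_mult[OF s])
    moreover have "L (\<lambda>n. (?t *\<^sub>R e) * s n) = (?t *\<^sub>R e) * L s"
      by (rule L_decreasing_mult[OF s]) (simp add: cstar_positive_scaleR cstar_positive_e)
    moreover have "x = ?t *\<^sub>R e - (?t *\<^sub>R e - x)" by simp
    then have "L (\<lambda>n. x * s n) = L (\<lambda>n. (?t *\<^sub>R e) * s n - (?t *\<^sub>R e - x) * s n)"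
      by (simp add: left_diff_distrib)
    ultimately show ?thesis
      using L_diff[OF Bseq_mult_left[OF B, of "?t *\<^sub>R e"] Bseq_mult_left[OF B, of "?t *\<^sub>R e - x"]]
      by (simp add: left_diff_distrib)
  qed
  define x where "x = re_part c"
  define y where "y = im_part c"
  have c: "c = x + \<i> *\<^sub>C y" by (simp add: x_def y_def re_im_parts)
  have sxy: "star x = x" "star y = y" by (simp_all add: x_def y_def)
  have "L (\<lambda>n. c * s n) = L (\<lambda>n. x * s n + \<i> *\<^sub>C (y * s n))"
    by (simp add: c distrib_right mult_scaleC_left)
  also have "\<dots> = L (\<lambda>n. x * s n) + \<i> *\<^sub>C L (\<lambda>n. y * s n)"
    using L_add[OF Bseq_mult_left[OF B, of x] Bseq_scaleC[OF Bseq_mult_left[OF B, of y], of \<i>]]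
    by (simp add: L_scaleC[OF Bseq_mult_left[OF B, of y]])
  also have "\<dots> = c * L s"
    by (simp add: sa[OF sxy(1)] sa[OF sxy(2)] c distrib_right mult_scaleC_left)
  finally show ?thesis .
qed

definition polarized :: "(nat \<Rightarrow> 'a) \<Rightarrow> bool" where
  "polarized s \<longleftrightarrow> (\<exists>p q u v. decreasing p \<and> decreasing q \<and> decreasing u \<and> decreasing v \<and>
    s = (\<lambda>n. (1/4) *\<^sub>R ((p n - q n) + \<i> *\<^sub>C (u n - v n))))"

lemma
  assumes "polarized s"
  shows polarized_mult: "L (\<lambda>n. c * s n) = c * L s"
    and polarized_Suc: "L (\<lambda>n. s (Suc n)) = L s"
    and polarized_star: "L (\<lambda>n. star (s n)) = star (L s)"
proof -
  obtain p q u v where d: "decreasing p" "decreasing q" "decreasing u" "decreasing v"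
    and s: "s = (\<lambda>n. (1/4) *\<^sub>R ((p n - q n) + \<i> *\<^sub>C (u n - v n)))"
    using assms by (auto simp: polarized_def)
  have comb: "L (\<lambda>n. (1/4) *\<^sub>R ((p' n - q' n) + c *\<^sub>C (u' n - v' n)))
      = (1/4) *\<^sub>R ((L p' - L q') + c *\<^sub>C (L u' - L v'))"
    if B: "Bseq p'" "Bseq q'" "Bseq u'" "Bseq v'" for p' q' u' v' c
  proof -
    have diff: "Bseq (\<lambda>n. a n - b n)" if "Bseq a" "Bseq b" for a b :: "nat \<Rightarrow> 'a"
      using Bseq_plus[OF that(1), of "\<lambda>n. - b n"] that(2) by (simp add: Bseq_minus_iff)
    note B1 = diff[OF B(1,2)] and B2 = Bseq_scaleC[OF diff[OF B(3,4)], of c]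
    show ?thesis
      by (simp add: L_scaleR[OF Bseq_plus[OF B1 B2]] L_add[OF B1 B2] L_diff[OF B(1,2)]
          L_scaleC[OF diff[OF B(3,4)]] L_diff[OF B(3,4)])
  qed
  note B = d[THEN decreasing_Bseq]
  have Ls: "L s = (1/4) *\<^sub>R ((L p - L q) + \<i> *\<^sub>C (L u - L v))"
    unfolding s by (rule comb[OF B])
  have "L (\<lambda>n. c * s n) = L (\<lambda>n. (1/4) *\<^sub>R ((c * p n - c * q n) + \<i> *\<^sub>C (c * u n - c * v n)))"
    by (simp add: s distrib_left right_diff_distrib mult_scaleC_right)
  also have "\<dots> = (1/4) *\<^sub>R ((c * L p - c * L q) + \<i> *\<^sub>C (c * L u - c * L v))"
    by (simp add: comb B Bseq_mult_left L_decreasing_mult_all d)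
  also have "\<dots> = c * L s"
    by (simp add: Ls distrib_left right_diff_distrib mult_scaleC_right)
  finally show "L (\<lambda>n. c * s n) = c * L s" .
  have BS: "Bseq (\<lambda>n. a (Suc n))" if "Bseq a" for a :: "nat \<Rightarrow> 'a"
    using that by (simp add: Bseq_Suc_iff)
  have "L (\<lambda>n. s (Suc n)) = (1/4) *\<^sub>R ((L (\<lambda>n. p (Suc n)) - L (\<lambda>n. q (Suc n)))
      + \<i> *\<^sub>C (L (\<lambda>n. u (Suc n)) - L (\<lambda>n. v (Suc n))))"
    unfolding s by (rule comb) (intro BS B)+
  then show "L (\<lambda>n. s (Suc n)) = L s"
    by (simp add: Ls L_decreasing_Suc d)
  have pos: "cstar_positive (L a)" if "decreasing a" for a
    using that by (intro L_positive decreasing_Bseq always_eventually) (auto simp: decreasing_def)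
  have sa: "star (a n) = a n" "star (L a) = L a" if "decreasing a" for a n
    using that pos[OF that] by (auto simp: decreasing_def intro: cstar_positive_star)
  have "L (\<lambda>n. star (s n)) = L (\<lambda>n. (1/4) *\<^sub>R ((p n - q n) + (- \<i>) *\<^sub>C (u n - v n)))"
    by (simp add: s star_scaleR star_add star_diff star_scaleC sa d)
  also have "\<dots> = (1/4) *\<^sub>R ((L p - L q) + (- \<i>) *\<^sub>C (L u - L v))"
    by (rule comb[OF B])
  also have "\<dots> = star (L s)"
    by (simp add: Ls star_scaleR star_add star_diff star_scaleC sa d)
  finally show "L (\<lambda>n. star (s n)) = star (L s)" .
qed

end

locale dual_group_frames =
  group_frames act ip e G + generalized_limit e L
  for act :: "'a::{cstar_algebra, comm_ring} \<Rightarrow> 'h::complex_banach \<Rightarrow> 'h"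
    and ip :: "'h \<Rightarrow> 'h \<Rightarrow> 'a" and e :: 'a and G :: "('h \<Rightarrow> 'h) set" and L :: "(nat \<Rightarrow> 'a) \<Rightarrow> 'a" +
  fixes \<xi> :: 'h
  assumes l2_self_dual: "l2_self_dual TYPE('a) G" and PF_\<xi>: "PF \<xi>"
begin

text \<open>The projection is the decreasing limit of the powers of \<open>1 - T\<^sup>2\<close>, where \<open>T\<close> is scaled to norm
  at most 1. Self-duality turns the limit form into an operator.\<close>

lemma kernel_projection:
  assumes T: "cadj T T"
  obtains E where "cadj E E" "E * E = E" "T * E = 0" "\<And>X. T * X = 0 \<Longrightarrow> E * X = X"
    "\<And>Z Z'. cadj Z Z' \<Longrightarrow> T * Z = Z * T \<Longrightarrow> T * Z' = Z' * T \<Longrightarrow> E * Z = Z * E"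
proof -
  define r where "r = 1 / (norm T + 1)"
  define S where "S = r *\<^sub>R T"
  define Y where "Y = 1 - S * S"
  have r: "r > 0" by (simp add: r_def add_nonneg_pos)
  have S: "cadj S S" unfolding S_def by (intro cadj_intros T)
  have S1: "norm S \<le> 1"
    by (simp add: S_def r_def add_nonneg_pos divide_simps)
  have Y: "cadj Y Y" unfolding Y_def by (intro cadj_intros S)
  have SS: "norm (S * S) \<le> 1"
    using norm_mult_ineq[of S S] S1 by (meson mult_le_one norm_ge_zero order_trans)
  have SSa: "adj (S * S) (S * S)" by (rule cadj_adj[OF cadj_intros(6)[OF S S]])
  have Ypos: "cstar_positive (ip (ap Y x) x)" for x
    using contraction_positive[OF SSa SS, of x] by (simp add: Y_def cle_def ip_diff_left)
  have Ynorm: "norm Y \<le> 1"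
  proof (rule norm_le_of_form_le[OF cadj_adj[OF Y] Ypos])
    fix x
    have "ip (ap Y x) x = ip x x - ip (ap S x) (ap S x)"
      by (simp add: Y_def ip_diff_left cadj_ip[OF S])
    then show "ip (ap Y x) x \<preceq> 1 *\<^sub>R ip x x" by (simp add: cle_def ip_positive)
  qed simp
  have pw: "cadj (Y ^ n) (Y ^ n)" for n by (rule cadj_power[OF Y])
  \<comment> \<open>The induction carries two consecutive powers: the form of
    \<open>Y ^ (n + 2)\<close> at \<open>x\<close> is the form of \<open>Y ^ n\<close> at
    \<open>ap Y x\<close>.\<close>
  have "(\<forall>x. cstar_positive (ip (ap (Y ^ n) x) x)) \<and> (\<forall>x. cstar_positive (ip (ap (Y ^ Suc n) x) x))" for n
  proof (induction n)
    case (Suc n)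
    have "ip (ap (Y ^ Suc (Suc n)) x) x = ip (ap (Y ^ n) (ap Y x)) (ap Y x)" for x
    proof -
      have "Y ^ Suc (Suc n) = Y * Y ^ n * Y" by (simp add: power_commutes mult.assoc)
      then show ?thesis by (simp add: cadj_ip[OF Y])
    qed
    then show ?case using Suc by simp
  qed (simp add: Ypos ip_positive)
  then have pos: "cstar_positive (ip (ap (Y ^ n) x) x)" for n x by blast
  have dec: "decreasing (\<lambda>n. ip (ap (Y ^ n) x) x)" for x
    unfolding decreasing_def
  proof (intro conjI allI pos)
    fix n
    have "S * Y = Y * S" by (simp add: Y_def algebra_simps mult.assoc)
    then have "Y ^ n * S = S * Y ^ n" by (rule power_commuting_commutes[OF sym])
    \<comment> \<open>As \<open>1 - Y = S * S\<close> and \<open>S\<close> commutes with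
      \<open>Y\<close>, the difference of consecutive powers is conjugated into a positive
      form.\<close>
    then have "Y ^ n - Y ^ Suc n = S * Y ^ n * S"
      by (simp add: Y_def algebra_simps power_commutes[symmetric] flip: mult.assoc)
    then have "ip (ap (Y ^ n - Y ^ Suc n) x) x = ip (ap (Y ^ n) (ap S x)) (ap S x)"
      by (simp only: ap_simps cadj_ip[OF S])
    then show "ip (ap (Y ^ Suc n) x) x \<preceq> ip (ap (Y ^ n) x) x"
      using pos[of n "ap S x"] by (simp add: cle_def ip_diff_left)
  qed
  have pol: "polarized (\<lambda>n. ip (ap (Y ^ n) x) y)" for x y
  proof -
    let ?s = "\<lambda>c n. ip (ap (Y ^ n) (x + c *\<^sub>C y)) (x + c *\<^sub>C y)"
    have "ip (ap (Y ^ n) x) y = (1/4) *\<^sub>R ((ip (ap (Y ^ n) (x + y)) (x + y) - ?s (-1) n)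
        + \<i> *\<^sub>C (?s \<i> n - ?s (- \<i>) n))" for n
      by (rule polarization)
        (simp_all add: ap.add_right ip_simps adj_scaleC[OF cadj_adj[OF pw]])
    then show ?thesis
      unfolding polarized_def using dec by blast
  qed
  have pwn: "norm (Y ^ n) \<le> 1" for n
    using norm_power_le[OF norm_one_endo Ynorm, of n] by simp
  have bnd: "norm (ip (ap (Y ^ n) x) y) \<le> norm x * norm y" for n x y
  proof -
    have "norm (ap (Y ^ n) x) \<le> norm x"
      using norm_ap[of "Y ^ n" x] mult_right_mono[OF pwn[of n], of "norm x"] by simp
    then show ?thesis
      using norm_ip[of "ap (Y ^ n) x" y] mult_right_mono[of _ "norm x" "norm y"] by (meson norm_ge_zero order_trans)
  qed
  note Bs = BseqI[OF bnd]
  define B where "B x y = L (\<lambda>n. ip (ap (Y ^ n) x) y)" for x y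
  have "\<exists>z. \<forall>x. B x y = ip x z" for y
  proof -
    have 1: "B (x + x') y = B x y + B x' y" for x x'
      unfolding B_def ap.add_right ip_add_left by (rule L_add[OF Bs Bs])
    have 2: "B (act a x) y = a * B x y" for a x
      unfolding B_def adj_act[OF cadj_adj[OF pw]] ip_act_left by (rule polarized_mult[OF pol])
    have 3: "norm (B x y) \<le> norm y * norm x" for x
      unfolding B_def mult.commute[of "norm y"] by (rule L_norm[OF bnd])
    obtain z where "\<And>x. B x y = ip x z"
      by (rule module_self_dual[OF PF_\<xi> l2_self_dual, of "\<lambda>x. B x y" "norm y"]) (simp_all add: 1 2 3)
    then show ?thesis by blast
  qed
  then obtain E0 where E0: "\<And>x y. B x y = ip x (E0 y)" by metis
  have Bstar: "B x y = star (B y x)" for x y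
    unfolding B_def polarized_star[OF pol, symmetric] by (simp add: star_ip cadj_ip[OF pw])
  have E0a: "ip (E0 x) y = ip x (E0 y)" for x y
    using Bstar[of x y] by (simp add: E0 star_ip)
  have "bounded_linear E0"
  proof (rule bounded_linear_intro[where K = 1])
    fix x y and c :: real
    show "E0 (x + y) = E0 x + E0 y" by (rule ip_eqI) (simp add: E0a ip_add_left)
    show "E0 (c *\<^sub>R x) = c *\<^sub>R E0 x" by (rule ip_eqI) (simp add: E0a ip_scaleR_left)
    have "norm (B (E0 x) x) \<le> norm (E0 x) * norm x"
      unfolding B_def by (rule L_norm[OF bnd])
    then have "norm (E0 x) * norm (E0 x) \<le> norm (E0 x) * norm x"
      by (simp add: E0 norm_ip_self power2_eq_square)
    then show "norm (E0 x) \<le> norm x * 1" by (cases "E0 x = 0") simp_all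
  qed
  define E where "E = endo_of E0"
  have ap_E: "ap E x = E0 x" for x by (simp add: E_def ap_endo_of \<open>bounded_linear E0\<close>)
  have BE: "B x y = ip x (ap E y)" for x y by (simp add: E0 ap_E)
  have E: "cadj E E"
    unfolding cadj_def
  proof (intro conjI ballI allI)
    show "adj E E" by (simp add: adj_def ap_E E0a)
    fix U x assume U: "U \<in> G"
    show "ap E (U x) = U (ap E x)"
    proof (rule ip_eqI_right)
      fix z
      have "B z (U x) = B (inv U z) x"
        unfolding B_def ip_G'[OF U] cadj_commute[OF pw inv_in_G[OF U]] ..
      then show "ip z (ap E (U x)) = ip z (U (ap E x))" by (simp add: BE ip_G'[OF U])
    qed
  qed
  \<comment> \<open>Dropping the first term of a decreasing sequence does not change its infimum, so
    the limit form absorbs one more factor \<open>Y\<close>.\<close>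
  have YE: "Y * E = E"
  proof (rule endo_eqI, rule ip_eqI_right)
    fix y x
    have "B (ap Y x) y = B x y"
      unfolding B_def using polarized_Suc[OF pol, of x y] by (simp add: power_commutes[symmetric])
    then show "ip x (ap (Y * E) y) = ip x (ap E y)" by (simp add: BE cadj_ip[OF Y])
  qed
  then have SSE: "S * S * E = 0" by (simp add: Y_def algebra_simps)
  have SE: "S * E = 0"
  proof (rule endo_eqI)
    fix x
    have "ip (ap (S * E) x) (ap (S * E) x) = ip (ap E x) (ap (S * S * E) x)"
      by (simp add: cadj_ip[OF S])
    then show "ap (S * E) x = ap 0 x" by (simp add: SSE ip_self_eq_0)
  qed
  have TE: "T * E = 0"
    using SE r by (simp add: S_def)
  have EX: "E * X = X" if "T * X = 0" for X
  proof (rule endo_eqI, rule ip_eqI)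
    fix x z
    have "Y * X = X" using that by (simp add: Y_def S_def left_diff_distrib mult.assoc)
    then have "Y ^ n * X = X" for n
      by (induction n) (simp_all add: mult.assoc)
    then have "ap (Y ^ n) (ap X x) = ap X x" for n by (metis ap_simps(7))
    then have "B (ap X x) z = ip (ap X x) z" by (simp add: B_def L_const)
    then show "ip (ap (E * X) x) z = ip (ap X x) z" by (simp add: BE cadj_ip[OF E])
  qed
  \<comment> \<open>\<open>Z * E\<close> again maps into the kernel of \<open>T\<close>, where
    \<open>E\<close> acts as the identity. The same for the adjoint \<open>Z'\<close> turns this
    one-sided relation into commutation.\<close>
  have half: "E * Z * E = Z * E" if "T * Z = Z * T" for Z
  proof -
    have "T * (Z * E) = Z * (T * E)" by (simp add: that flip: mult.assoc)
    then show ?thesis using EX[of "Z * E"] by (simp add: TE mult.assoc)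
  qed
  show thesis
  proof (rule that[OF E EX[OF TE] TE EX])
    fix Z Z' assume Z: "cadj Z Z'" "T * Z = Z * T" "T * Z' = Z' * T"
    have "cadj (E * Z * E) (E * Z' * E)" "cadj (E * Z) (Z' * E)"
      using cadj_intros(6)[OF cadj_intros(6)[OF E Z(1)] E] cadj_intros(6)[OF E Z(1)] by (simp_all add: mult.assoc)
    then have "E * Z * E = E * Z"
      by (metis half[OF Z(3)] adj_sym adj_unique cadj_adj)
    then show "E * Z = Z * E" by (simp add: half[OF Z(2)])
  qed
qed

text \<open>\<open>E\<close> plays the role of the spectral projection of \<open>C\<close> for the
  values up to \<open>-l\<close>. Only form bounds on its range and on the complement are recorded,
  so the value \<open>-l\<close> itself may fall on either side.\<close>

definition cut :: "'h endo \<Rightarrow> real \<Rightarrow> 'h endo \<Rightarrow> bool" where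
  "cut C l E \<longleftrightarrow> cadj E E \<and> E * E = E \<and> E * C = C * E \<and>
    (\<forall>x. ip (ap C (ap E x)) (ap E x) \<preceq> - (l *\<^sub>R ip (ap E x) (ap E x))) \<and>
    (\<forall>x. - (l *\<^sub>R ip (ap (1 - E) x) (ap (1 - E) x)) \<preceq> ip (ap C (ap (1 - E) x)) (ap (1 - E) x))"

text \<open>With \<open>D = - l - C\<close> and \<open>R\<close> its absolute value, the root of
  \<open>D * D\<close>, the projection sought is the one onto the kernel of \<open>R - D\<close>,
  where \<open>D\<close> is positive.\<close>

lemma spectral_projection:
  assumes C: "cadj C C" and C1: "norm C \<le> 1" and l: "0 \<le> l" "l \<le> 1"
  shows "\<exists>E. cut C l E"
proof -
  define D where "D = - (l *\<^sub>R 1) - C"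
  have D: "cadj D D" unfolding D_def by (intro cadj_intros C)
  have "norm D \<le> norm (l *\<^sub>R (1::'h endo)) + norm C"
    unfolding D_def using norm_triangle_ineq4[of "- (l *\<^sub>R 1)" C] by simp
  also have "norm (l *\<^sub>R (1::'h endo)) \<le> 1"
    using norm_one_endo[where 'a = 'h] l by (simp add: mult_le_one)
  \<comment> \<open>\<open>norm D\<close> is at most 2; the factor \<open>1/2\<close> brings the
    square into the range of the root series and is undone by \<open>R = 2 Q\<close>.\<close>
  finally have D2: "norm ((1/2) *\<^sub>R D) \<le> 1" using C1 by simp
  define Z where "Z = ((1/2) *\<^sub>R D) * ((1/2) *\<^sub>R D)"
  have hD: "cadj ((1/2) *\<^sub>R D) ((1/2) *\<^sub>R D)" by (intro cadj_intros D)
  have Z: "cadj Z Z" unfolding Z_def by (intro cadj_intros D)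
  have Zip: "ip (ap Z x) x = ip (ap ((1/2) *\<^sub>R D) x) (ap ((1/2) *\<^sub>R D) x)" for x
    unfolding Z_def ap_simps(7) cadj_ip[OF hD] ..
  have "adj (1 - Z) (1 - Z)" by (intro cadj_adj cadj_intros Z)
  then have "norm (1 - Z) \<le> 1"
  proof (rule norm_le_of_form_le)
    fix x
    show "cstar_positive (ip (ap (1 - Z) x) x)"
      using contraction_ip_le[OF cadj_adj[OF hD] D2, of x] by (simp only: ap_simps(2,4) ip_diff_left Zip cle_def)
    show "ip (ap (1 - Z) x) x \<preceq> 1 *\<^sub>R ip x x"
      using ip_positive[of "ap ((1/2) *\<^sub>R D) x"] by (simp only: ap_simps(2,4) ip_diff_left Zip cle_def) simp
  qed simp
  then obtain Q where Q: "adj Q Q" "Q * Q = Z" "norm (1 - Q) \<le> 1"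
    and Qcomm: "\<And>f x. linear f \<Longrightarrow> continuous_on UNIV f \<Longrightarrow> (\<And>y. ap Z (f y) = f (ap Z y)) \<Longrightarrow> ap Q (f x) = f (ap Q x)"
    using self_adjoint_sqrt[OF cadj_adj[OF Z]] by metis
  have Qc: "cadj Q Q"
    unfolding cadj_def by (auto simp: Q(1) intro!: Qcomm G_linear G_continuous cadj_commute[OF Z])
  have QX: "Q * X = X * Q" if "Z * X = X * Z" for X
  proof (rule endo_eqI)
    fix x
    have "ap Z (ap X y) = ap X (ap Z y)" for y using that by (metis ap_simps(7))
    then show "ap (Q * X) x = ap (X * Q) x"
      using Qcomm[of "ap X" x] by (simp add: linear_continuous_on ap.bounded_linear_right bounded_linear.linear)
  qed
  define R where "R = 2 *\<^sub>R Q"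
  have R: "cadj R R" unfolding R_def by (intro cadj_intros Qc)
  have RR: "R * R = D * D" by (simp add: R_def Q(2) Z_def)
  have QD: "Q * D = D * Q" by (rule QX) (simp add: Z_def mult.assoc)
  have DC: "D * C = C * D" by (simp add: D_def algebra_simps)
  then have "Z * C = C * Z" by (simp add: Z_def mult.assoc) (simp add: DC flip: mult.assoc)
  then have QC: "Q * C = C * Q" by (rule QX)
  have Rpos: "cstar_positive (ip (ap R x) x)" for x
  proof -
    have "adj (1 - Q) (1 - Q)" by (intro adj_intros Q)
    from contraction_positive[OF this Q(3), of x] have "cstar_positive (2 *\<^sub>R ip (ap Q x) x)"
      by (intro cstar_positive_scaleR) (simp_all add: cle_def ip_diff_left)
    then show ?thesis by (simp add: R_def ip_scaleR_left)
  qed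
  have T: "cadj (R - D) (R - D)" by (intro cadj_intros R D)
  then obtain E where E: "cadj E E" "E * E = E" "(R - D) * E = 0"
    "\<And>X. (R - D) * X = 0 \<Longrightarrow> E * X = X"
    "\<And>Z Z'. cadj Z Z' \<Longrightarrow> (R - D) * Z = Z * (R - D) \<Longrightarrow> (R - D) * Z' = Z' * (R - D) \<Longrightarrow> E * Z = Z * E"
    by (rule kernel_projection) blast
  have CD: "C = - (l *\<^sub>R 1) - D" by (simp add: D_def)
  have Cip: "ip (ap C x) x = - (l *\<^sub>R ip x x) - ip (ap D x) x" for x
    by (subst CD) (simp add: ip_simps)
  show ?thesis
    unfolding cut_def
  proof (intro exI[of _ E] conjI E(1,2) allI)
    have "(R - D) * C = C * (R - D)" by (simp add: R_def QC DC left_diff_distrib right_diff_distrib)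
    then show "E * C = C * E" using E(5)[OF C] by blast
    fix x
    have "ap R (ap E x) = ap D (ap E x)"
      using arg_cong[OF E(3), of "\<lambda>X. ap X x"] by simp
    then show "ip (ap C (ap E x)) (ap E x) \<preceq> - (l *\<^sub>R ip (ap E x) (ap E x))"
      using Rpos[of "ap E x"] by (simp add: Cip cle_def)
    let ?y = "ap (1 - E) x"
    \<comment> \<open>So \<open>R + D\<close> maps into the range of \<open>E\<close>. On the
      complement its form therefore vanishes, which means that the form of \<open>D\<close> is that
      of \<open>- R\<close>.\<close>
    have "(R - D) * (R + D) = 0"
      using RR by (simp add: algebra_simps R_def QD)
    then have "E * (R + D) = R + D" by (rule E(4))
    then have "ap E (ap (R + D) ?y) = ap (R + D) ?y" by (metis ap_simps(7))
    then have "ip (ap (R + D) ?y) ?y = ip (ap E (ap (R + D) ?y)) ?y" by simp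
    also have "\<dots> = ip (ap (R + D) ?y) (ap (E * (1 - E)) x)"
      by (simp only: cadj_ip[OF E(1)] ap_simps(7))
    also have "E * (1 - E) = 0" by (simp add: right_diff_distrib E(2))
    finally have "ip (ap D ?y) ?y = - ip (ap R ?y) ?y"
      by (simp only: ap_simps(3) ip_add_left ap_simps(1) ip_zero) (simp add: eq_neg_iff_add_eq_0 add.commute)
    then show "- (l *\<^sub>R ip ?y ?y) \<preceq> ip (ap C ?y) ?y"
      using Rpos[of ?y] unfolding Cip by (simp only: cle_def) simp
  qed
qed

end

section \<open>Moving one frame vector towards another\<close>

context unital_cstar
begin

text \<open>Applied to an infinite index set, self-duality forces bounded sums of positive elements to converge
  in norm: otherwise \<open>f \<mapsto> \<Sum>k. f k * b k\<close> with \<open>a k = star (b k) * b k\<close> would not be represented.\<close>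

lemma self_dual_imp_summable:
  fixes a :: "nat \<Rightarrow> 'a"
  assumes sd: "l2_self_dual TYPE('a) I" and h: "bij_betw h I (UNIV :: nat set)"
    and pos: "\<And>k. cstar_positive (a k)" and bnd: "\<And>n. norm (\<Sum>k<n. a k) \<le> c"
  shows "summable a"
proof -
  let ?K = "l2_carrier I :: ('b \<Rightarrow> 'a) set"
  obtain b where b: "\<And>k. a k = star (b k) * b k"
    using pos unfolding cstar_positive_def by metis
  define d where "d i = b (h i)" for i
  have c0: "0 \<le> c" using bnd[of 0] by simp
  have dF: "norm (\<Sum>i\<in>F. star (d i) * star (star (d i))) \<le> c" if F: "finite F" "F \<subseteq> I" for F
  proof -
    have inj: "inj_on h F" using h F(2) by (meson bij_betw_imp_inj_on inj_on_subset)
    obtain n where n: "h ` F \<subseteq> {..<n}" using F(1) finite_nat_bounded by (metis finite_imageI)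
    have "(\<Sum>i\<in>F. star (d i) * star (star (d i))) = (\<Sum>k\<in>h ` F. a k)"
      by (simp add: sum.reindex[OF inj] b d_def)
    also have "norm \<dots> \<le> norm (\<Sum>k<n. a k)"
    proof (rule norm_mono)
      show "cstar_positive (\<Sum>k\<in>h ` F. a k)" by (intro cstar_positive_sum pos)
      have "(\<Sum>k<n. a k) - (\<Sum>k\<in>h ` F. a k) = (\<Sum>k\<in>{..<n} - h ` F. a k)"
        using n by (simp add: sum_diff)
      then show "(\<Sum>k\<in>h ` F. a k) \<preceq> (\<Sum>k<n. a k)"
        by (simp add: cle_def cstar_positive_sum pos)
    qed
    also have "\<dots> \<le> c" by (rule bnd)
    finally show ?thesis .
  qed
  have fd: "(norm (\<Sum>i\<in>F. f i * d i))\<^sup>2 \<le> norm (\<Sum>i\<in>F. f i * star (f i)) * c" if F: "finite F" "F \<subseteq> I" for F f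
    using order_trans[OF _ mult_left_mono[OF dF[OF F] norm_ge_zero[of "\<Sum>i\<in>F. f i * star (f i)"]]]
      sum_cauchy_schwarz[of f "\<lambda>i. star (d i)" F]
    by simp
  let ?\<phi> = "\<lambda>f. \<Sum>\<^sub>\<infinity>i\<in>I. f i * d i"
  have fs: "(\<lambda>i. f i * star (f i)) summable_on I" if "f \<in> ?K" for f
    using that by (simp add: l2_carrier_def)
  have sm: "(\<lambda>i. f i * d i) summable_on I" if "f \<in> ?K" for f
    by (rule summable_on_dominated[OF fs[OF that] c0 fd])
  have 1: "?\<phi> (\<lambda>i. f i + g i) = ?\<phi> f + ?\<phi> g" if "f \<in> ?K" "g \<in> ?K" for f g
    using infsum_add[OF sm[OF that(1)] sm[OF that(2)]] by (simp add: distrib_right)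
  have 2: "?\<phi> (\<lambda>i. x * f i) = x * ?\<phi> f" if "f \<in> ?K" for f x
    using has_sum_bounded_linear[OF bounded_linear_mult_right[of x] has_sum_infsum[OF sm[OF that]]]
    by (simp add: mult.assoc infsumI)
  have 3: "norm (?\<phi> f) \<le> sqrt c * sqrt (norm (l2_ip I f f))" if f: "f \<in> ?K" for f
  proof -
    have "(norm (?\<phi> f))\<^sup>2 \<le> norm (l2_ip I f f) * c"
      unfolding l2_ip_def by (rule norm_infsum_dominated[OF fs[OF f] c0 fd])
    then show ?thesis
      using real_le_rsqrt by (fastforce simp: real_sqrt_mult mult.commute)
  qed
  from sd[unfolded l2_self_dual_def self_dual_def, rule_format, of ?\<phi>] 1 2 3
  obtain y where y: "y \<in> ?K" "\<And>f. f \<in> ?K \<Longrightarrow> ?\<phi> f = l2_ip I f y" by blast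
  \<comment> \<open>The representing family is forced to be the adjoint of \<open>d\<close>, and its
    membership in the standard module is the norm convergence to be proved.\<close>
  have "star (y i) = d i" if i: "i \<in> I" for i
  proof -
    let ?f = "\<lambda>j. if j = i then e else 0"
    have hs: "((\<lambda>j. ?f j * g j) has_sum g i) I" for g :: "'b \<Rightarrow> 'a"
      using i by (intro has_sum_finite_neutralI[of "{i}"]) auto
    have "?f \<in> ?K"
      using hs[of "\<lambda>j. star (?f j)"] i by (auto simp: l2_carrier_def summable_on_def)
    from y(2)[OF this] show ?thesis
      unfolding l2_ip_def infsumI[OF hs] by simp
  qed
  then have yd: "y i * star (y i) = a (h i)" if "i \<in> I" for i
    using that by (metis b d_def mult.commute star_star)
  have "(\<lambda>i. y i * star (y i)) summable_on I" using y(1) by (simp add: l2_carrier_def)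
  then have "(\<lambda>i. a (h i)) summable_on I"
    using summable_on_cong[of I "\<lambda>i. y i * star (y i)" "\<lambda>i. a (h i)"] yd by simp
  then obtain S where "((\<lambda>i. a (h i)) has_sum S) I" by (auto simp: summable_on_def)
  then have "(a has_sum S) UNIV" using has_sum_reindex_bij_betw[OF h, of a S] by simp
  then show ?thesis using has_sum_imp_sums sums_summable by blast
qed

end

context generalized_limit
begin

text \<open>The spectrum of \<open>b\<close> omits \<open>]0, 1[\<close>, and \<open>p\<close> is the spectral projection for \<open>{0}\<close>.\<close>

lemma annihilating_positive:
  assumes b: "cstar_positive b" and bb: "b \<preceq> b * b"
  obtains p where "cstar_positive p" "p * b = 0" "e - b \<preceq> p"
proof -
  define M where "M = norm b + 1"
  have M: "M > 0" "norm b \<le> M" by (simp_all add: M_def add_nonneg_pos)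
  \<comment> \<open>\<open>y\<close> equals \<open>e\<close> where \<open>b\<close> vanishes and is
    smaller elsewhere, so its powers decrease to the desired \<open>p\<close>.\<close>
  define y where "y = e - (1 / M) *\<^sub>R b"
  have "cstar_positive ((1 / M) *\<^sub>R (M *\<^sub>R e - b))"
    using sa_cle_norm[OF cstar_positive_star[OF b] M(2)] M(1)
    by (intro cstar_positive_scaleR) (simp_all add: cle_def)
  then have y: "cstar_positive y" using M by (simp add: y_def scaleR_diff_right)
  have ye: "y \<preceq> e" using M b by (simp add: y_def cle_def cstar_positive_scaleR)
  define w where "w = rec_nat e (\<lambda>_ v. y * v)"
  have w0: "w 0 = e" and wS: "\<And>n. w (Suc n) = y * w n" by (simp_all add: w_def)
  have wpos: "cstar_positive (w n)" for n
    by (induction n) (simp_all add: w0 wS cstar_positive_e cstar_positive_mult y)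
  have dec: "decreasing w"
    unfolding decreasing_def
  proof (intro conjI allI wpos)
    show "w (Suc n) \<preceq> w n" for n
      using cle_mult_left[OF wpos ye, of n] by (simp add: wS mult.commute)
  qed
  have "y * L w = L w"
    using L_decreasing_mult[OF dec y] L_decreasing_Suc[OF dec] by (simp add: wS)
  then have "(1 / M) *\<^sub>R (b * L w) = 0" by (simp add: y_def left_diff_distrib)
  then have 1: "L w * b = 0" using M by (simp add: mult.commute)
  \<comment> \<open>The spectral gap enters through \<open>b \<preceq> b * b\<close>: it makes
    \<open>e - b \<preceq> y * (e - b)\<close>, so the bound survives each further factor
    \<open>y\<close>.\<close>
  have "e - b \<preceq> w n" for n
  proof (induction n)
    case 0
    show ?case using b by (simp add: w0 cle_def)
  next
    case (Suc n)
    have "cstar_positive ((1 / M) *\<^sub>R (b * b - b))"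
      using bb M by (simp add: cle_def cstar_positive_scaleR)
    moreover have "y * (e - b) - (e - b) = (1 / M) *\<^sub>R (b * b - b)"
      by (simp add: y_def algebra_simps scaleR_diff_right)
    ultimately have "e - b \<preceq> y * (e - b)" by (simp add: cle_def)
    also have "\<dots> \<preceq> y * w n" by (rule cle_mult_left[OF y Suc])
    finally show ?case by (simp add: wS)
  qed
  then have "e - b \<preceq> L w" by (rule L_decreasing_ge[OF dec])
  moreover have "cstar_positive (L w)"
    by (rule L_positive[OF decreasing_Bseq[OF dec]]) (simp add: wpos)
  ultimately show thesis using that 1 by blast
qed

end

context comm_hilbert_module
begin

text \<open>The real and the imaginary part of \<open>ip x y\<close> both lie between
  \<open>- ip x x\<close> and \<open>ip x x\<close>; estimating their squares separately costs the
  factor 2.\<close>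

lemma ip_mult_star_le:
  assumes "ip y y = ip x x"
  shows "ip x y * star (ip x y) \<preceq> 2 *\<^sub>R (ip x x * ip x x)"
proof -
  let ?\<tau> = "ip x x" and ?\<beta> = "ip x y"
  have sq: "X * X \<preceq> ?\<tau> * ?\<tau>" if "2 *\<^sub>R X \<preceq> 2 *\<^sub>R ?\<tau>" "- (2 *\<^sub>R X) \<preceq> 2 *\<^sub>R ?\<tau>" for X
  proof -
    have "X \<preceq> ?\<tau>" "- X \<preceq> ?\<tau>"
      using cle_scaleR[OF _ that(1), of "1/2"] cle_scaleR[OF _ that(2), of "1/2"] by simp_all
    then have "cstar_positive ((?\<tau> - X) * (?\<tau> + X))"
      by (intro cstar_positive_mult) (simp_all add: cle_def)
    then show ?thesis by (simp add: cle_def algebra_simps)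
  qed
  have tw: "z *\<^sub>C ?\<beta> + cnj z *\<^sub>C star ?\<beta> \<preceq> 2 *\<^sub>R ?\<tau>" if "cmod z \<le> 1" for z
    using twice_re_ip_le[OF that, of x y] assms by (simp add: star_scaleC scaleR_2)
  define X where "X = re_part ?\<beta>"
  define Y where "Y = im_part ?\<beta>"
  have "2 *\<^sub>R X \<preceq> 2 *\<^sub>R ?\<tau>" "- (2 *\<^sub>R X) \<preceq> 2 *\<^sub>R ?\<tau>"
    using tw[of 1] tw[of "-1"] by (simp_all add: X_def re_part_def scaleC.minus_left)
  then have 1: "X * X \<preceq> ?\<tau> * ?\<tau>" by (rule sq)
  have "2 *\<^sub>R Y \<preceq> 2 *\<^sub>R ?\<tau>" "- (2 *\<^sub>R Y) \<preceq> 2 *\<^sub>R ?\<tau>"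
    using tw[of "- \<i>"] tw[of "\<i>"] by (simp_all add: Y_def im_part_def scaleC.minus_left scaleC.diff_right)
  then have 2: "Y * Y \<preceq> ?\<tau> * ?\<tau>" by (rule sq)
  have "?\<beta> * star ?\<beta> = (X + \<i> *\<^sub>C Y) * (X - \<i> *\<^sub>C Y)"
    by (simp only: X_def Y_def re_im_parts)
  also have "\<dots> = X * X + Y * Y"
    by (simp add: algebra_simps mult_scaleC_left mult_scaleC_right)
  finally show ?thesis using cle_add[OF 1 2] by (simp add: scaleR_2)
qed

end

context dual_group_frames
begin

section \<open>Separating vectors and reflections in the commutant\<close>

definition mulop :: "'a \<Rightarrow> 'h endo" where
  "mulop a = endo_of (act a)"

lemma ap_mulop [simp]: "ap (mulop a) x = act a x"
  by (simp add: mulop_def ap_endo_of bounded_bilinear.bounded_linear_right[OF bounded_bilinear_act])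

lemma cadj_mulop: "cadj (mulop a) (mulop (star a))"
  by (simp add: cadj_def adj_def ip_simps G_act)

lemma commutant_eq_0:
  assumes "cadj X X'" "ap X \<xi> = 0"
  shows "X = 0"
proof (rule endo_eqI)
  fix x
  have "norm (ap X x) < \<epsilon>" if \<epsilon>: "\<epsilon> > 0" for \<epsilon>
  proof -
    obtain \<delta> where "\<delta> > 0"
      "\<And>Y Y'. cadj Y Y' \<Longrightarrow> norm Y \<le> norm X \<Longrightarrow> norm (ap Y \<xi>) < \<delta> \<Longrightarrow> norm (ap Y x) < \<epsilon>"
      using commutant_small[OF PF_\<xi> \<epsilon>] by metis
    then show ?thesis using assms by simp
  qed
  then show "ap X x = ap 0 x"
    by (metis ap_simps(1) less_irrefl zero_less_norm_iff)
qed

lemma unitary_norm: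
  assumes "cadj X X'" "X' * X = 1"
  shows "norm X \<le> 1"
proof (rule norm_endo_le)
  fix x
  have "ip (ap X x) (ap X x) = ip x x"
    using assms by (metis ap_simps(2,7) cadj_ip)
  then show "norm (ap X x) \<le> 1 * norm x" by (simp add: norm_eq_ip)
qed simp

lemma reflection:
  assumes E: "cadj E E" "E * E = E"
  shows "cadj (1 - 2 *\<^sub>R E) (1 - 2 *\<^sub>R E)" "(1 - 2 *\<^sub>R E) * (1 - 2 *\<^sub>R E) = 1"
  by (intro cadj_intros E) (simp add: algebra_simps E scaleR_2)

text \<open>The thresholds increase strictly so that a part of the module on which one step changes nothing is
  left alone by all later steps.\<close>

definition threshold :: "nat \<Rightarrow> real" where
  "threshold n = 3/4 - 1 / (4 * (real n + 1))"

lemma threshold_bounds: "1/2 \<le> threshold n" "threshold n \<le> 3/4" "threshold n < threshold (Suc n)"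
  by (simp_all add: threshold_def field_simps)

text \<open>The real part of \<open>K V\<close>, where \<open>K = cross \<xi> \<eta>\<close> and
  \<open>V'\<close> stands for the adjoint of \<open>V\<close>. Moving \<open>\<xi>\<close> by
  \<open>V'\<close> changes the cross operator from \<open>K\<close> to \<open>K V\<close>, which
  explains the factor on the right.\<close>

definition half_re :: "'h \<Rightarrow> 'h endo \<Rightarrow> 'h endo \<Rightarrow> 'h endo" where
  "half_re \<eta> V V' = (1/2) *\<^sub>R (cross \<xi> \<eta> * V + V' * cross \<eta> \<xi>)"

lemma half_re_props:
  assumes \<eta>: "PF \<eta>" and V: "cadj V V'" "V * V' = 1" "V' * V = 1"
  shows "cadj (half_re \<eta> V V') (half_re \<eta> V V')" "norm (half_re \<eta> V V') \<le> 1"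
proof -
  let ?K = "cross \<xi> \<eta>" and ?K' = "cross \<eta> \<xi>"
  have K: "cadj ?K ?K'" by (rule cadj_cross[OF PF_\<xi> \<eta>])
  have "cadj (?K * V + V' * ?K') (V' * ?K' + ?K * V)"
    by (intro cadj_intros K V cadj_sym[OF K] cadj_sym[OF V(1)])
  then show "cadj (half_re \<eta> V V') (half_re \<eta> V V')"
    unfolding half_re_def using cadj_intros(7)[of "?K * V + V' * ?K'" _ "1/2"] by (simp add: add.commute)
  have "norm (?K * V) \<le> 1 * 1"
    by (rule order_trans[OF norm_mult_ineq mult_mono[OF norm_cross[OF PF_\<xi> \<eta>] unitary_norm[OF V(1,3)]]]) simp_all
  moreover have "norm (V' * ?K') \<le> 1 * 1"
    by (rule order_trans[OF norm_mult_ineq mult_mono[OF unitary_norm[OF cadj_sym[OF V(1)] V(2)] norm_cross[OF \<eta> PF_\<xi>]]]) simp_all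
  ultimately have "norm (?K * V + V' * ?K') \<le> 1 * 1 + 1 * 1" by (rule norm_triangle_mono)
  then show "norm (half_re \<eta> V V') \<le> 1" by (simp add: half_re_def)
qed

text \<open>Dependent choice, as each projection is cut from the real part left by all earlier
  reflections and is not determined uniquely.\<close>

lemma greedy_reflections:
  assumes \<eta>: "PF \<eta>"
  obtains E V V' where
    "V 0 = 1"
    "\<And>n. V (Suc n) = V n * (1 - 2 *\<^sub>R E n)" "\<And>n. V' (Suc n) = (1 - 2 *\<^sub>R E n) * V' n"
    "\<And>n. cadj (V n) (V' n)" "\<And>n. V n * V' n = 1" "\<And>n. V' n * V n = 1"
    "\<And>n. cut (half_re \<eta> (V n) (V' n)) (threshold n) (E n)"
proof -
  let ?P = "\<lambda>n (E, V, V'). cadj V V' \<and> V * V' = 1 \<and> V' * V = 1 \<and> (n = 0 \<longrightarrow> V = 1) \<and>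
    cut (half_re \<eta> V V') (threshold n) E"
  let ?Q = "\<lambda>n (E, V, V') (F, W, W'). W = V * (1 - 2 *\<^sub>R E) \<and> W' = (1 - 2 *\<^sub>R E) * V'"
  have ex: "\<exists>E. cut (half_re \<eta> V V') (threshold n) E"
    if V: "cadj V V'" "V * V' = 1" "V' * V = 1" for V V' n
  proof -
    have "0 \<le> threshold n" "threshold n \<le> 1" using threshold_bounds[of n] by linarith+
    with half_re_props[OF \<eta> V] show ?thesis by (rule spectral_projection)
  qed
  have "\<exists>f. \<forall>n. ?P n (f n) \<and> ?Q n (f n) (f (Suc n))"
  proof (rule dependent_nat_choice)
    show "\<exists>x. ?P 0 x" using ex[of 1 1 0] cadj_intros(2) by auto
    fix x :: "'h endo \<times> 'h endo \<times> 'h endo" and n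
    assume P: "?P n x"
    obtain E V V' where x: "x = (E, V, V')" by (cases x)
    have V: "cadj V V'" "V * V' = 1" "V' * V = 1" and E: "cadj E E" "E * E = E"
      using P by (auto simp: x cut_def)
    let ?r = "1 - 2 *\<^sub>R E"
    have 1: "cadj (V * ?r) (?r * V')" by (rule cadj_intros(6)[OF V(1) reflection(1)[OF E]])
    have 2: "(V * ?r) * (?r * V') = 1"
      using reflection(2)[OF E] V(2) by (metis mult.assoc mult_1_left)
    have 3: "(?r * V') * (V * ?r) = 1"
      using reflection(2)[OF E] V(3) by (metis mult.assoc mult_1_left)
    obtain F where "cut (half_re \<eta> (V * ?r) (?r * V')) (threshold (Suc n)) F" using ex[OF 1 2 3] by blast
    then show "\<exists>y. ?P (Suc n) y \<and> ?Q n x y"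
      using 1 2 3 by (intro exI[of _ "(F, V * ?r, ?r * V')"]) (simp add: x)
  qed
  then obtain f where f: "\<And>n. ?P n (f n) \<and> ?Q n (f n) (f (Suc n))" by blast
  show thesis
    by (rule that[of "\<lambda>n. fst (snd (f n))" "\<lambda>n. fst (f n)" "\<lambda>n. snd (snd (f n))"])
      (use f in \<open>auto simp: split_beta\<close>)
qed

end

lemma (in unital_cstar) eq_0_of_cle_smaller_multiple:
  fixes a :: 'a
  assumes a: "cstar_positive a" and le: "s *\<^sub>R a \<preceq> r *\<^sub>R a" and "r < s"
  shows "a = 0"
proof (rule cle_antisym)
  have "cstar_positive ((r - s) *\<^sub>R a)" using le by (simp add: cle_def scaleR_diff_left)
  then have "cstar_positive ((1 / (s - r)) *\<^sub>R ((r - s) *\<^sub>R a))"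
    by (rule cstar_positive_scaleR[rotated]) (use \<open>r < s\<close> in simp)
  moreover have "(1 / (s - r)) * (r - s) = -1" using \<open>r < s\<close> by (simp add: field_simps)
  ultimately show "a \<preceq> 0" by (simp add: cle_def)
  show "0 \<preceq> a" using a by (simp add: cle_def)
qed

context dual_group_frames
begin

text \<open>\<open>A E = (A E) E\<close>, and the trace property moves the last \<open>E\<close> to
  the front.\<close>

lemma trace_compress:
  assumes A: "cadj A A'" and E: "cadj E E" "E * E = E"
  shows "ip (ap A (ap E \<xi>)) \<xi> = ip (ap A (ap E \<xi>)) (ap E \<xi>)"
proof -
  have EE: "ap E (ap E x) = ap E x" for x using E(2) by (metis ap_simps(7))
  have "ip (ap (A * E) (ap E \<xi>)) \<xi> = ip (ap E (ap (A * E) \<xi>)) \<xi>"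
    by (rule trace_commute[OF PF_\<xi> cadj_intros(6)[OF A E(1)] E(1)])
  then show ?thesis by (simp add: EE cadj_ip[OF E(1)])
qed

end

section \<open>The traces of the reflecting projections\<close>

locale reflection_sequence =
  dual_group_frames act ip e G L \<xi>
  for act :: "'a::{cstar_algebra, comm_ring} \<Rightarrow> 'h::complex_banach \<Rightarrow> 'h"
    and ip :: "'h \<Rightarrow> 'h \<Rightarrow> 'a" and e :: 'a and G :: "('h \<Rightarrow> 'h) set" and L :: "(nat \<Rightarrow> 'a) \<Rightarrow> 'a"
    and \<xi> :: 'h +
  fixes \<eta> :: 'h and E V V' :: "nat \<Rightarrow> 'h endo"
  assumes PF_\<eta>: "PF \<eta>" and V0: "V 0 = 1"
    and V_Suc: "\<And>n. V (Suc n) = V n * (1 - 2 *\<^sub>R E n)"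
    and V'_Suc: "\<And>n. V' (Suc n) = (1 - 2 *\<^sub>R E n) * V' n"
    and V_cadj: "\<And>n. cadj (V n) (V' n)" and V_unitary: "\<And>n. V n * V' n = 1" "\<And>n. V' n * V n = 1"
    and V_cut: "\<And>n. cut (half_re \<eta> (V n) (V' n)) (threshold n) (E n)"
begin

abbreviation C :: "nat \<Rightarrow> 'h endo" where "C n \<equiv> half_re \<eta> (V n) (V' n)"
abbreviation \<tau> :: "nat \<Rightarrow> 'a" where "\<tau> n \<equiv> ip (ap (E n) \<xi>) (ap (E n) \<xi>)"

lemma E_cadj: "cadj (E n) (E n)" and E_idem: "E n * E n = E n" and E_comm: "E n * C n = C n * E n"
  and E_upper: "ip (ap (C n) (ap (E n) x)) (ap (E n) x) \<preceq> - (threshold n *\<^sub>R ip (ap (E n) x) (ap (E n) x))"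
  and E_lower: "- (threshold n *\<^sub>R ip (ap (1 - E n) x) (ap (1 - E n) x))
    \<preceq> ip (ap (C n) (ap (1 - E n) x)) (ap (1 - E n) x)"
  using V_cut[of n] unfolding cut_def by blast+

lemma E_E: "ap (E n) (ap (E n) x) = ap (E n) x"
  using E_idem by (metis ap_simps(7))

lemma C_cadj: "cadj (C n) (C n)" and C_norm: "norm (C n) \<le> 1"
  using half_re_props[OF PF_\<eta> V_cadj V_unitary] by blast+

lemma C_Suc: "C (Suc n) = C n - (cross \<xi> \<eta> * V n * E n + E n * V' n * cross \<eta> \<xi>)"
  by (simp add: half_re_def V_Suc V'_Suc algebra_simps mult.assoc)

text \<open>One reflection subtracts \<open>K V E\<close> and its adjoint. Under the trace only
  their corners at \<open>E\<close> count, and these add up to twice the corner of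
  \<open>C n\<close>, where \<open>E_upper\<close> applies.\<close>

lemma gain: "ip (ap (C n) \<xi>) \<xi> + \<tau> n \<preceq> ip (ap (C (Suc n)) \<xi>) \<xi>"
proof -
  let ?A = "cross \<xi> \<eta> * V n" and ?A' = "V' n * cross \<eta> \<xi>" and ?E = "E n"
  have A: "cadj ?A ?A'"
    by (intro cadj_intros cadj_cross PF_\<xi> PF_\<eta> V_cadj)
  have 1: "ip (ap (?A * ?E) \<xi>) \<xi> = ip (ap ?A (ap ?E \<xi>)) (ap ?E \<xi>)"
    using trace_compress[OF A E_cadj E_idem] by simp
  have "ip (ap (?E * ?A') \<xi>) \<xi> = star (ip (ap (?A * ?E) \<xi>) \<xi>)"
    using cadj_ip[OF cadj_intros(6)[OF A E_cadj[of n]], of \<xi> \<xi>] by (simp add: star_ip)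
  then have 2: "ip (ap (?E * ?A') \<xi>) \<xi> = ip (ap ?A' (ap ?E \<xi>)) (ap ?E \<xi>)"
    by (simp only: 1 star_ip cadj_ip[OF cadj_sym[OF A]])
  have "ip (ap (C n) \<xi>) \<xi> - ip (ap (C (Suc n)) \<xi>) \<xi> = 2 *\<^sub>R ip (ap (C n) (ap ?E \<xi>)) (ap ?E \<xi>)"
  proof -
    have "ip (ap (C n) \<xi>) \<xi> - ip (ap (C (Suc n)) \<xi>) \<xi> = ip (ap (?A * ?E) \<xi>) \<xi> + ip (ap (?E * ?A') \<xi>) \<xi>"
      unfolding C_Suc by (simp add: ip_simps mult.assoc)
    also have "\<dots> = ip (ap (?A + ?A') (ap ?E \<xi>)) (ap ?E \<xi>)"
      unfolding 1 2 by (simp add: ip_simps)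
    also have "\<dots> = 2 *\<^sub>R ip (ap (C n) (ap ?E \<xi>)) (ap ?E \<xi>)"
      by (simp add: half_re_def ip_simps)
    finally show ?thesis .
  qed
  also have "\<dots> \<preceq> 2 *\<^sub>R (- (threshold n *\<^sub>R \<tau> n))"
    by (rule cle_scaleR[OF _ E_upper]) simp
  \<comment> \<open>This needs \<open>2 * threshold n \<ge> 1\<close>, which is why the thresholds
    start at \<open>1/2\<close>.\<close>
  also have "\<dots> \<preceq> - \<tau> n"
    using cstar_positive_scaleR[of "2 * threshold n - 1" "\<tau> n"] threshold_bounds(1)[of n]
    by (simp add: cle_def ip_positive scaleR_diff_left)
  finally show ?thesis by (simp add: cle_def algebra_simps)
qed

text \<open>The gains telescope, and the trace of every contraction \<open>C n\<close> lies between
  \<open>- (norm \<xi>)\<^sup>2 e\<close> and \<open>(norm \<xi>)\<^sup>2 e\<close>.\<close>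

lemma tau_sum: "(\<Sum>k<n. \<tau> k) \<preceq> (2 * (norm \<xi>)\<^sup>2) *\<^sub>R e"
proof -
  have "ip (ap (C 0) \<xi>) \<xi> + (\<Sum>k<n. \<tau> k) \<preceq> ip (ap (C n) \<xi>) \<xi>" for n
  proof (induction n)
    case (Suc n)
    have "ip (ap (C 0) \<xi>) \<xi> + (\<Sum>k<Suc n. \<tau> k) \<preceq> ip (ap (C n) \<xi>) \<xi> + \<tau> n"
      using cle_add[OF Suc cle_refl[of "\<tau> n"]] by (simp add: add.assoc)
    then show ?case using gain by (rule cle_trans)
  qed simp
  then have "(\<Sum>k<n. \<tau> k) \<preceq> ip (ap (C n) \<xi>) \<xi> - ip (ap (C 0) \<xi>) \<xi>"
    by (simp add: cle_def algebra_simps)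
  also have "\<dots> \<preceq> (norm \<xi>)\<^sup>2 *\<^sub>R e + (norm \<xi>)\<^sup>2 *\<^sub>R e"
  proof -
    have sa: "star (ip (ap (C n) \<xi>) \<xi>) = ip (ap (C n) \<xi>) \<xi>" for n
      by (simp add: star_ip cadj_ip[OF C_cadj])
    have "norm (ip (ap (C n) \<xi>) \<xi>) \<le> (norm \<xi>)\<^sup>2" for n
      using norm_ip[of "ap (C n) \<xi>" \<xi>]
        mult_right_mono[OF order_trans[OF norm_ap mult_right_mono[OF C_norm]], of \<xi> "norm \<xi>" n]
      by (simp add: power2_eq_square)
    then have "ip (ap (C n) \<xi>) \<xi> \<preceq> (norm \<xi>)\<^sup>2 *\<^sub>R e" "- ip (ap (C n) \<xi>) \<xi> \<preceq> (norm \<xi>)\<^sup>2 *\<^sub>R e" for n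
      using sa by (simp_all add: sa_cle_norm star_minus)
    then show ?thesis using cle_add by fastforce
  qed
  finally show ?thesis by (simp flip: scaleR_add_left)
qed

text \<open>Since \<xi> is separating, \<open>p\<close> annihilates all of \<open>E n\<close>, so at
  \<open>y = p E (Suc n) \<xi>\<close> the forms of \<open>C n\<close> and \<open>C (Suc n)\<close>
  agree. One is bounded below by \<open>- threshold n\<close>, the other above by
  \<open>- threshold (Suc n)\<close>, each times \<open>ip y y\<close>; hence
  \<open>y = 0\<close>.\<close>

lemma E_annihilated_Suc:
  assumes "p * \<tau> n = 0"
  shows "p * \<tau> (Suc n) = 0"
proof -
  have zero: "act p (ap (E k) x) = 0" if "act p (ap (E k) \<xi>) = 0" for k x
  proof -
    have "mulop p * E k = 0"
      by (rule commutant_eq_0[OF cadj_intros(6)[OF cadj_mulop E_cadj]]) (simp add: that)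
    then have "ap (mulop p * E k) x = 0" by simp
    then show ?thesis by simp
  qed
  have "ip (act p (ap (E n) \<xi>)) (act p (ap (E n) \<xi>)) = star p * (p * \<tau> n)"
    by (simp add: ip_simps mult_ac)
  then have "act p (ap (E n) \<xi>) = 0" using assms ip_self_eq_0 by simp
  note En = zero[OF this]
  let ?y = "act p (ap (E (Suc n)) \<xi>)"
  have Ey: "ap (E n) ?y = 0" by (simp add: adj_act[OF cadj_adj[OF E_cadj]] En)
  have Ey': "ap (E (Suc n)) ?y = ?y" by (simp add: adj_act[OF cadj_adj[OF E_cadj]] E_E)
  have "ip (ap (C (Suc n)) y) y = ip (ap (C n) y) y" if "ap (E n) y = 0" for y
    by (simp add: C_Suc ip_diff_left ip_add_left that cadj_ip[OF E_cadj] ap.zero_right)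
  from this[OF Ey] have "ip (ap (C (Suc n)) ?y) ?y = ip (ap (C n) ?y) ?y" .
  moreover have "ip (ap (C (Suc n)) ?y) ?y \<preceq> - (threshold (Suc n) *\<^sub>R ip ?y ?y)"
    using E_upper[of "Suc n" ?y] by (simp only: Ey')
  moreover have "- (threshold n *\<^sub>R ip ?y ?y) \<preceq> ip (ap (C n) ?y) ?y"
    using E_lower[of n ?y] by (simp only: ap_simps Ey diff_zero)
  ultimately have "- (threshold n *\<^sub>R ip ?y ?y) \<preceq> - (threshold (Suc n) *\<^sub>R ip ?y ?y)"
    by (simp only:) (rule cle_trans)
  then have "threshold (Suc n) *\<^sub>R ip ?y ?y \<preceq> threshold n *\<^sub>R ip ?y ?y" by (simp add: cle_def)
  then have "ip ?y ?y = 0"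
    by (rule eq_0_of_cle_smaller_multiple[OF ip_positive _ threshold_bounds(3)])
  then have "?y = 0" by (simp add: ip_self_eq_0)
  then have "ip ?y (ap (E (Suc n)) \<xi>) = 0" by simp
  then show ?thesis by (simp add: ip_act_left)
qed

text \<open>The frame expansion of \<open>E \<xi>\<close> has \<open>card G\<close> terms. As
  \<open>E\<close> commutes with \<open>U\<close>, its coefficients are inner products of
  \<open>E \<xi>\<close> and \<open>U E \<xi>\<close>, two vectors with the same inner square
  \<open>\<tau> n\<close>.\<close>

lemma tau_le_square:
  assumes "finite G"
  shows "\<tau> n \<preceq> (2 * real (card G)) *\<^sub>R (\<tau> n * \<tau> n)"
proof -
  let ?v = "ap (E n) \<xi>"
  have "((\<lambda>U. ip ?v (U \<xi>) * star (ip ?v (U \<xi>))) has_sum \<tau> n) G"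
    by (rule PF_coefficients[OF PF_\<xi>])
  then have "\<tau> n = (\<Sum>U\<in>G. ip ?v (U \<xi>) * star (ip ?v (U \<xi>)))"
    using assms has_sum_unique has_sum_finite by blast
  also have "\<dots> \<preceq> (\<Sum>U\<in>G. 2 *\<^sub>R (\<tau> n * \<tau> n))"
  proof -
    have "ip ?v (U \<xi>) * star (ip ?v (U \<xi>)) \<preceq> 2 *\<^sub>R (\<tau> n * \<tau> n)" if U: "U \<in> G" for U
    proof -
      have "ip ?v (U \<xi>) = ip (ap (E n) ?v) (U \<xi>)" by (simp add: E_E)
      also have "\<dots> = ip ?v (U ?v)" by (simp only: cadj_ip[OF E_cadj] cadj_commute[OF E_cadj U])
      finally show ?thesis
        using ip_mult_star_le[of "U ?v" ?v] by (simp add: ip_G_G[OF U])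
    qed
    then have "cstar_positive (\<Sum>U\<in>G. 2 *\<^sub>R (\<tau> n * \<tau> n) - ip ?v (U \<xi>) * star (ip ?v (U \<xi>)))"
      by (intro cstar_positive_sum) (simp add: cle_def)
    then show ?thesis by (simp add: cle_def sum_subtractf)
  qed
  also have "(\<Sum>U\<in>G. 2 *\<^sub>R (\<tau> n * \<tau> n)) = (2 * real (card G)) *\<^sub>R (\<tau> n * \<tau> n)"
    by (simp add: sum_constant_scaleR mult.commute)
  finally show ?thesis .
qed

text \<open>The multiple \<open>b k\<close> of \<open>\<tau> k\<close> is at least 1 wherever it is
  nonzero, and later ones vanish wherever it does. Where \<open>b m\<close> is nonzero, the
  \<open>m\<close> earlier terms add up to at least \<open>m\<close>, against the bound of
  \<open>tau_sum\<close>.\<close>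

lemma tau_eventually_0:
  assumes fin: "finite G"
  shows "\<exists>N. \<forall>m\<ge>N. \<tau> m = 0"
proof -
  define g where "g = 2 * real (card G)"
  have g: "g > 0" using fin id_in_G by (auto simp: g_def card_gt_0_iff)
  define b where "b k = g *\<^sub>R \<tau> k" for k
  have bpos: "cstar_positive (b k)" for k
    unfolding b_def using g by (intro cstar_positive_scaleR ip_positive) simp
  have bb: "b k \<preceq> b k * b k" for k
    using cle_scaleR[OF less_imp_le[OF g] tau_le_square[OF fin, of k]] by (simp add: b_def g_def)
  have ann: "p * \<tau> m = 0" if "p * \<tau> k = 0" "k \<le> m" for p k m
    using that(2,1) by (induction m rule: dec_induct) (auto intro: E_annihilated_Suc)
  \<comment> \<open>\<open>p\<close> kills \<open>b m\<close> and dominates \<open>e - b k\<close>: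
    on the support of \<open>b m\<close> the element \<open>b k\<close> is at least 1.\<close>
  have key: "b m \<preceq> b k * b m" if km: "k \<le> m" for k m
  proof -
    obtain p where p: "cstar_positive p" "p * b k = 0" "e - b k \<preceq> p"
      using annihilating_positive[OF bpos bb] by metis
    have "p * \<tau> k = 0" using p(2) g by (simp add: b_def)
    then have "p * b m = 0" using ann[OF _ km] by (simp add: b_def)
    moreover have "b m * (e - b k) \<preceq> b m * p" by (rule cle_mult_left[OF bpos p(3)])
    ultimately show ?thesis by (simp add: cle_def right_diff_distrib mult.commute)
  qed
  define c where "c = g * (2 * (norm \<xi>)\<^sup>2)"
  have "b m = 0" if m: "real m > c" for m
  proof -
    have "(\<Sum>k<m. b k) \<preceq> c *\<^sub>R e"
      using cle_scaleR[OF less_imp_le[OF g] tau_sum[of m]] by (simp add: b_def c_def scaleR_sum_right)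
    from cle_mult_left[OF bpos this, of m] have 1: "(\<Sum>k<m. b k * b m) \<preceq> c *\<^sub>R b m"
      by (simp add: sum_distrib_left mult.commute)
    have "cstar_positive (\<Sum>k<m. b k * b m - b m)"
      by (rule cstar_positive_sum) (use key in \<open>simp add: cle_def\<close>)
    then have "real m *\<^sub>R b m \<preceq> (\<Sum>k<m. b k * b m)"
      by (simp add: cle_def sum_subtractf sum_constant_scaleR)
    then have "real m *\<^sub>R b m \<preceq> c *\<^sub>R b m" using 1 by (rule cle_trans)
    then show ?thesis by (rule eq_0_of_cle_smaller_multiple[OF bpos _ m])
  qed
  then have "\<tau> m = 0" if "m \<ge> nat \<lceil>c\<rceil> + 1" for m
  proof -
    have "real m > c" using that by linarith
    with \<open>\<And>m. real m > c \<Longrightarrow> b m = 0\<close> show ?thesis using g unfolding b_def by fastforce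
  qed
  then show ?thesis by blast
qed

lemma summable_tau: "summable \<tau>"
proof (cases "finite G")
  case True
  then obtain N where "\<forall>m\<ge>N. \<tau> m = 0" using tau_eventually_0 by blast
  then show ?thesis by (intro summable_finite[of "{..<N}"]) (auto simp: not_less)
next
  case False
  show ?thesis
  proof (rule self_dual_imp_summable[OF l2_self_dual to_nat_on_infinite[OF PF_countable[OF PF_\<xi>] False]])
    show "norm (\<Sum>k<n. \<tau> k) \<le> 2 * (norm \<xi>)\<^sup>2" for n
      by (rule cle_norm_bound[OF cstar_positive_sum tau_sum]) (simp_all add: ip_positive)
  qed (rule ip_positive)
qed

end

section \<open>The path\<close>

context reflection_sequence
begin

text \<open>\<open>W z\<close> replaces every reflection \<open>1 - 2 E k\<close> by \<open>1 + (z - 1) E k\<close>. As \<open>z\<close> moves on the unit circle from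
  \<open>1\<close> to \<open>-1\<close> this connects the identity to \<open>V\<close>.\<close>

primrec W :: "complex \<Rightarrow> nat \<Rightarrow> 'h endo" where
  "W z 0 = 1"
| "W z (Suc n) = W z n * (1 + scal (z - 1) * E n)"

primrec W' :: "complex \<Rightarrow> nat \<Rightarrow> 'h endo" where
  "W' z 0 = 1"
| "W' z (Suc n) = (1 + scal (cnj z - 1) * E n) * W' z n"

lemma E_scal: "E n * scal c = scal c * E n"
  by (rule endo_eqI) (simp add: adj_scaleC[OF cadj_adj[OF E_cadj]])

lemma W_cadj: "cadj (W z n) (W' z n)"
proof (induction n)
  case (Suc n)
  have "cadj (scal (z - 1) * E n) (E n * scal (cnj (z - 1)))"
    by (intro cadj_intros E_cadj)
  then have "cadj (1 + scal (z - 1) * E n) (1 + scal (cnj z - 1) * E n)"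
    using cadj_intros(3)[OF cadj_intros(2)] by (simp add: E_scal)
  then show ?case using Suc cadj_intros(6) by simp
qed (simp add: cadj_intros)

lemma W_unitary:
  assumes z: "cmod z = 1"
  shows "W z n * W' z n = 1" "W' z n * W z n = 1"
proof -
  \<comment> \<open>As \<open>E\<close> is idempotent, the coefficient of \<open>E\<close> in the
    product is \<open>(z - 1) + (w - 1) + (z - 1) (w - 1) = z w - 1\<close>.\<close>
  have step: "(1 + scal (z - 1) * E n) * (1 + scal (w - 1) * E n) = 1" if "z * w = 1" for z w n
  proof (rule endo_eqI)
    fix x
    have "(z - 1) *\<^sub>C x + (w - 1) *\<^sub>C x + (z - 1) *\<^sub>C (w - 1) *\<^sub>C x = 0" for x :: 'h
      unfolding scaleC_scaleC scaleC_add_left[symmetric]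
      using that by (simp add: algebra_simps)
    from this[of "ap (E n) x"]
    show "ap ((1 + scal (z - 1) * E n) * (1 + scal (w - 1) * E n)) x = ap 1 x"
      by (simp add: ap.add_right E_E adj_scaleC[OF cadj_adj[OF E_cadj]] scaleC_add_right add_ac)
  qed
  have zz: "z * cnj z = 1" "cnj z * z = 1"
    using z complex_norm_square[of z] by (simp_all add: mult.commute)
  show "W z n * W' z n = 1"
  proof (induction n)
    case (Suc n)
    have "W z (Suc n) * W' z (Suc n)
        = W z n * ((1 + scal (z - 1) * E n) * (1 + scal (cnj z - 1) * E n)) * W' z n"
      by (simp add: mult.assoc)
    then show ?case using Suc by (simp add: step[OF zz(1)])
  qed simp
  show "W' z n * W z n = 1"
  proof (induction n)
    case (Suc n)
    have "W' z (Suc n) * W z (Suc n)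
        = (1 + scal (cnj z - 1) * E n) * (W' z n * W z n) * (1 + scal (z - 1) * E n)"
      by (simp add: mult.assoc)
    then show ?case using Suc by (simp add: step[OF zz(2)])
  qed simp
qed

lemma W_1: "W' 1 n = 1"
proof (induction n)
  case (Suc n)
  have "scal 0 * E n = 0" by (rule endo_eqI) simp
  then show ?case using Suc by simp
qed simp

lemma W_minus_1: "W (-1) n = V n"
proof (induction n)
  case (Suc n)
  have "1 + scal (- 2) * E n = 1 - 2 *\<^sub>R E n"
  proof (rule endo_eqI)
    fix x
    have "(- 2) *\<^sub>C ap (E n) x = of_real (- 2) *\<^sub>C ap (E n) x" by simp
    then show "ap (1 + scal (- 2) * E n) x = ap (1 - 2 *\<^sub>R E n) x"
      unfolding scaleC_of_real by simp
  qed
  then show ?case using Suc by (simp add: V_Suc)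
qed (simp add: V0)

text \<open>All \<open>W z k\<close> are isometric, so the increment is controlled by the real part
  of the inner product of \<open>W z m \<xi>\<close> and \<open>W z n \<xi>\<close>.
  \<open>trace_compress\<close> puts \<open>E m\<close> on both sides of each new term, so the term
  is bounded by \<open>\<tau> m\<close> and not merely by a square root of it.\<close>

lemma W_increment:
  assumes z: "cmod z = 1" and nm: "n \<le> m"
  shows "ip (ap (W z m - W z n) \<xi>) (ap (W z m - W z n) \<xi>) \<preceq> 4 *\<^sub>R (\<Sum>k=n..<m. \<tau> k)"
proof -
  let ?q = "\<lambda>m. ip (ap (W z m) \<xi>) (ap (W z n) \<xi>) + star (ip (ap (W z m) \<xi>) (ap (W z n) \<xi>))"
  have iso: "ip (ap (W z k) x) (ap (W z k) x) = ip x x" for k x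
    using W_unitary(2)[OF z, of k] by (metis W_cadj ap_simps(2,7) cadj_ip)
  have "2 *\<^sub>R ip \<xi> \<xi> \<preceq> ?q m + 4 *\<^sub>R (\<Sum>k=n..<m. \<tau> k)"
    using nm
  proof (induction m rule: dec_induct)
    case base
    show ?case by (simp add: iso star_ip scaleR_2)
  next
    case (step m)
    let ?x = "ap (W z m) (ap (E m) \<xi>)" and ?y = "ap (W z n) (ap (E m) \<xi>)"
    \<comment> \<open>On the unit circle \<open>z - 1\<close> has modulus at most 2; halving it
      allows \<open>twice_re_ip_le\<close>, and doubling again yields the constant 4.\<close>
    let ?c = "(1 - z) / 2"
    have "cadj (W' z n * W z m) (W' z m * W z n)"
      by (intro cadj_intros W_cadj cadj_sym[OF W_cadj])
    from trace_compress[OF this E_cadj E_idem, of m]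
    have tr: "ip ?x (ap (W z n) \<xi>) = ip ?x ?y"
      by (simp add: cadj_ip[OF cadj_sym[OF W_cadj]])
    have "cmod (1 - z) \<le> 1 + 1" using norm_triangle_ineq4[of 1 z] z by simp
    then have "cmod ?c \<le> 1" by (simp add: norm_divide)
    from twice_re_ip_le[OF this, of ?x ?y]
    have "?c *\<^sub>C ip ?x ?y + star (?c *\<^sub>C ip ?x ?y) \<preceq> 2 *\<^sub>R \<tau> m"
      by (simp add: iso scaleR_2)
    from cle_scaleR[OF _ this, of 2]
    have le: "2 *\<^sub>R (?c *\<^sub>C ip ?x ?y) + star (2 *\<^sub>R (?c *\<^sub>C ip ?x ?y)) \<preceq> 4 *\<^sub>R \<tau> m"
      by (simp add: scaleR_add_right star_scaleR)
    have "2 *\<^sub>R (?c *\<^sub>C ip ?x ?y) = - ((z - 1) *\<^sub>C ip ?x ?y)"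
    proof -
      have "of_real 2 * ?c = - (z - 1)" by simp
      then show ?thesis
        by (simp only: scaleC_of_real[symmetric] scaleC_scaleC scaleC.minus_left)
    qed
    moreover have "ip (ap (W z (Suc m)) \<xi>) (ap (W z n) \<xi>) = ip (ap (W z m) \<xi>) (ap (W z n) \<xi>) + (z - 1) *\<^sub>C ip ?x ?y"
      by (simp add: ap.add_right ip_add_left adj_scaleC[OF cadj_adj[OF W_cadj]] ip_scaleC_left tr)
    ultimately have "?q m = ?q (Suc m) + (2 *\<^sub>R (?c *\<^sub>C ip ?x ?y) + star (2 *\<^sub>R (?c *\<^sub>C ip ?x ?y)))"
      by (simp add: star_add star_minus)
    with le have "?q m \<preceq> ?q (Suc m) + 4 *\<^sub>R \<tau> m"
      using cle_add[OF cle_refl le] by simp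
    then have "?q m + 4 *\<^sub>R (\<Sum>k=n..<m. \<tau> k) \<preceq> ?q (Suc m) + 4 *\<^sub>R \<tau> m + 4 *\<^sub>R (\<Sum>k=n..<m. \<tau> k)"
      by (rule cle_add) simp
    also have "\<dots> = ?q (Suc m) + 4 *\<^sub>R (\<Sum>k=n..<Suc m. \<tau> k)"
      using step(1) by (simp add: scaleR_add_right add_ac)
    finally show ?case using step.IH cle_trans by blast
  qed
  then have le: "cstar_positive (?q m + 4 *\<^sub>R (\<Sum>k=n..<m. \<tau> k) - 2 *\<^sub>R ip \<xi> \<xi>)"
    by (simp only: cle_def)
  have eq: "ip (ap (W z m - W z n) \<xi>) (ap (W z m - W z n) \<xi>) = 2 *\<^sub>R ip \<xi> \<xi> - ?q m"
    by (simp add: ip_simps iso star_ip scaleR_2)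
  have "4 *\<^sub>R (\<Sum>k=n..<m. \<tau> k) - (2 *\<^sub>R ip \<xi> \<xi> - ?q m) = ?q m + 4 *\<^sub>R (\<Sum>k=n..<m. \<tau> k) - 2 *\<^sub>R ip \<xi> \<xi>"
    by (simp only: algebra_simps)
  with le show ?thesis unfolding cle_def eq by (simp only:)
qed

text \<open>For the difference \<open>D\<close> with adjoint \<open>D'\<close> the two sides are the
  traces of \<open>D D'\<close> and \<open>D' D\<close>. Convergence of the adjoints at \<xi> thus
  comes for free.\<close>

lemma W'_increment:
  "ip (ap (W' z m - W' z n) \<xi>) (ap (W' z m - W' z n) \<xi>) = ip (ap (W z m - W z n) \<xi>) (ap (W z m - W z n) \<xi>)"
proof -
  have D: "cadj (W z m - W z n) (W' z m - W' z n)" by (intro cadj_intros W_cadj)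
  show ?thesis
    unfolding cadj_ip[OF D] cadj_ip[OF cadj_sym[OF D]]
    using trace_commute[OF PF_\<xi> D cadj_sym[OF D]] by (metis D cadj_ip cadj_sym)
qed

lemma W_Cauchy:
  assumes "\<epsilon> > 0"
  shows "\<exists>N. \<forall>z m n. cmod z = 1 \<longrightarrow> N \<le> n \<longrightarrow> n \<le> m \<longrightarrow>
    norm (ap (W z m - W z n) \<xi>) < \<epsilon> \<and> norm (ap (W' z m - W' z n) \<xi>) < \<epsilon>"
proof -
  have "\<epsilon>\<^sup>2 / 4 > 0" using assms by simp
  then obtain N where N: "\<forall>n\<ge>N. \<forall>m. norm (\<Sum>k=n..<m. \<tau> k) < \<epsilon>\<^sup>2 / 4"
    using summable_tau unfolding summable_Cauchy by blast
  have 1: "norm (ap (W z m - W z n) \<xi>) < \<epsilon>" if "cmod z = 1" "N \<le> n" "n \<le> m" for z m n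
  proof -
    have "(norm (ap (W z m - W z n) \<xi>))\<^sup>2 \<le> norm (4 *\<^sub>R (\<Sum>k=n..<m. \<tau> k))"
      unfolding norm_ip_self[symmetric] by (rule norm_mono[OF ip_positive W_increment[OF that(1,3)]])
    also have "\<dots> < \<epsilon>\<^sup>2" using N[rule_format, OF that(2), of m] by simp
    finally show ?thesis by (rule power2_less_imp_less) (use assms in simp)
  qed
  have "norm (ap (W' z m - W' z n) \<xi>) = norm (ap (W z m - W z n) \<xi>)" for z m n
    unfolding norm_eq_ip W'_increment ..
  with 1 show ?thesis by (intro exI[of _ N]) simp
qed

text \<open>The adjoint products act on \<xi>, so that the coefficients of \<open>x\<close> with
  respect to the moved frame are those of \<open>W z n x\<close> with respect to the old
  one.\<close>

definition \<zeta> :: "complex \<Rightarrow> 'h" where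
  "\<zeta> z = lim (\<lambda>n. ap (W' z n) \<xi>)"

lemma uniform_limit_zeta: "uniform_limit {z. cmod z = 1} (\<lambda>n z. ap (W' z n) \<xi>) \<zeta> sequentially"
proof -
  have "uniformly_Cauchy_on {z. cmod z = 1} (\<lambda>n z. ap (W' z n) \<xi>)"
  proof (rule uniformly_Cauchy_onI')
    fix \<epsilon> :: real assume "\<epsilon> > 0"
    from W_Cauchy[OF this] obtain N where "\<forall>z m n. cmod z = 1 \<longrightarrow> N \<le> n \<longrightarrow> n \<le> m \<longrightarrow>
        norm (ap (W z m - W z n) \<xi>) < \<epsilon> \<and> norm (ap (W' z m - W' z n) \<xi>) < \<epsilon>"
      by (elim exE)
    then have N: "cmod z = 1 \<Longrightarrow> N \<le> n \<Longrightarrow> n \<le> m \<Longrightarrow> dist (ap (W' z n) \<xi>) (ap (W' z m) \<xi>) < \<epsilon>" for z m n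
      by (simp add: dist_norm norm_minus_commute)
    show "\<exists>M. \<forall>z\<in>{z. cmod z = 1}. \<forall>m\<ge>M. \<forall>n>m. dist (ap (W' z m) \<xi>) (ap (W' z n) \<xi>) < \<epsilon>"
      by (rule exI[of _ N]) (simp add: N)
  qed
  then show ?thesis
    unfolding \<zeta>_def uniformly_convergent_uniform_limit_iff[symmetric]
    by (rule Cauchy_uniformly_convergent)
qed

lemma zeta_tendsto: "cmod z = 1 \<Longrightarrow> (\<lambda>n. ap (W' z n) \<xi>) \<longlonglongrightarrow> \<zeta> z"
  using tendsto_uniform_limitI[OF uniform_limit_zeta, of z] by simp

lemma continuous_zeta: "continuous_on {z. cmod z = 1} \<zeta>"
proof (rule uniform_limit_theorem[OF always_eventually uniform_limit_zeta])
  have "continuous_on {z. cmod z = 1} (\<lambda>z. ap (W' z n) \<xi>)" for n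
  proof (induction n)
    case (Suc n)
    then show ?case
      by (auto intro!: continuous_intros ap.continuous_on scaleC.continuous_on)
  qed simp
  then show "\<forall>n. continuous_on {z. cmod z = 1} (\<lambda>z. ap (W' z n) \<xi>)" by blast
qed simp

lemma zeta_1: "\<zeta> 1 = \<xi>"
proof (rule LIMSEQ_unique)
  show "(\<lambda>n. ap (W' 1 n) \<xi>) \<longlonglongrightarrow> \<zeta> 1" by (rule zeta_tendsto) simp
  show "(\<lambda>n. ap (W' 1 n) \<xi>) \<longlonglongrightarrow> \<xi>" by (simp add: W_1)
qed

text \<open>The differences have norm at most 2, so \<open>commutant_small\<close> turns the Cauchy
  property at \<xi> into one at every \<open>x\<close>. That \<open>J\<close> is isometric is all
  that \<open>PF_transport\<close> asks for.\<close>

lemma W_strong_limit: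
  assumes z: "cmod z = 1"
  obtains J where "\<And>x. (\<lambda>n. ap (W z n) x) \<longlonglongrightarrow> J x" "\<And>x. ip (J x) (J x) = ip x x"
    "\<And>x U. U \<in> G \<Longrightarrow> ip x (U (\<zeta> z)) = ip (J x) (U \<xi>)"
proof -
  have "convergent (\<lambda>n. ap (W z n) x)" for x
  proof (rule Cauchy_convergent, rule metric_CauchyI)
    fix \<epsilon> :: real assume "\<epsilon> > 0"
    then obtain \<delta> where \<delta>: "\<delta> > 0"
      "\<And>X X'. cadj X X' \<Longrightarrow> norm X \<le> 2 \<Longrightarrow> norm (ap X \<xi>) < \<delta> \<Longrightarrow> norm (ap X x) < \<epsilon>"
      using commutant_small[OF PF_\<xi>, of \<epsilon> 2 x] by blast
    from W_Cauchy[OF \<delta>(1)] obtain N where "\<forall>z m n. cmod z = 1 \<longrightarrow> N \<le> n \<longrightarrow> n \<le> m \<longrightarrow>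
        norm (ap (W z m - W z n) \<xi>) < \<delta> \<and> norm (ap (W' z m - W' z n) \<xi>) < \<delta>"
      by (elim exE)
    then have N: "norm (ap (W z m - W z n) \<xi>) < \<delta>" if "N \<le> n" "n \<le> m" for m n
      using z that by blast
    have "norm (W z m - W z n) \<le> 1 + 1" for m n
      by (rule norm_triangle_le_diff[OF add_mono])
        (rule unitary_norm[OF W_cadj W_unitary(2)[OF z]])+
    then have "norm (ap (W z m - W z n) x) < \<epsilon>" if "N \<le> n" "n \<le> m" for m n
      by (intro \<delta>(2)[OF cadj_intros(4)[OF W_cadj W_cadj]] N[OF that]) simp
    then have "dist (ap (W z m) x) (ap (W z n) x) < \<epsilon>" if "N \<le> n" "N \<le> m" for m n
      using that by (cases "n \<le> m") (simp_all add: dist_norm, metis nle_le norm_minus_commute)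
    then show "\<exists>M. \<forall>m\<ge>M. \<forall>n\<ge>M. dist (ap (W z m) x) (ap (W z n) x) < \<epsilon>" by blast
  qed
  then obtain J where J: "\<And>x. (\<lambda>n. ap (W z n) x) \<longlonglongrightarrow> J x" unfolding convergent_def by metis
  show thesis
  proof (rule that[OF J])
    fix x
    have "ip (ap (W z n) x) (ap (W z n) x) = ip x x" for n
      using W_unitary(2)[OF z, of n] by (metis W_cadj ap_simps(2,7) cadj_ip)
    then have "(\<lambda>n. ip x x) \<longlonglongrightarrow> ip (J x) (J x)"
      using tendsto_ip[OF J J, of x x] by simp
    then show "ip (J x) (J x) = ip x x" by (rule LIMSEQ_unique[OF _ tendsto_const])
    fix U assume U: "U \<in> G"
    have "(\<lambda>n. ip (inv U x) (ap (W' z n) \<xi>)) \<longlonglongrightarrow> ip (inv U x) (\<zeta> z)"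
      by (intro tendsto_ip tendsto_const zeta_tendsto z)
    moreover have "ip (inv U x) (ap (W' z n) \<xi>) = ip (ap (W z n) x) (U \<xi>)" for n
      by (simp only: ip_G'[OF U, symmetric] cadj_commute[OF cadj_sym[OF W_cadj] U, symmetric]
          cadj_ip[OF W_cadj])
    ultimately have "(\<lambda>n. ip (ap (W z n) x) (U \<xi>)) \<longlonglongrightarrow> ip x (U (\<zeta> z))"
      by (simp add: ip_G'[OF U])
    then show "ip x (U (\<zeta> z)) = ip (J x) (U \<xi>)"
      using LIMSEQ_unique tendsto_ip[OF J tendsto_const] by blast
  qed
qed

lemma PF_zeta: "cmod z = 1 \<Longrightarrow> PF (\<zeta> z)"
  using W_strong_limit[of z] PF_transport[OF PF_\<xi>] by metis

lemma path_zeta: "path_component {\<zeta>. PF \<zeta>} \<xi> (\<zeta> (-1))"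
  unfolding path_component_def
proof (intro exI conjI)
  let ?g = "\<lambda>t::real. \<zeta> (cis (pi * t))"
  show "path ?g"
    unfolding path_def
    by (rule continuous_on_compose2[OF continuous_zeta]) (auto intro!: continuous_intros)
  show "path_image ?g \<subseteq> {\<zeta>. PF \<zeta>}" by (auto simp: path_image_def PF_zeta)
  show "pathstart ?g = \<xi>" by (simp add: pathstart_def zeta_1)
  show "pathfinish ?g = \<zeta> (-1)" by (simp add: pathfinish_def)
qed

text \<open>\<open>C n\<close> commutes with \<open>E n\<close>, so its form splits. The complement
  contributes the bound \<open>- threshold n\<close>, the range of \<open>E n\<close> only
  \<open>-1\<close>; the subtracted term pays for the latter and tends to 0.\<close>

lemma C_form_lower: "- ((3/4) *\<^sub>R ip x x) - ip (ap (E n) x) (ap (E n) x) \<preceq> ip (ap (C n) x) x"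
proof -
  let ?y = "ap (E n) x" and ?w = "ap (1 - E n) x"
  have C: "cadj (C n) (C n)" by (rule C_cadj)
  have Ew: "ap (E n) ?w = 0" by (simp add: ap.diff_right E_E)
  have "ip (ap (C n) ?y) ?w = ip (ap (E n * C n) x) ?w"
    unfolding E_comm by simp
  also have "\<dots> = 0" by (simp only: ap_simps(7) cadj_ip[OF E_cadj] Ew ip_zero)
  finally have 1: "ip (ap (C n) ?y) ?w = 0" .
  then have 2: "ip (ap (C n) ?w) ?y = 0"
    by (metis C cadj_ip star_ip star_zero)
  have 3: "ip ?y ?w = 0" "ip ?w ?y = 0"
    by (simp_all only: cadj_ip[OF E_cadj] Ew ip_zero cadj_ip[OF E_cadj, symmetric])
  have x: "x = ?y + ?w" by simp
  have Cx: "ip (ap (C n) x) x = ip (ap (C n) ?y) ?y + ip (ap (C n) ?w) ?w"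
    by (subst (1 2) x) (simp only: ap.add_right ip_add_left ip_add_right 1 2, simp)
  have xx: "ip x x = ip ?y ?y + ip ?w ?w"
    by (subst (1 2) x) (simp only: ip_add_left ip_add_right 3, simp)
  have "- ip ?y ?y \<preceq> ip (ap (C n) ?y) ?y"
  proof -
    have "norm (- C n) \<le> 1" using C_norm[of n] by simp
    from contraction_positive[OF adj_intros(5)[OF cadj_adj[OF C]] this, of ?y]
    have "- ip (ap (C n) ?y) ?y \<preceq> ip ?y ?y" by (simp only: ap_simps(5) ip_minus_left)
    then show ?thesis by (simp add: cle_def add.commute)
  qed
  moreover have "- (threshold n *\<^sub>R ip ?w ?w) \<preceq> ip (ap (C n) ?w) ?w"
    by (rule E_lower)
  ultimately have "- ip ?y ?y + - (threshold n *\<^sub>R ip ?w ?w) \<preceq> ip (ap (C n) x) x"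
    unfolding Cx by (rule cle_add)
  moreover have "- ((3/4) *\<^sub>R ip x x) - ip ?y ?y \<preceq> - ip ?y ?y + - (threshold n *\<^sub>R ip ?w ?w)"
  proof -
    have "cstar_positive ((3/4) *\<^sub>R ip ?y ?y + (3/4 - threshold n) *\<^sub>R ip ?w ?w)"
      using threshold_bounds(2)[of n] by (intro cstar_positive_add cstar_positive_scaleR ip_positive) simp_all
    moreover have "- ip ?y ?y + - (threshold n *\<^sub>R ip ?w ?w) - (- ((3/4) *\<^sub>R ip x x) - ip ?y ?y)
        = (3/4) *\<^sub>R ip ?y ?y + (3/4 - threshold n) *\<^sub>R ip ?w ?w"
      unfolding xx by (simp only: scaleR_add_right scaleR_diff_left) simp
    ultimately show ?thesis unfolding cle_def by (simp only:)
  qed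
  ultimately show ?thesis by (rule cle_trans[rotated])
qed

lemma E_tendsto_0: "(\<lambda>n. ap (E n) x) \<longlonglongrightarrow> 0"
proof (rule tendstoI)
  fix \<epsilon> :: real assume "\<epsilon> > 0"
  then obtain \<delta> where \<delta>: "\<delta> > 0"
    "\<And>X X'. cadj X X' \<Longrightarrow> norm X \<le> 1 \<Longrightarrow> norm (ap X \<xi>) < \<delta> \<Longrightarrow> norm (ap X x) < \<epsilon>"
    using commutant_small[OF PF_\<xi>, of \<epsilon> 1 x] by blast
  have "(\<lambda>n. norm (\<tau> n)) \<longlonglongrightarrow> 0"
    using tendsto_norm[OF summable_LIMSEQ_zero[OF summable_tau]] by simp
  then have "\<forall>\<^sub>F n in sequentially. norm (\<tau> n) < \<delta>\<^sup>2"
    by (rule order_tendstoD(2)) (use \<delta>(1) in \<open>simp add: zero_less_power\<close>)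
  then show "\<forall>\<^sub>F n in sequentially. dist (ap (E n) x) 0 < \<epsilon>"
  proof (rule eventually_mono)
    fix n assume "norm (\<tau> n) < \<delta>\<^sup>2"
    then have "norm (ap (E n) \<xi>) < \<delta>"
      by (intro power2_less_imp_less[OF _ less_imp_le[OF \<delta>(1)]]) (simp add: norm_ip_self)
    moreover have "norm (E n) \<le> 1"
    proof (rule norm_le_of_form_le[OF cadj_adj[OF E_cadj]])
      fix y
      have eq: "ip (ap (E n) y) y = ip (ap (E n) y) (ap (E n) y)"
        by (simp add: cadj_ip[OF E_cadj, symmetric] E_E)
      then show "cstar_positive (ip (ap (E n) y) y)" by (simp add: ip_positive)
      have "cstar_positive (ip (y - ap (E n) y) (y - ap (E n) y))" by (rule ip_positive)
      also have "ip (y - ap (E n) y) (y - ap (E n) y) = ip y y - ip (ap (E n) y) y"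
        by (simp add: ip_diff_left ip_diff_right cadj_ip[OF E_cadj] E_E)
      finally show "ip (ap (E n) y) y \<preceq> 1 *\<^sub>R ip y y" by (simp add: cle_def)
    qed simp
    ultimately show "dist (ap (E n) x) 0 < \<epsilon>" using \<delta>(2)[OF E_cadj] by simp
  qed
qed

text \<open>The cross operator from \<open>\<zeta> (-1)\<close> to \<eta> is the strong limit of the
  \<open>K V n\<close>, so \<open>C_form_lower\<close> passes to the limit; \<open>3/2\<close> is
  twice \<open>3/4\<close>.\<close>

lemma zeta_form_lower:
  "- ((3/2) *\<^sub>R ip x x) \<preceq> ip (ap (cross (\<zeta> (-1)) \<eta> + cross \<eta> (\<zeta> (-1))) x) x"
proof -
  let ?K = "cross \<xi> \<eta>"
  have z: "cmod (-1) = 1" by simp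
  obtain J where J: "\<And>x. (\<lambda>n. ap (W (-1) n) x) \<longlonglongrightarrow> J x"
    "\<And>x U. U \<in> G \<Longrightarrow> ip x (U (\<zeta> (-1))) = ip (J x) (U \<xi>)"
    by (rule W_strong_limit[OF z]) blast
  have PFz: "PF (\<zeta> (-1))" by (rule PF_zeta[OF z])
  have "ap (cross (\<zeta> (-1)) \<eta>) x = ap ?K (J x)"
    unfolding ap_cross[OF PFz PF_\<eta>] ap_cross[OF PF_\<xi> PF_\<eta>] synthesis_def
    by (rule infsum_cong) (simp add: J(2))
  then have "(\<lambda>n. ap (?K * V n) x) \<longlonglongrightarrow> ap (cross (\<zeta> (-1)) \<eta>) x"
    using ap.tendsto[OF tendsto_const J(1), of ?K x] by (simp add: W_minus_1)
  then have 1: "(\<lambda>n. ip (ap (?K * V n) x) x + star (ip (ap (?K * V n) x) x))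
      \<longlonglongrightarrow> ip (ap (cross (\<zeta> (-1)) \<eta>) x) x + star (ip (ap (cross (\<zeta> (-1)) \<eta>) x) x)"
    by (intro tendsto_add tendsto_star tendsto_ip tendsto_const)
  have "(\<lambda>n. 2 *\<^sub>R (- ((3/4) *\<^sub>R ip x x) - ip (ap (E n) x) (ap (E n) x))) \<longlonglongrightarrow> 2 *\<^sub>R (- ((3/4) *\<^sub>R ip x x) - ip 0 0)"
    by (intro tendsto_scaleR tendsto_diff tendsto_const tendsto_ip E_tendsto_0)
  then have 2: "(\<lambda>n. 2 *\<^sub>R (- ((3/4) *\<^sub>R ip x x) - ip (ap (E n) x) (ap (E n) x))) \<longlonglongrightarrow> - ((3/2) *\<^sub>R ip x x)"
    by simp
  have "2 *\<^sub>R ip (ap (C n) x) x = ip (ap (?K * V n) x) x + star (ip (ap (?K * V n) x) x)" for n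
  proof -
    have "cadj (?K * V n) (V' n * cross \<eta> \<xi>)"
      by (intro cadj_intros cadj_cross PF_\<xi> PF_\<eta> V_cadj)
    then have "star (ip (ap (?K * V n) x) x) = ip (ap (V' n * cross \<eta> \<xi>) x) x"
      by (metis cadj_ip cadj_sym star_ip)
    then show ?thesis by (simp add: half_re_def ip_simps)
  qed
  then have "2 *\<^sub>R (- ((3/4) *\<^sub>R ip x x) - ip (ap (E n) x) (ap (E n) x))
      \<preceq> ip (ap (?K * V n) x) x + star (ip (ap (?K * V n) x) x)" for n
    using cle_scaleR[OF _ C_form_lower, of 2 x n] by simp
  from cle_tendsto[OF 2 1 _ this]
  have "- ((3/2) *\<^sub>R ip x x) \<preceq> ip (ap (cross (\<zeta> (-1)) \<eta>) x) x + star (ip (ap (cross (\<zeta> (-1)) \<eta>) x) x)"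
    by simp
  moreover have "star (ip (ap (cross (\<zeta> (-1)) \<eta>) x) x) = ip (ap (cross \<eta> (\<zeta> (-1))) x) x"
    by (metis PFz PF_\<eta> cadj_cross cadj_ip star_ip)
  ultimately show ?thesis by (simp add: ip_add_left)
qed

end

section \<open>Normalizing the segment between two frame vectors\<close>

context group_frames
begin

lemma isqrt_cadj:
  assumes d: "cadj d d" and q: "norm d \<le> q" "q < 1"
  shows "cadj (isqrt d) (isqrt d)" "isqrt d * d = d * isqrt d"
proof -
  have closed: "closed {X. X * d = d * X}"
    by (intro closed_Collect_eq continuous_intros)
  have closed': "closed {X. \<forall>U\<in>G. \<forall>x. ap X (U x) = U (ap X x)}"
  proof -
    have *: "{X. \<forall>U\<in>G. \<forall>x. ap X (U x) = U (ap X x)} = (\<Inter>U\<in>G. {X. \<forall>x. ap X (U x) = U (ap X x)})"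
      by auto
    show ?thesis unfolding * by (intro closed_INT ballI closed_commute_map G_continuous)
  qed
  let ?S = "{X. adj X X} \<inter> {X. \<forall>U\<in>G. \<forall>x. ap X (U x) = U (ap X x)} \<inter> {X. X * d = d * X}"
  have S: "?S = {X. cadj X X \<and> X * d = d * X}" by (auto simp: cadj_def)
  have "isqrt d \<in> ?S"
  proof (rule isqrt_in_closed[OF norm_one_endo q])
    show "closed ?S" by (intro closed_Int closed_adj_self closed closed')
    show "x * d \<in> ?S" if "x \<in> ?S" for x
      using that cadj_intros(6)[OF _ d, of x x] unfolding S by (auto simp: mult.assoc)
    show "x + y \<in> ?S" if "x \<in> ?S" "y \<in> ?S" for x y
      using that cadj_intros(3)[of x x y y] unfolding S by (auto simp: distrib_left distrib_right)
    show "r *\<^sub>R x \<in> ?S" if "x \<in> ?S" for r x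
      using that cadj_intros(7)[of x x r] unfolding S by auto
  qed (simp_all add: S cadj_intros)
  then show "cadj (isqrt d) (isqrt d)" "isqrt d * d = d * isqrt d" by (auto simp: S)
qed

lemma isqrt_0: "isqrt (0 :: 'h endo) = 1"
proof -
  have "isqrt_coeff k *\<^sub>R (0 :: 'h endo) ^ k = 0" if "k \<notin> {0}" for k
    using that by (cases k) simp_all
  then have "isqrt (0 :: 'h endo) = (\<Sum>k\<in>{0}. isqrt_coeff k *\<^sub>R (0 :: 'h endo) ^ k)"
    unfolding isqrt_def by (intro suminf_finite) auto
  then show ?thesis by (simp add: isqrt_coeff_def)
qed

text \<open>The frame operator of \<open>v\<close> is \<open>1 - d\<close>. Since
  \<open>R = isqrt d\<close> commutes with \<open>G\<close>, that of \<open>R v\<close> is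
  \<open>R (1 - d) R = 1\<close>.\<close>

lemma PF_normalize:
  assumes v: "\<And>x. ((\<lambda>U. ip x (U v) * ip (U v) x) has_sum ip (ap (1 - d) x) x) G"
    and G: "countable G" and d: "cadj d d" and q: "norm d \<le> q" "q < 1"
  shows "PF (ap (isqrt d) v)"
  unfolding complete_parseval_frame_vector_def parseval_frame_def
proof (intro conjI allI G)
  fix x
  let ?R = "isqrt d"
  note R = isqrt_cadj[OF d q]
  have RU: "ip x (U (ap ?R v)) = ip (ap ?R x) (U v)" if "U \<in> G" for U
    by (simp only: cadj_ip[OF R(1)] cadj_commute[OF R(1) that])
  have "ip (ap (1 - d) (ap ?R x)) (ap ?R x) = ip (ap (?R * ?R * (1 - d)) x) x"
  proof -
    have "?R * ?R * (1 - d) = ?R * ((1 - d) * ?R)"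
      by (simp add: algebra_simps mult.assoc R(2))
    then show ?thesis by (simp add: cadj_ip[OF R(1)])
  qed
  then have "((\<lambda>U. ip (ap ?R x) (U v) * ip (U v) (ap ?R x)) has_sum ip x x) G"
    using v[of "ap ?R x"] by (simp add: isqrt_square[OF norm_one_endo q])
  moreover have "ip (ap ?R x) (U v) * ip (U v) (ap ?R x) = ip x (U (ap ?R v)) * ip (U (ap ?R v)) x" if "U \<in> G" for U
    using RU[OF that] by (metis star_ip)
  ultimately show "((\<lambda>U. ip x (U (ap ?R v)) * ip (U (ap ?R v)) x) has_sum ip x x) G"
    by (rule has_sum_cong[THEN iffD1, rotated])
qed

text \<open>The segment from \<open>\<zeta>\<close> to \<open>\<eta>\<close> stays away from vectors with degenerate frame operator.\<close>

lemma path_component_of_form_lower: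
  assumes \<zeta>: "PF \<zeta>" and \<eta>: "PF \<eta>"
    and le: "\<And>x. - ((3/2) *\<^sub>R ip x x) \<preceq> ip (ap (cross \<zeta> \<eta> + cross \<eta> \<zeta>) x) x"
  shows "path_component {\<zeta>. PF \<zeta>} \<zeta> \<eta>"
  unfolding path_component_def
proof (intro exI conjI)
  let ?H = "cross \<zeta> \<eta> + cross \<eta> \<zeta>"
  define v where "v t = (1 - t) *\<^sub>R \<zeta> + t *\<^sub>R \<eta>" for t
  \<comment> \<open>The frame operator of \<open>v t\<close> is \<open>1 - d t\<close>, because
    \<open>(1 - t)^2 + t^2 = 1 - 2 t (1 - t)\<close>.\<close>
  define d where "d t = (t * (1 - t)) *\<^sub>R (2 *\<^sub>R 1 - ?H)" for t
  have H: "cadj ?H ?H"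
    using cadj_intros(3)[OF cadj_cross[OF \<zeta> \<eta>] cadj_cross[OF \<eta> \<zeta>]] by (simp add: add.commute)
  have d: "cadj (d t) (d t)" for t unfolding d_def by (intro cadj_intros H)
  have nd: "norm (d t) \<le> 7/8" if t: "t \<in> {0..1}" for t
  proof (rule norm_le_of_form_le[OF cadj_adj[OF d]])
    fix x
    have t0: "0 \<le> t * (1 - t)" using t by simp
    \<comment> \<open>\<open>2 - H\<close> is at most \<open>2 + 3/2 = 7/2\<close> and
      \<open>t (1 - t)\<close> at most \<open>1/4\<close>; this leaves the margin \<open>1/8\<close>
      for the frame operator.\<close>
    have t1: "t * (1 - t) * (7/2) \<le> 7/8"
      using zero_le_power2[of "t - 1/2"] by (simp add: power2_eq_square algebra_simps)
    have dt: "ip (ap (d t) x) x = (t * (1 - t)) *\<^sub>R (2 *\<^sub>R ip x x - ip (ap ?H x) x)"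
      by (simp add: d_def ip_simps)
    have "norm ((1/2) *\<^sub>R ?H) \<le> 1"
      using norm_triangle_mono[OF norm_cross[OF \<zeta> \<eta>] norm_cross[OF \<eta> \<zeta>]] by simp
    from contraction_positive[OF cadj_adj[OF cadj_intros(7)[OF H]] this, of x]
    have "(1/2) *\<^sub>R ip (ap ?H x) x \<preceq> ip x x" by (simp add: ip_simps)
    from cle_scaleR[OF _ this, of 2]
    have "ip (ap ?H x) x \<preceq> 2 *\<^sub>R ip x x" by simp
    then show "cstar_positive (ip (ap (d t) x) x)"
      unfolding dt by (intro cstar_positive_scaleR t0) (simp add: cle_def)
    have "2 *\<^sub>R ip x x - ip (ap ?H x) x \<preceq> (7/2) *\<^sub>R ip x x"
    proof -
      have "(7/2) *\<^sub>R ip x x = 2 *\<^sub>R ip x x + (3/2) *\<^sub>R ip x x"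
        by (simp flip: scaleR_add_left)
      then show ?thesis using le[of x] by (simp add: cle_def add.commute)
    qed
    from cle_scaleR[OF t0 this] have "ip (ap (d t) x) x \<preceq> (t * (1 - t) * (7/2)) *\<^sub>R ip x x"
      unfolding dt by simp
    also have "\<dots> \<preceq> (7/8) *\<^sub>R ip x x"
      using cstar_positive_scaleR[OF _ ip_positive, of "7/8 - t * (1 - t) * (7/2)" x] t1
      by (simp add: cle_def scaleR_diff_left)
    finally show "ip (ap (d t) x) x \<preceq> (7/8) *\<^sub>R ip x x" .
  qed simp
  have vs: "((\<lambda>U. ip x (U (v t)) * ip (U (v t)) x) has_sum ip (ap (1 - d t) x) x) G" for x t
  proof -
    let ?s = "1 - t"
    have "((\<lambda>U. (?s * ?s) *\<^sub>R (ip x (U \<zeta>) * ip (U \<zeta>) x) + (t * t) *\<^sub>R (ip x (U \<eta>) * ip (U \<eta>) x)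
        + (t * ?s) *\<^sub>R (ip x (U \<zeta>) * ip (U \<eta>) x + ip x (U \<eta>) * ip (U \<zeta>) x)) has_sum
        (?s * ?s) *\<^sub>R ip x x + (t * t) *\<^sub>R ip x x
        + (t * ?s) *\<^sub>R (ip (ap (cross \<zeta> \<eta>) x) x + ip (ap (cross \<eta> \<zeta>) x) x)) G"
      by (intro has_sum_add has_sum_scaleR PF_has_sum ip_cross \<zeta> \<eta>)
    also have "(?s * ?s) *\<^sub>R ip x x + (t * t) *\<^sub>R ip x x
        + (t * ?s) *\<^sub>R (ip (ap (cross \<zeta> \<eta>) x) x + ip (ap (cross \<eta> \<zeta>) x) x) = ip (ap (1 - d t) x) x"
    proof -
      have "?s * ?s + t * t = 1 - t * ?s * 2" by (simp add: algebra_simps)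
      then have "(?s * ?s) *\<^sub>R ip x x + (t * t) *\<^sub>R ip x x = ip x x - (t * ?s * 2) *\<^sub>R ip x x"
        by (simp only: scaleR_add_left[symmetric]) (simp add: scaleR_diff_left)
      then show ?thesis by (simp add: d_def ip_simps scaleR_diff_right)
    qed
    finally show ?thesis
    proof (rule has_sum_cong[THEN iffD1, rotated])
      fix U assume U: "U \<in> G"
      have "U (v t) = ?s *\<^sub>R U \<zeta> + t *\<^sub>R U \<eta>"
        by (simp add: v_def linear_add[OF G_linear[OF U]] linear_scale[OF G_linear[OF U]])
      then show "(?s * ?s) *\<^sub>R (ip x (U \<zeta>) * ip (U \<zeta>) x) + (t * t) *\<^sub>R (ip x (U \<eta>) * ip (U \<eta>) x)
        + (t * ?s) *\<^sub>R (ip x (U \<zeta>) * ip (U \<eta>) x + ip x (U \<eta>) * ip (U \<zeta>) x) = ip x (U (v t)) * ip (U (v t)) x"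
        by (simp only: ip_simps distrib_left distrib_right mult_scaleR_left mult_scaleR_right
            scaleR_add_right scaleR_scaleR) (simp add: mult_ac add_ac)
    qed
  qed
  let ?g = "\<lambda>t. ap (isqrt (d t)) (v t)"
  have cd: "continuous_on {0..1} d" unfolding d_def by (intro continuous_intros)
  have cv: "continuous_on {0..1} v" unfolding v_def by (intro continuous_intros)
  show "path ?g"
    unfolding path_def
    by (intro ap.continuous_on continuous_on_isqrt[OF norm_one_endo nd _ _ cd] cv) simp_all
  show "path_image ?g \<subseteq> {\<zeta>. PF \<zeta>}"
    unfolding path_image_def
    by (auto intro!: PF_normalize[OF vs PF_countable[OF \<zeta>] d nd])
  have "d 0 = 0" "d 1 = 0" by (simp_all add: d_def)
  then show "pathstart ?g = \<zeta>" "pathfinish ?g = \<eta>"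
    by (simp_all add: pathstart_def pathfinish_def isqrt_0 v_def)
qed

end

context dual_group_frames
begin

lemma path_component_PF:
  assumes \<eta>: "PF \<eta>"
  shows "path_component {\<zeta>. PF \<zeta>} \<xi> \<eta>"
proof (rule greedy_reflections[OF \<eta>])
  fix E V V' assume g: "V 0 = 1"
    "\<And>n. V (Suc n) = V n * (1 - 2 *\<^sub>R E n)" "\<And>n. V' (Suc n) = (1 - 2 *\<^sub>R E n) * V' n"
    "\<And>n. cadj (V n) (V' n)" "\<And>n. V n * V' n = 1" "\<And>n. V' n * V n = 1"
    "\<And>n. cut (half_re \<eta> (V n) (V' n)) (threshold n) (E n)"
  then interpret reflection_sequence act ip e G L \<xi> \<eta> E V V'
    by unfold_locales (rule \<eta> g)+
  have "PF (\<zeta> (-1))" by (rule PF_zeta) simp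
  from path_component_of_form_lower[OF this \<eta> zeta_form_lower]
  show ?thesis by (rule path_component_trans[OF path_zeta])
qed

end

theorem corollary3p3:
  fixes act :: "'a::{cstar_algebra, comm_ring} \<Rightarrow> 'h::complex_banach \<Rightarrow> 'h"
    and ip :: "'h \<Rightarrow> 'h \<Rightarrow> 'a"
    and G :: "('h \<Rightarrow> 'h) set"
  assumes "wstar_algebra_with_predual TYPE('a) TYPE('p::complex_banach)"
    and "hilbert_module act ip"
    and "finitely_generated act \<or> countably_generated act"
    and "unitary_group ip G"
    and "l2_self_dual TYPE('a) G"
  shows "path_connected {\<xi>. complete_parseval_frame_vector ip G \<xi>}"
proof -
  have "id \<in> G" using assms(4) by (simp add: unitary_group_def)
  then obtain e :: 'a where e: "\<And>a. e * a = a"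
    using self_dual_imp_unit[OF assms(5)] by blast
  obtain L :: "(nat \<Rightarrow> 'a) \<Rightarrow> 'a" where L:
    "\<And>s t. Bseq s \<Longrightarrow> Bseq t \<Longrightarrow> L (\<lambda>n. s n + t n) = L s + L t"
    "\<And>c s. Bseq s \<Longrightarrow> L (\<lambda>n. c *\<^sub>C s n) = c *\<^sub>C L s"
    "\<And>s b r. Bseq s \<Longrightarrow> (\<forall>\<^sub>F n in sequentially. norm (s n - b) \<le> r) \<Longrightarrow> norm (L s - b) \<le> r"
    using predual_generalized_limit[OF assms(1)] by blast
  have "path_component {\<xi>. complete_parseval_frame_vector ip G \<xi>} \<xi> \<eta>"
    if "complete_parseval_frame_vector ip G \<xi>" "complete_parseval_frame_vector ip G \<eta>" for \<xi> \<eta>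
  proof -
    interpret unital_cstar e by standard (rule e)
    interpret generalized_limit e L by standard (fact L)+
    interpret comm_hilbert_module act ip e
      unfolding comm_hilbert_module_def using assms(2) unital_cstar_axioms by blast
    interpret group_frames act ip e G by standard (rule assms(4))
    interpret dual_group_frames act ip e G L \<xi> by standard (fact assms(5) that(1))+
    show ?thesis by (rule path_component_PF[OF that(2)])
  qed
  then show ?thesis unfolding path_connected_component by blast
qed

end
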